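(* Let $f:M\to N$ be a holomorphic map between compact complex manifolds. If $\mathcal O_{T^*_M}(-1)$ is RC-positive and $\mathcal O_{T^*_N}(1)$ is nef, then $f$ is a constant map.
   Context: Manifolds are connected. For a complex manifold $X$, $\mathbb P(T_X)\to X$ is the bundle whose fiber over $p$ is the set of complex lines in $T_pX=T^{1,0}_pX$; $\mathcal O_{T^*_X}(-1)$ is the tautological line bundle on $\mathbb P(T_X)$ whose fiber at $(p,[W])$ is the line $\mathbb CW\subset T_pX$, and $\mathcal O_{T^*_X}(1)$ is its dual. A holomorphic line bundle $\mathscr L$ over a complex manifold $Y$ is RC-positive if it admits a smooth Hermitian metric $h^{\mathscr L}$ such that its Chern curvature $-\sqrt{-1}\,\partial\bar\partial\log h^{\mathscr L}$ has at least one positive eigenvalue at every point of $Y$. A holomorphic line bundle $\mathscr L$ over a compact complex manifold $Y$ with a fixed Hermitian metric $\omega$ is nef if for every $\varepsilon>0$ there is a smooth Hermitian metric $h_\varepsilon$ on $\mathscr L$ with $-\sqrt{-1}\,\partial\bar\partial\log h_\varepsilon\ge-\varepsilon\omega$. *)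

theory Defs
  imports "HOL-Analysis.Analysis" "Jordan_Normal_Form.Char_Poly"
begin

section \<open>Calculus on open subsets of complex coordinate space\<close>

text \<open>
  The dimension has to be a natural number inside the formulas, since a manifold of dimension
  \<open>n\<close> is used together with its projectivized tangent bundle, of dimension \<open>2 * n - 1\<close>.
  As for \<^const>\<open>Euclidean_space\<close>, the space of complex \<open>n\<close>-tuples consists of the sequences
  that vanish from index \<open>n\<close> on, with the topology of pointwise convergence.
\<close>

type_synonym cvec = "nat \<Rightarrow> complex"

definition Cspace :: "nat \<Rightarrow> cvec set" where
  "Cspace n = {v. \<forall>i\<ge>n. v i = 0}"

text \<open>Real partial derivative of \<open>g\<close> at \<open>v\<close> in the \<open>j\<close>-th complex variable \<open>z = x + \<i> y\<close>, in the
  direction \<open>u\<close>: \<open>u = 1\<close> gives the derivative in \<open>x\<close> and \<open>u = \<i>\<close> the derivative in \<open>y\<close>.\<close>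

definition pderiv_dir :: "nat \<Rightarrow> complex \<Rightarrow> (cvec \<Rightarrow> complex) \<Rightarrow> cvec \<Rightarrow> complex" where
  "pderiv_dir j u g v =
     vector_derivative (\<lambda>t::real. g (v(j := v j + of_real t * u))) (at 0)"

text \<open>The class \<open>C\<^sup>k\<close> on \<open>U\<close>, which is meant to be an open subset of \<^term>\<open>Cspace n\<close>.\<close>

primrec Ck_on :: "nat \<Rightarrow> nat \<Rightarrow> cvec set \<Rightarrow> (cvec \<Rightarrow> complex) \<Rightarrow> bool" where
  "Ck_on n 0 U g \<longleftrightarrow> continuous_on U g"
| "Ck_on n (Suc k) U g \<longleftrightarrow> continuous_on U g \<and>
     (\<forall>j<n. \<forall>u\<in>{1, \<i>}.
        (\<forall>v\<in>U. (\<lambda>t::real. g (v(j := v j + of_real t * u))) differentiable at 0) \<and>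
        Ck_on n k U (pderiv_dir j u g))"

definition smooth_on :: "nat \<Rightarrow> cvec set \<Rightarrow> (cvec \<Rightarrow> complex) \<Rightarrow> bool" where
  "smooth_on n U g \<longleftrightarrow> (\<forall>k. Ck_on n k U g)"

text \<open>Wirtinger derivatives.\<close>

definition dz :: "nat \<Rightarrow> (cvec \<Rightarrow> complex) \<Rightarrow> cvec \<Rightarrow> complex" where
  "dz j g v = (pderiv_dir j 1 g v - \<i> * pderiv_dir j \<i> g v) / 2"

definition dzbar :: "nat \<Rightarrow> (cvec \<Rightarrow> complex) \<Rightarrow> cvec \<Rightarrow> complex" where
  "dzbar j g v = (pderiv_dir j 1 g v + \<i> * pderiv_dir j \<i> g v) / 2"

definition holo_on :: "nat \<Rightarrow> cvec set \<Rightarrow> (cvec \<Rightarrow> complex) \<Rightarrow> bool" where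
  "holo_on n U g \<longleftrightarrow> smooth_on n U g \<and> (\<forall>j<n. \<forall>v\<in>U. dzbar j g v = 0)"


section \<open>Complex manifolds and holomorphic maps\<close>

text \<open>A chart is a pair of its domain and its coordinate map.\<close>

type_synonym 'a chart = "'a set \<times> ('a \<Rightarrow> cvec)"

record 'a cmanifold =
  mtop :: "'a topology"
  mdim :: nat
  atlas :: "'a chart set"

abbreviation chart_inv :: "'a chart \<Rightarrow> cvec \<Rightarrow> 'a" where
  "chart_inv c \<equiv> inv_into (fst c) (snd c)"

definition complex_manifold :: "'a cmanifold \<Rightarrow> bool" where
  "complex_manifold X \<longleftrightarrow>
     connected_space (mtop X) \<and> Hausdorff_space (mtop X) \<and> second_countable (mtop X) \<and>
     \<Union>(fst ` atlas X) = topspace (mtop X) \<and>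
     (\<forall>(U, \<phi>)\<in>atlas X.
        openin (mtop X) U \<and>
        openin (top_of_set (Cspace (mdim X))) (\<phi> ` U) \<and>
        homeomorphic_map (subtopology (mtop X) U) (top_of_set (\<phi> ` U)) \<phi>) \<and>
     (\<forall>c\<in>atlas X. \<forall>c'\<in>atlas X. \<forall>j<mdim X.
        holo_on (mdim X) (snd c ` (fst c \<inter> fst c')) (\<lambda>v. snd c' (chart_inv c v) j))"

definition holomorphic_map :: "'a cmanifold \<Rightarrow> 'b cmanifold \<Rightarrow> ('a \<Rightarrow> 'b) \<Rightarrow> bool" where
  "holomorphic_map X Y f \<longleftrightarrow>
     continuous_map (mtop X) (mtop Y) f \<and>
     (\<forall>c\<in>atlas X. \<forall>c'\<in>atlas Y. \<forall>j<mdim Y.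
        holo_on (mdim X) (snd c ` {p \<in> fst c. f p \<in> fst c'})
          (\<lambda>v. snd c' (f (chart_inv c v)) j))"

text \<open>Smoothness of a function on an open subset \<open>V\<close> of a manifold.\<close>

definition smooth_fun :: "'a cmanifold \<Rightarrow> 'a set \<Rightarrow> ('a \<Rightarrow> complex) \<Rightarrow> bool" where
  "smooth_fun X V g \<longleftrightarrow>
     (\<forall>c\<in>atlas X. smooth_on (mdim X) (snd c ` (fst c \<inter> V)) (\<lambda>v. g (chart_inv c v)))"


section \<open>The holomorphic tangent bundle\<close>

text \<open>
  A tangent vector \<open>W\<close> of type \<open>(1,0)\<close> at \<open>p\<close> is the family of its components in all charts
  around \<open>p\<close>, related by the holomorphic Jacobian matrices of the coordinate changes:
  \<open>W (c, j)\<close> is the coefficient of \<open>\<partial>/\<partial>z\<^sub>j\<close> in the chart \<open>c\<close> (and \<open>0\<close> where this makes no sense).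
\<close>

type_synonym 'a tvec = "'a chart \<times> nat \<Rightarrow> complex"

text \<open>Entry \<open>\<partial>z'\<^sub>j/\<partial>z\<^sub>i\<close> at \<open>p\<close> of the Jacobian of the change from chart \<open>c\<close> to chart \<open>c'\<close>.\<close>

definition jac :: "'a chart \<Rightarrow> 'a chart \<Rightarrow> 'a \<Rightarrow> nat \<Rightarrow> nat \<Rightarrow> complex" where
  "jac c c' p j i = dz i (\<lambda>v. snd c' (chart_inv c v) j) (snd c p)"

definition tangent_space :: "'a cmanifold \<Rightarrow> 'a \<Rightarrow> 'a tvec set" where
  "tangent_space X p = {W.
     (\<forall>c j. c \<notin> atlas X \<or> p \<notin> fst c \<or> j \<ge> mdim X \<longrightarrow> W (c, j) = 0) \<and>
     (\<forall>c\<in>atlas X. \<forall>c'\<in>atlas X. p \<in> fst c \<and> p \<in> fst c' \<longrightarrow>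
        (\<forall>j<mdim X. W (c', j) = (\<Sum>i<mdim X. jac c c' p j i * W (c, i))))}"

text \<open>The coordinate vector \<open>\<partial>/\<partial>z\<^sub>i\<close> of the chart \<open>c\<close> at \<open>p\<close>.\<close>

definition coord_vec :: "'a cmanifold \<Rightarrow> 'a chart \<Rightarrow> 'a \<Rightarrow> nat \<Rightarrow> 'a tvec" where
  "coord_vec X c p i =
     (\<lambda>(c', j). if c' \<in> atlas X \<and> p \<in> fst c' \<and> j < mdim X then jac c c' p j i else 0)"

definition hermitian_inner :: "('s \<Rightarrow> complex) set \<Rightarrow>
    (('s \<Rightarrow> complex) \<Rightarrow> ('s \<Rightarrow> complex) \<Rightarrow> complex) \<Rightarrow> bool" where
  "hermitian_inner E h \<longleftrightarrow>
     (\<forall>u\<in>E. \<forall>v\<in>E. \<forall>w\<in>E. h (\<lambda>s. u s + v s) w = h u w + h v w) \<and>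
     (\<forall>a. \<forall>u\<in>E. \<forall>v\<in>E. h (\<lambda>s. a * u s) v = a * h u v) \<and>
     (\<forall>u\<in>E. \<forall>v\<in>E. h v u = cnj (h u v)) \<and>
     (\<forall>u\<in>E. u \<noteq> (\<lambda>s. 0) \<longrightarrow> Re (h u u) > 0)"

definition manifold_metric ::
    "'a cmanifold \<Rightarrow> ('a \<Rightarrow> 'a tvec \<Rightarrow> 'a tvec \<Rightarrow> complex) \<Rightarrow> bool" where
  "manifold_metric X \<omega> \<longleftrightarrow>
     (\<forall>p\<in>topspace (mtop X). hermitian_inner (tangent_space X p) (\<omega> p)) \<and>
     (\<forall>c\<in>atlas X. \<forall>i<mdim X. \<forall>j<mdim X.
        smooth_fun X (fst c) (\<lambda>p. \<omega> p (coord_vec X c p i) (coord_vec X c p j)))"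


section \<open>Line bundles, RC-positivity and nefness\<close>

text \<open>
  The fibres of a line bundle are realized as one-dimensional linear subspaces of a space of
  complex-valued functions, with pointwise operations. The holomorphic structure is given by a
  family of local holomorphic frames (pairs of an open set and a nowhere vanishing section over
  it), whose domains cover the base.
\<close>

record ('a, 's) line_bundle =
  fibre :: "'a \<Rightarrow> ('s \<Rightarrow> complex) set"
  frames :: "('a set \<times> ('a \<Rightarrow> 's \<Rightarrow> complex)) set"

definition dual_bundle :: "('a, 's) line_bundle \<Rightarrow> ('a, 's \<Rightarrow> complex) line_bundle" where
  "dual_bundle L = \<lparr>
     fibre = (\<lambda>y. {\<xi>.
       (\<forall>u\<in>fibre L y. \<forall>v\<in>fibre L y. \<xi> (\<lambda>s. u s + v s) = \<xi> u + \<xi> v) \<and>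
       (\<forall>a. \<forall>u\<in>fibre L y. \<xi> (\<lambda>s. a * u s) = a * \<xi> u) \<and>
       (\<forall>u. u \<notin> fibre L y \<longrightarrow> \<xi> u = 0)}),
     frames = (\<lambda>(V, e). (V, \<lambda>y u.
       if u \<in> fibre L y then (THE a. u = (\<lambda>s. a * e y s)) else 0)) ` frames L\<rparr>"

definition bundle_metric :: "'a cmanifold \<Rightarrow> ('a, 's) line_bundle \<Rightarrow>
    ('a \<Rightarrow> ('s \<Rightarrow> complex) \<Rightarrow> ('s \<Rightarrow> complex) \<Rightarrow> complex) \<Rightarrow> bool" where
  "bundle_metric Y L h \<longleftrightarrow>
     (\<forall>y\<in>topspace (mtop Y). hermitian_inner (fibre L y) (h y)) \<and>
     (\<forall>(V, e)\<in>frames L. smooth_fun Y V (\<lambda>y. h y (e y) (e y)))"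

text \<open>
  Coefficient \<open>K\<^sub>i\<^sub>j = - \<partial>\<^sup>2 log h(e, e) / (\<partial>z\<^sub>i \<partial>conj(z\<^sub>j))\<close> of the Chern curvature
  \<open>\<i> \<Sum> K\<^sub>i\<^sub>j dz\<^sub>i \<and> d conj(z\<^sub>j)\<close> in the chart \<open>c\<close>, where \<open>e\<close> is a local holomorphic frame.
\<close>

definition chern_curv :: "('a \<Rightarrow> ('s \<Rightarrow> complex) \<Rightarrow> ('s \<Rightarrow> complex) \<Rightarrow> complex) \<Rightarrow>
    ('a \<Rightarrow> 's \<Rightarrow> complex) \<Rightarrow> 'a chart \<Rightarrow> 'a \<Rightarrow> nat \<Rightarrow> nat \<Rightarrow> complex" where
  "chern_curv h e c y i j =
     - dz i (dzbar j (\<lambda>v. of_real (ln (Re (let x = chart_inv c v in h x (e x) (e x))))))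
         (snd c y)"

definition RC_positive :: "'a cmanifold \<Rightarrow> ('a, 's) line_bundle \<Rightarrow> bool" where
  "RC_positive Y L \<longleftrightarrow>
     (\<exists>h. bundle_metric Y L h \<and>
       (\<forall>y\<in>topspace (mtop Y). \<forall>c\<in>atlas Y. \<forall>(V, e)\<in>frames L. y \<in> fst c \<and> y \<in> V \<longrightarrow>
         (\<exists>k::real. k > 0 \<and>
           eigenvalue (mat (mdim Y) (mdim Y) (\<lambda>(i, j). chern_curv h e c y i j))
             (complex_of_real k))))"

text \<open>The metric \<open>\<omega>\<close> is fixed before \<open>\<epsilon>\<close>; for compact \<open>Y\<close> its choice does not matter.
  The inequality between real \<open>(1,1)\<close>-forms is the one between the associated Hermitian forms.\<close>

definition nef :: "'a cmanifold \<Rightarrow> ('a, 's) line_bundle \<Rightarrow> bool" where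
  "nef Y L \<longleftrightarrow>
     (\<exists>\<omega>. manifold_metric Y \<omega> \<and>
       (\<forall>\<epsilon>>0. \<exists>h. bundle_metric Y L h \<and>
         (\<forall>y\<in>topspace (mtop Y). \<forall>c\<in>atlas Y. \<forall>(V, e)\<in>frames L. y \<in> fst c \<and> y \<in> V \<longrightarrow>
           (\<forall>a::nat \<Rightarrow> complex.
             Re (\<Sum>i<mdim Y. \<Sum>j<mdim Y. chern_curv h e c y i j * a i * cnj (a j))
             \<ge> - \<epsilon> * Re (\<Sum>i<mdim Y. \<Sum>j<mdim Y.
                   \<omega> y (coord_vec Y c y i) (coord_vec Y c y j) * a i * cnj (a j))))))"


section \<open>The projectivized tangent bundle and its tautological line bundle\<close>

type_synonym 'a ptangent = "'a \<times> 'a tvec set"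

definition PT_points :: "'a cmanifold \<Rightarrow> 'a ptangent set" where
  "PT_points X = {(p, {\<lambda>s. a * W s |a. True}) |p W.
     p \<in> topspace (mtop X) \<and> W \<in> tangent_space X p \<and> W \<noteq> (\<lambda>s. 0)}"

text \<open>The set of those \<open>(p, l)\<close> for which \<open>p\<close> is in the domain of \<open>c\<close> and the \<open>i\<close>-th homogeneous
  coordinate of \<open>l\<close> in \<open>c\<close> is nonzero, and the local frame of the tautological bundle over it
  that selects the vector of \<open>l\<close> whose \<open>i\<close>-th component is \<open>1\<close>.\<close>

definition PT_dom :: "'a cmanifold \<Rightarrow> 'a chart \<Rightarrow> nat \<Rightarrow> 'a ptangent set" where
  "PT_dom X c i = {(p, l) \<in> PT_points X. p \<in> fst c \<and> (\<exists>W\<in>l. W (c, i) \<noteq> 0)}"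

definition taut_frame :: "'a chart \<Rightarrow> nat \<Rightarrow> 'a ptangent \<Rightarrow> 'a tvec" where
  "taut_frame c i = (\<lambda>(p, l). THE W. W \<in> l \<and> W (c, i) = 1)"

text \<open>The coordinates of \<open>(p, l)\<close> in \<open>PT_dom X c i\<close> are those of \<open>p\<close>, followed by the \<open>n - 1\<close>
  inhomogeneous coordinates \<open>W\<^sub>j / W\<^sub>i\<close> (\<open>j \<noteq> i\<close>, in increasing order) of \<open>l\<close>.\<close>

definition PT_coord :: "'a cmanifold \<Rightarrow> 'a chart \<Rightarrow> nat \<Rightarrow> 'a ptangent \<Rightarrow> cvec" where
  "PT_coord X c i y = (\<lambda>k.
     if k < mdim X then snd c (fst y) k
     else if k < 2 * mdim X - 1
       then taut_frame c i y (c, if k - mdim X < i then k - mdim X else Suc (k - mdim X))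
     else 0)"

definition proj_tangent :: "'a cmanifold \<Rightarrow> 'a ptangent cmanifold" where
  "proj_tangent X = \<lparr>
     mtop = topology_generated_by
       {{y \<in> PT_dom X c i. PT_coord X c i y \<in> S} |c i S.
          c \<in> atlas X \<and> i < mdim X \<and> openin (top_of_set (Cspace (2 * mdim X - 1))) S},
     mdim = 2 * mdim X - 1,
     atlas = {(PT_dom X c i, PT_coord X c i) |c i. c \<in> atlas X \<and> i < mdim X}\<rparr>"

text \<open>The bundle with fibre \<open>\<complex>W\<close> over \<open>(p, [W])\<close>.\<close>

definition tautological :: "'a cmanifold \<Rightarrow> ('a ptangent, 'a chart \<times> nat) line_bundle" where
  "tautological X = \<lparr>
     fibre = snd,
     frames = {(PT_dom X c i, taut_frame c i) |c i. c \<in> atlas X \<and> i < mdim X}\<rparr>"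

end

theory Submission
  imports Defs "HOL-Complex_Analysis.Complex_Analysis"
begin

text \<open>
  Metrics on the tautological bundles are squared lengths \<open>H\<close> and \<open>K\<close> of tangent vectors. If the
  differential of \<open>f\<close> does not vanish, then \<open>K(df W) / H(W)\<close> has a positive maximum on the
  projectivized tangent bundle of \<open>M\<close>. There \<open>log K(df W) - log H(W)\<close> has nonpositive Laplacian on
  every complex line, whereas RC-positivity provides a line on which \<open>- log H\<close> has Laplacian at least
  \<open>c > 0\<close>, and nefness bounds that of \<open>log K(df W)\<close> from below by \<open>- \<epsilon> \<omega>(\<beta>', \<beta>')\<close>, where \<open>\<beta>\<close> is
  the image of the line in the projectivized tangent bundle of \<open>N\<close>. This would be a contradiction
  for small \<open>\<epsilon>\<close>, were it not that the fibre part of \<open>\<beta>'\<close> is unbounded near the zeros of \<open>df\<close>.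
  Therefore \<open>K\<close> is multiplied by a power \<open>S\<^sup>A\<^sup>\<epsilon>\<close> of a squared coordinate length \<open>S\<close>: the Laplacian of
  \<open>log S(df W)\<close> is the squared Fubini--Study length of the fibre part of \<open>\<beta>'\<close> and hence, for large \<open>A\<close>,
  absorbs the fibre part of \<open>\<omega>\<close>. Instead of a partition of unity, \<open>S\<close> is cut off in each of finitely
  many coordinate balls and the maximum is also taken over the balls.
\<close>

section \<open>Calculus on open subsets of \<open>Cspace n\<close>\<close>

text \<open>The order of the choices is decisive. Nefness supplies a new metric \<open>K\<close> for
  every \<epsilon>, with no control of its size, so no constant may depend on it. With \<epsilon> =
  1/k the quotient is raised to the natural powers \<open>K^k * S^A / H^(k + A)\<close>, which is
  homogeneous of degree zero and extends continuously by 0 over the zeros of the differential. A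
  common bound \<open>C\<close> for the fixed data comes first, then \<open>A\<close>, so large that
  the Fubini--Study term absorbs \<open>C\<close> times the fibre part, and last \<open>k\<close>,
  so large that the gain \<open>k / C\<close> from \<open>H\<close> beats all bounded losses; the
  loss from nefness is \<open>k\<close> times 1/k and does not grow. The price is the cutoff: the
  Laplacian of its logarithm has no lower bound near the boundary of a ball. At the maximum,
  however, the same vector can also be measured in a ball that contains its base point well inside.
  Between the two values of the quotient, \<open>K\<close> and \<open>H\<close> cancel, and only two
  coordinate lengths and two cutoffs remain. So the cutoff at the maximum has a lower bound that
  depends on \<open>C\<close> alone.\<close>

lemma Cspace_box:
  assumes U: "openin (top_of_set (Cspace n)) U" and v: "v \<in> U"
  obtains e where "e > 0" "\<And>w. w \<in> Cspace n \<Longrightarrow> (\<And>j. j < n \<Longrightarrow> norm (w j - v j) < e) \<Longrightarrow> w \<in> U"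
proof -
  obtain T where T: "open T" "U = Cspace n \<inter> T"
    using U by (auto simp: openin_open)
  then have "openin (product_topology (\<lambda>i. euclidean) UNIV) T" and "v \<in> T"
    using v by (auto simp: open_fun_def)
  from product_topology_open_contains_basis[OF this]
  obtain X where X: "v \<in> Pi\<^sub>E UNIV X" "\<And>i. open (X i)" "Pi\<^sub>E UNIV X \<subseteq> T"
    by auto
  \<comment> \<open>As a filter statement this can be intersected over the finitely many indices
    below \<open>n\<close>; from \<open>n\<close> on, all points of \<open>Cspace n\<close>
    agree.\<close>
  have "eventually (\<lambda>e. ball (v j) e \<subseteq> X j) (at_right 0)" for j
  proof -
    have "v j \<in> X j" using X(1) by auto
    then obtain d where "d > 0" "ball (v j) d \<subseteq> X j"
      using X(2) open_contains_ball by blast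
    then show ?thesis
      unfolding eventually_at_right_field
      by (intro exI[of _ d]) (auto simp: subset_eq)
  qed
  then have "eventually (\<lambda>e. \<forall>j\<in>{..<n}. ball (v j) e \<subseteq> X j) (at_right 0)"
    by (intro eventually_ball_finite) auto
  moreover have "eventually (\<lambda>e::real. e > 0) (at_right 0)"
    by (simp add: eventually_at_right_less)
  ultimately have "eventually (\<lambda>e. (\<forall>j\<in>{..<n}. ball (v j) e \<subseteq> X j) \<and> e > 0) (at_right 0)"
    by eventually_elim simp
  then obtain e where e: "\<forall>j\<in>{..<n}. ball (v j) e \<subseteq> X j" "e > 0"
    using eventually_happens' trivial_limit_at_right_real by blast
  have "w \<in> U" if w: "w \<in> Cspace n" "\<And>j. j < n \<Longrightarrow> norm (w j - v j) < e" for w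
  proof -
    have "w j \<in> X j" for j
    proof (cases "j < n")
      case True
      then have "w j \<in> ball (v j) e" using w by (simp add: dist_norm norm_minus_commute)
      then show ?thesis using e True by blast
    next
      case False
      then have "w j = v j" using w v T(2) by (auto simp: Cspace_def)
      then show ?thesis using X(1) by auto
    qed
    then show ?thesis using X(3) T(2) w(1) by auto
  qed
  then show ?thesis using that e by blast
qed

lemma Cspace_box_continuous:
  fixes g :: "cvec \<Rightarrow> complex"
  assumes U: "openin (top_of_set (Cspace n)) U" and v: "v \<in> U"
    and g: "continuous_on U g" and d: "d > 0"
  obtains e where "e > 0" "\<And>w. w \<in> Cspace n \<Longrightarrow> (\<And>j. j < n \<Longrightarrow> norm (w j - v j) < e) \<Longrightarrow>
    w \<in> U \<and> norm (g w - g v) < d"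
proof -
  have "openin (top_of_set U) (U \<inter> g -` ball (g v) d)"
    using g continuous_openin_preimage_gen by blast
  then have o: "openin (top_of_set (Cspace n)) (U \<inter> g -` ball (g v) d)"
    using U openin_trans by blast
  obtain e where "e > 0" "\<And>w. w \<in> Cspace n \<Longrightarrow> (\<And>j. j < n \<Longrightarrow> norm (w j - v j) < e) \<Longrightarrow>
    w \<in> U \<inter> g -` ball (g v) d"
    using Cspace_box[OF o, of v] v d by (metis IntI centre_in_ball vimageI)
  then show ?thesis
    using that by (simp add: dist_norm norm_minus_commute)
qed

lemma openin_Cspace_subset: "openin (top_of_set (Cspace n)) U \<Longrightarrow> v \<in> U \<Longrightarrow> v \<in> Cspace n"
  using openin_imp_subset by blast

lemma Cspace_upd: "v \<in> Cspace n \<Longrightarrow> j < n \<Longrightarrow> v(j := x) \<in> Cspace n"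
  by (auto simp: Cspace_def)

lemma eventually_coordinate_line:
  assumes U: "openin (top_of_set (Cspace n)) U" and v: "v \<in> U" and j: "j < n"
  shows "\<forall>\<^sub>F t in nhds (0::real). v(j := v j + of_real t * u) \<in> U"
proof -
  obtain e where e: "e > 0" "\<And>w. w \<in> Cspace n \<Longrightarrow> (\<And>i. i < n \<Longrightarrow> norm (w i - v i) < e) \<Longrightarrow> w \<in> U"
    using Cspace_box[OF U v] by metis
  have "((\<lambda>t::real. norm (of_real t * u)) \<longlongrightarrow> norm (of_real 0 * u)) (nhds 0)"
    by (intro tendsto_intros) (auto simp: filterlim_ident)
  then have "\<forall>\<^sub>F t::real in nhds 0. norm (of_real t * u) < e"
    using e(1) by (intro order_tendstoD) auto
  then show ?thesis
    by eventually_elim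
      (use e j v U in \<open>auto intro!: e(2) Cspace_upd dest: openin_Cspace_subset\<close>)
qed

text \<open>\<open>pderiv_dir\<close> is defined by a derivative at parameter 0 only. Moving the
  base point along the line turns it into a derivative at every parameter, as mean value estimates
  require.\<close>

lemma pderiv_dir_shift:
  assumes "(\<lambda>t::real. g ((v(j := v j + of_real s * u))(j := (v(j := v j + of_real s * u)) j + of_real t * u)))
     differentiable at 0"
  shows "((\<lambda>t::real. g (v(j := v j + of_real t * u))) has_vector_derivative
     pderiv_dir j u g (v(j := v j + of_real s * u))) (at s)"
proof -
  let ?w = "v(j := v j + of_real s * u)"
  have "((\<lambda>t::real. g (?w(j := ?w j + of_real t * u))) has_vector_derivative pderiv_dir j u g ?w) (at 0)"
    using assms unfolding pderiv_dir_def by (rule vector_derivative_works[THEN iffD1])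
  then have "((\<lambda>t::real. g (?w(j := ?w j + of_real t * u))) has_vector_derivative pderiv_dir j u g ?w) (at (s - s))"
    by simp
  moreover have "((\<lambda>t. t - s) has_vector_derivative 1) (at s)"
    by (auto intro!: derivative_eq_intros)
  ultimately have "((\<lambda>t::real. g (?w(j := ?w j + of_real (t - s) * u))) has_vector_derivative pderiv_dir j u g ?w) (at s)"
    using vector_diff_chain_at[where f = "\<lambda>t. t - s" and g = "\<lambda>t::real. g (?w(j := ?w j + of_real t * u))" and x = s]
    by (fastforce simp: o_def)
  then show ?thesis
    by (simp add: algebra_simps)
qed

text \<open>One step of the chain rule, in which a single real coordinate changes. The base point
  \<open>w t\<close> moves with \<open>t\<close>, so differentiability at \<open>v\<close> alone
  says nothing; continuity of the partial derivative and the mean value inequality make the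
  linearization uniform near \<open>v\<close>.\<close>

lemma partial_step:
  fixes g :: "cvec \<Rightarrow> complex" and w :: "'p::real_normed_vector \<Rightarrow> cvec" and dl :: "'p \<Rightarrow> real"
  assumes U: "openin (top_of_set (Cspace n)) U" and v: "v \<in> U" and j: "j < n" and u: "norm u = 1"
    and diff: "\<And>v. v \<in> U \<Longrightarrow> (\<lambda>t::real. g (v(j := v j + of_real t * u))) differentiable at 0"
    and cont: "continuous_on U (pderiv_dir j u g)"
    and w: "\<And>t. w t \<in> Cspace n" "\<And>i. i < n \<Longrightarrow> ((\<lambda>t. w t i) \<longlongrightarrow> v i) (nhds t0)"
    and dl: "(dl has_derivative D) (at t0)" "dl t0 = 0"
  shows "((\<lambda>t. g ((w t)(j := w t j + of_real (dl t) * u)) - g (w t)) has_derivative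
      (\<lambda>h. D h *\<^sub>R pderiv_dir j u g v)) (at t0)"
proof -
  let ?P = "pderiv_dir j u g" and ?q = "\<lambda>t s. (w t)(j := w t j + of_real s * u)"
  have bl: "bounded_linear D" using dl(1) has_derivative_bounded_linear by blast
  \<comment> \<open>On the whole segment the partial derivative is within \<open>e / 3\<close> of
    its value at \<open>v\<close>, hence within \<open>2 * e / 3\<close> of its value at the
    starting point; replacing the latter by the value at \<open>v\<close> costs the last
    third.\<close>
  have est: "\<forall>\<^sub>F t in nhds t0. norm (g (?q t (dl t)) - g (w t) - dl t *\<^sub>R ?P v) \<le> \<bar>dl t\<bar> * e"
    if e: "e > 0" for e
  proof -
    obtain d where d: "d > 0" "\<And>w. w \<in> Cspace n \<Longrightarrow> (\<And>i. i < n \<Longrightarrow> norm (w i - v i) < d) \<Longrightarrow>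
      w \<in> U \<and> norm (?P w - ?P v) < e / 3"
      using Cspace_box_continuous[OF U v cont, of "e/3"] e by (metis divide_pos_pos zero_less_numeral)
    have "\<forall>\<^sub>F t in nhds t0. \<forall>i\<in>{..<n}. dist (w t i) (v i) < d / 2"
      using tendstoD[OF w(2), of _ "d/2"] d(1) by (intro eventually_ball_finite ballI) auto
    moreover have "(dl \<longlongrightarrow> 0) (nhds t0)"
      using has_derivative_continuous[OF dl(1)] dl(2)
      by (metis continuous_at tendsto_at_iff_tendsto_nhds)
    then have "\<forall>\<^sub>F t in nhds t0. \<bar>dl t\<bar> < d / 2"
      using d(1) tendstoD[of dl 0 "nhds t0" "d/2"] by (simp add: dist_real_def)
    ultimately show ?thesis
    proof eventually_elim
      case (elim t)
      have box: "?q t s \<in> U \<and> norm (?P (?q t s) - ?P v) < e/3" if s: "\<bar>s\<bar> \<le> \<bar>dl t\<bar>" for s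
      proof (rule d(2))
        show "?q t s \<in> Cspace n" using w(1) j by (rule Cspace_upd)
        fix i assume i: "i < n"
        have "norm (w t j - v j + of_real s * u) \<le> norm (w t j - v j) + norm (of_real s * u)"
          by (rule norm_triangle_ineq)
        also have "\<dots> < d/2 + d/2"
          using elim s i j u by (intro add_strict_mono) (auto simp: dist_norm norm_mult)
        finally show "norm (?q t s i - v i) < d"
          using bspec[OF elim(1), of i] i zero_le_dist[of "w t i" "v i"]
          by (cases "i = j") (auto simp: dist_norm[symmetric] algebra_simps simp del: zero_le_dist)
      qed
      have "norm (g (?q t (dl t)) - g (?q t 0) - (dl t - 0) *\<^sub>R ?P (?q t 0)) \<le> norm (dl t - 0) * (2 * e/3)"
      proof (rule vector_differentiable_bound_linearization[where f = "\<lambda>s. g (?q t s)" and f' = "\<lambda>s. ?P (?q t s)"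
            and S = "closed_segment 0 (dl t)"])
        fix s assume "s \<in> closed_segment 0 (dl t)"
        then have s: "\<bar>s\<bar> \<le> \<bar>dl t\<bar>" by (auto simp: closed_segment_eq_real_ivl split: if_splits)
        show "((\<lambda>s. g (?q t s)) has_vector_derivative ?P (?q t s)) (at s within closed_segment 0 (dl t))"
          using pderiv_dir_shift[of g "w t" j s u, OF diff] box[OF s] by (simp add: has_vector_derivative_at_within)
        have "norm (?P (?q t s) - ?P (?q t 0)) \<le> norm (?P (?q t s) - ?P v) + norm (?P (?q t 0) - ?P v)"
          using norm_triangle_ineq4[of "?P (?q t s) - ?P v" "?P (?q t 0) - ?P v"] by simp
        then show "norm (?P (?q t s) - ?P (?q t 0)) \<le> 2 * e/3"
          using box[OF s] box[of 0] by linarith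
      qed auto
      moreover have "norm (dl t *\<^sub>R (?P (?q t 0) - ?P v)) \<le> \<bar>dl t\<bar> * (e/3)"
        using mult_left_mono[of "norm (?P (?q t 0) - ?P v)" "e/3" "\<bar>dl t\<bar>"] box[of 0] by simp
      moreover have "g (?q t (dl t)) - g (w t) - dl t *\<^sub>R ?P v =
        (g (?q t (dl t)) - g (?q t 0) - (dl t - 0) *\<^sub>R ?P (?q t 0)) + dl t *\<^sub>R (?P (?q t 0) - ?P v)"
        by (simp add: scaleR_diff_right)
      ultimately have "norm (g (?q t (dl t)) - g (w t) - dl t *\<^sub>R ?P v) \<le> \<bar>dl t\<bar> * (2 * e/3) + \<bar>dl t\<bar> * (e/3)"
        using norm_triangle_mono by (smt (verit) real_norm_def)
      then show ?case by (simp add: field_simps)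
    qed
  qed
  obtain K where K: "K > 0" "\<And>h. norm (D h) \<le> norm h * K"
    using bounded_linear.pos_bounded[OF bl] by blast
  have lip: "\<forall>\<^sub>F t in nhds t0. \<bar>dl t - D (t - t0)\<bar> \<le> e * norm (t - t0)" if e: "e > 0" for e
  proof -
    obtain d where "d > 0" "\<forall>y. norm (y - t0) < d \<longrightarrow> norm (dl y - dl t0 - D (y - t0)) \<le> e * norm (y - t0)"
      using dl(1)[unfolded has_derivative_at_alt, THEN conjunct2, rule_format, OF e] by metis
    then show ?thesis
      unfolding eventually_nhds_metric using dl(2) by (auto simp: dist_norm intro!: exI[of _ d])
  qed
  show ?thesis
    unfolding has_derivative_at_alt
  proof (intro conjI allI impI)
    show "bounded_linear (\<lambda>h. D h *\<^sub>R ?P v)"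
      using bl by (rule bounded_linear_scaleR_left[THEN bounded_linear_compose])
    fix e :: real assume e: "e > 0"
    \<comment> \<open>Near \<open>t0\<close> the increment \<open>dl t\<close> is at most
      \<open>K + 1\<close> times the distance, by \<open>lip\<close> with constant 1. So
      \<open>e1\<close> and \<open>e2\<close> are scaled for the two error terms to be
      \<open>e / 2\<close> each.\<close>
    define e1 where "e1 = e / (2 * (K + 1))"
    define e2 where "e2 = e / (2 * (norm (?P v) + 1))"
    have pos: "e1 > 0" "e2 > 0" using e K by (auto simp: e1_def e2_def add_nonneg_pos)
    have "\<forall>\<^sub>F t in nhds t0. norm (g (?q t (dl t)) - g (w t) - (D (t - t0)) *\<^sub>R ?P v) \<le> e * norm (t - t0)"
      using est[OF pos(1)] lip[OF pos(2)] lip[of 1, simplified]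
    proof eventually_elim
      case (elim t)
      have "\<bar>dl t\<bar> \<le> (K + 1) * norm (t - t0)"
        using elim(3) K(2)[of "t - t0"] by (auto simp: algebra_simps)
      then have "\<bar>dl t\<bar> * e1 \<le> (K + 1) * norm (t - t0) * e1"
        using pos by (intro mult_right_mono) auto
      also have "\<dots> = e / 2 * norm (t - t0)"
        using K by (simp add: e1_def field_simps)
      finally have 1: "norm (g (?q t (dl t)) - g (w t) - dl t *\<^sub>R ?P v) \<le> e / 2 * norm (t - t0)"
        using elim(1) by linarith
      have "norm ((dl t - D (t - t0)) *\<^sub>R ?P v) \<le> (e2 * norm (t - t0)) * norm (?P v)"
        using elim(2) by (simp add: mult_right_mono)
      also have "\<dots> \<le> (e2 * norm (t - t0)) * (norm (?P v) + 1)"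
        using pos by (intro mult_left_mono) auto
      also have "\<dots> = e / 2 * norm (t - t0)"
        by (simp add: e2_def field_simps add_nonneg_eq_0_iff)
      finally have 2: "norm ((dl t - D (t - t0)) *\<^sub>R ?P v) \<le> e / 2 * norm (t - t0)" .
      have "g (?q t (dl t)) - g (w t) - (D (t - t0)) *\<^sub>R ?P v =
        (g (?q t (dl t)) - g (w t) - dl t *\<^sub>R ?P v) + (dl t - D (t - t0)) *\<^sub>R ?P v"
        by (simp add: scaleR_diff_left)
      then have "norm (g (?q t (dl t)) - g (w t) - (D (t - t0)) *\<^sub>R ?P v) \<le> e / 2 * norm (t - t0) + e / 2 * norm (t - t0)"
        using norm_triangle_mono[OF 1 2] by (simp only:)
      then show ?case by simp
    qed
    then show "\<exists>d>0. \<forall>y. norm (y - t0) < d \<longrightarrow>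
        norm (g (?q y (dl y)) - g (w y) - (g (?q t0 (dl t0)) - g (w t0)) - D (y - t0) *\<^sub>R ?P v) \<le> e * norm (y - t0)"
      unfolding eventually_nhds_metric using dl(2) by (auto simp: dist_norm)
  qed
qed

text \<open>The classical passage from continuous partial derivatives to total differentiability:
  \<open>G k t\<close> has already moved its first \<open>k\<close> coordinates, and the next one
  moves first in its real and then in its imaginary part.\<close>

lemma chain_rule_Cspace_total:
  fixes g :: "cvec \<Rightarrow> complex" and \<gamma> :: "'p::real_normed_vector \<Rightarrow> cvec"
  assumes U: "openin (top_of_set (Cspace n)) U" and g: "Ck_on n (Suc 0) U g"
    and \<gamma>: "\<And>t. \<gamma> t \<in> Cspace n" "\<gamma> t0 \<in> U" "\<And>j. j < n \<Longrightarrow> ((\<lambda>t. \<gamma> t j) has_derivative b j) (at t0)"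
  shows "((\<lambda>t. g (\<gamma> t)) has_derivative
    (\<lambda>h. \<Sum>j<n. dz j g (\<gamma> t0) * b j h + dzbar j g (\<gamma> t0) * cnj (b j h))) (at t0)"
proof -
  let ?v = "\<gamma> t0"
  define G where "G k t = (\<lambda>j. if j < k then \<gamma> t j else ?v j)" for k t
  have GC: "G k t \<in> Cspace n" for k t
    using \<gamma>(1) by (auto simp: G_def Cspace_def)
  have lim: "((\<lambda>t. \<gamma> t i) \<longlongrightarrow> ?v i) (nhds t0)" if "i < n" for i
    using has_derivative_continuous[OF \<gamma>(3)[OF that]] by (metis continuous_at tendsto_at_iff_tendsto_nhds)
  have diff: "(\<lambda>t::real. g (v(j := v j + of_real t * u))) differentiable at 0"
    and cont: "continuous_on U (pderiv_dir j u g)"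
    if "v \<in> U" "j < n" "u \<in> {1, \<i>}" for v j u
    using g that by auto
  have main: "((\<lambda>t. g (G k t)) has_derivative
    (\<lambda>h. \<Sum>j<k. dz j g ?v * b j h + dzbar j g ?v * cnj (b j h))) (at t0)" if "k \<le> n" for k
    using that
  proof (induction k)
    case 0
    show ?case by (simp add: G_def)
  next
    case (Suc k)
    then have k: "k < n" by simp
    let ?x = "\<lambda>t. Re (\<gamma> t k - ?v k)" and ?y = "\<lambda>t. Im (\<gamma> t k - ?v k)"
    define w where "w t = (G k t)(k := G k t k + of_real (?x t) * 1)" for t
    have wC: "w t \<in> Cspace n" for t unfolding w_def by (intro Cspace_upd GC k)
    have Glim: "((\<lambda>t. G k t i) \<longlongrightarrow> ?v i) (nhds t0)" if "i < n" for i
      using lim[OF that] by (cases "i < k") (auto simp: G_def)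
    have xlim: "((\<lambda>t. ?v k + of_real (?x t)) \<longlongrightarrow> ?v k + of_real (Re (?v k - ?v k))) (nhds t0)"
      by (intro tendsto_intros lim k)
    have wlim: "((\<lambda>t. w t i) \<longlongrightarrow> ?v i) (nhds t0)" if "i < n" for i
      using Glim[OF that] xlim by (cases "i = k") (auto simp: w_def G_def)
    have dx: "(?x has_derivative (\<lambda>h. Re (b k h))) (at t0)" "(?y has_derivative (\<lambda>h. Im (b k h))) (at t0)"
      using \<gamma>(3)[OF k] by (auto intro!: derivative_eq_intros)
    have 1: "((\<lambda>t. g ((G k t)(k := G k t k + of_real (?x t) * 1)) - g (G k t)) has_derivative
      (\<lambda>h. Re (b k h) *\<^sub>R pderiv_dir k 1 g ?v)) (at t0)"
      by (rule partial_step[OF U \<gamma>(2) k _ diff[OF _ k] cont[OF \<gamma>(2) k] GC Glim dx(1)]) auto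
    have 2: "((\<lambda>t. g ((w t)(k := w t k + of_real (?y t) * \<i>)) - g (w t)) has_derivative
      (\<lambda>h. Im (b k h) *\<^sub>R pderiv_dir k \<i> g ?v)) (at t0)"
      by (rule partial_step[OF U \<gamma>(2) k _ diff[OF _ k] cont[OF \<gamma>(2) k] wC wlim dx(2)]) auto
    have "(w t)(k := w t k + of_real (?y t) * \<i>) = G (Suc k) t" for t
      by (auto simp: w_def G_def fun_eq_iff complex_eq_iff less_Suc_eq)
    then have 3: "g (G (Suc k) t) = g (G k t) + (g ((G k t)(k := G k t k + of_real (?x t) * 1)) - g (G k t))
       + (g ((w t)(k := w t k + of_real (?y t) * \<i>)) - g (w t))" for t
      by (simp add: w_def)
    have 4: "Re (b k h) *\<^sub>R pderiv_dir k 1 g ?v + Im (b k h) *\<^sub>R pderiv_dir k \<i> g ?v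
      = dz k g ?v * b k h + dzbar k g ?v * cnj (b k h)" for h
      unfolding dz_def dzbar_def by (simp add: complex_eq_iff field_simps)
    show ?case
      unfolding 3
      by (rule has_derivative_eq_rhs[OF has_derivative_add[OF has_derivative_add[OF Suc.IH 1] 2]])
        (use k in \<open>auto simp: 4[symmetric] fun_eq_iff add.assoc\<close>)
  qed
  have "G n t = \<gamma> t" for t
    using \<gamma>(1) by (auto simp: G_def Cspace_def fun_eq_iff)
  then show ?thesis using main[of n] by simp
qed

lemma chain_rule_Cspace:
  fixes g :: "cvec \<Rightarrow> complex" and \<gamma> :: "'p::real_normed_vector \<Rightarrow> cvec"
  assumes U: "openin (top_of_set (Cspace n)) U" and g: "Ck_on n (Suc 0) U g"
    and \<gamma>: "\<forall>\<^sub>F t in nhds t0. \<gamma> t \<in> Cspace n" "\<gamma> t0 \<in> U" "\<And>j. j < n \<Longrightarrow> ((\<lambda>t. \<gamma> t j) has_derivative b j) (at t0)"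
  shows "((\<lambda>t. g (\<gamma> t)) has_derivative
    (\<lambda>h. \<Sum>j<n. dz j g (\<gamma> t0) * b j h + dzbar j g (\<gamma> t0) * cnj (b j h))) (at t0)"
proof -
  \<comment> \<open>Truncation produces a curve that lies in \<open>Cspace n\<close> at all times
    and agrees with the given one near \<open>t0\<close>.\<close>
  define \<gamma>' where "\<gamma>' t = (\<lambda>j. if j < n then \<gamma> t j else 0)" for t
  have eq: "\<gamma>' t = \<gamma> t" if "\<gamma> t \<in> Cspace n" for t
    using that by (auto simp: \<gamma>'_def Cspace_def fun_eq_iff)
  have 0: "\<gamma>' t0 = \<gamma> t0" using \<gamma>(2) U eq openin_Cspace_subset by blast
  have "((\<lambda>t. g (\<gamma>' t)) has_derivative
    (\<lambda>h. \<Sum>j<n. dz j g (\<gamma>' t0) * b j h + dzbar j g (\<gamma>' t0) * cnj (b j h))) (at t0)"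
    by (rule chain_rule_Cspace_total[OF U g]) (use \<gamma> 0 in \<open>auto simp: \<gamma>'_def Cspace_def\<close>)
  then have "((\<lambda>t. g (\<gamma>' t)) has_derivative
    (\<lambda>h. \<Sum>j<n. dz j g (\<gamma> t0) * b j h + dzbar j g (\<gamma> t0) * cnj (b j h))) (at t0)"
    by (simp add: 0)
  moreover have "\<forall>\<^sub>F t in at t0. g (\<gamma>' t) = g (\<gamma> t)"
    using \<gamma>(1) by (auto simp: eventually_nhds_conv_at eq elim: eventually_mono)
  ultimately show ?thesis
    using 0 by (auto intro: has_derivative_transform_eventually)
qed

section \<open>Closure properties of the classes \<open>Ck_on\<close>\<close>

lemma Ck_on_pderiv_dir:
  "Ck_on n (Suc k) U g \<Longrightarrow> j < n \<Longrightarrow> u \<in> {1, \<i>} \<Longrightarrow> Ck_on n k U (pderiv_dir j u g)"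
  unfolding Ck_on.simps by blast

lemma Ck_on_differentiable:
  "Ck_on n (Suc k) U g \<Longrightarrow> v \<in> U \<Longrightarrow> j < n \<Longrightarrow> u \<in> {1, \<i>} \<Longrightarrow>
    (\<lambda>t::real. g (v(j := v j + of_real t * u))) differentiable at 0"
  unfolding Ck_on.simps by blast

lemma Ck_on_imp_continuous_on: "Ck_on n k U g \<Longrightarrow> continuous_on U g"
  by (cases k) auto

lemma Ck_on_mono: "Ck_on n (Suc k) U g \<Longrightarrow> Ck_on n k U g"
proof (induction k arbitrary: g)
  case 0
  then show ?case by simp
next
  case (Suc k)
  have "Ck_on n k U (pderiv_dir j u g)" if "j < n" "u \<in> {1, \<i>}" for j u
    by (rule Suc.IH[OF Ck_on_pderiv_dir[OF Suc.prems that]])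
  then show ?case
    using Ck_on_differentiable[OF Suc.prems] Ck_on_imp_continuous_on[OF Suc.prems]
    unfolding Ck_on.simps(2)[of n k] by blast
qed

declare Ck_on.simps(2) [simp del]

lemma
  assumes "openin (top_of_set (Cspace n)) U" "v \<in> U" "j < n" "\<And>w. w \<in> U \<Longrightarrow> g w = g' w"
  shows pderiv_dir_cong: "pderiv_dir j u g v = pderiv_dir j u g' v"
    and differentiable_coordinate_line_cong: "(\<lambda>t::real. g (v(j := v j + of_real t * u))) differentiable at 0 \<longleftrightarrow>
      (\<lambda>t::real. g' (v(j := v j + of_real t * u))) differentiable at 0"
proof -
  have ev: "\<forall>\<^sub>F t in nhds (0::real). g (v(j := v j + of_real t * u)) = g' (v(j := v j + of_real t * u))"
    using eventually_coordinate_line[OF assms(1-3), of u] by eventually_elim (rule assms(4))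
  have eq: "((\<lambda>t::real. g (v(j := v j + of_real t * u))) has_vector_derivative D) (at 0) \<longleftrightarrow>
    ((\<lambda>t::real. g' (v(j := v j + of_real t * u))) has_vector_derivative D) (at 0)" for D
    using ev assms(2,4) by (intro has_vector_derivative_cong_ev) auto
  show "pderiv_dir j u g v = pderiv_dir j u g' v"
    unfolding pderiv_dir_def vector_derivative_def eq ..
  have "(\<lambda>t::real. h (v(j := v j + of_real t * u))) differentiable at 0 \<longleftrightarrow>
    (\<exists>D. ((\<lambda>t::real. h (v(j := v j + of_real t * u))) has_vector_derivative D) (at 0))" for h :: "cvec \<Rightarrow> complex"
    by (metis differentiableI_vector vector_derivative_works)
  then show "(\<lambda>t::real. g (v(j := v j + of_real t * u))) differentiable at 0 \<longleftrightarrow>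
      (\<lambda>t::real. g' (v(j := v j + of_real t * u))) differentiable at 0"
    by (simp only: eq)
qed

lemma dz_cong:
  assumes "openin (top_of_set (Cspace n)) U" "v \<in> U" "j < n" "\<And>w. w \<in> U \<Longrightarrow> g w = g' w"
  shows "dz j g v = dz j g' v"
  using pderiv_dir_cong[OF assms] by (simp add: dz_def)

lemma dzbar_cong:
  assumes "openin (top_of_set (Cspace n)) U" "v \<in> U" "j < n" "\<And>w. w \<in> U \<Longrightarrow> g w = g' w"
  shows "dzbar j g v = dzbar j g' v"
  using pderiv_dir_cong[OF assms] by (simp add: dzbar_def)

lemma Ck_on_cong:
  assumes U: "openin (top_of_set (Cspace n)) U" and eq: "\<And>w. w \<in> U \<Longrightarrow> g w = g' w" and g: "Ck_on n k U g"
  shows "Ck_on n k U g'"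
  using g eq
proof (induction k arbitrary: g g')
  case 0
  then show ?case by (simp cong: continuous_on_cong)
next
  case (Suc k)
  have "continuous_on U g'"
    using Ck_on_imp_continuous_on[OF Suc.prems(1)] Suc.prems(2) by (simp cong: continuous_on_cong)
  moreover have "(\<lambda>t::real. g' (v(j := v j + of_real t * u))) differentiable at 0"
    if "j < n" "u \<in> {1, \<i>}" "v \<in> U" for j u v
    using differentiable_coordinate_line_cong[OF U that(3) that(1), of g g' u] Suc.prems(2)
      Ck_on_differentiable[OF Suc.prems(1) that(3,1,2)] by blast
  moreover have "Ck_on n k U (pderiv_dir j u g')" if "j < n" "u \<in> {1, \<i>}" for j u
    by (rule Suc.IH[OF Ck_on_pderiv_dir[OF Suc.prems(1) that]])
      (rule pderiv_dir_cong[OF U _ that(1) Suc.prems(2)])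
  ultimately show ?case unfolding Ck_on.simps by blast
qed

lemma pderiv_dir_works:
  assumes "Ck_on n (Suc k) U g" "v \<in> U" "j < n" "u \<in> {1, \<i>}"
  shows "((\<lambda>t::real. g (v(j := v j + of_real t * u))) has_vector_derivative pderiv_dir j u g v) (at 0)"
  unfolding pderiv_dir_def by (intro vector_derivative_works[THEN iffD1] Ck_on_differentiable[OF assms])

lemma pderiv_dir_eqI:
  assumes "((\<lambda>t::real. g (v(j := v j + of_real t * u))) has_vector_derivative D) (at 0)"
  shows "pderiv_dir j u g v = D"
  unfolding pderiv_dir_def using assms by (rule vector_derivative_at)

text \<open>Any explicit formula \<open>D\<close> for the derivatives may replace
  \<open>pderiv_dir\<close>, because the two agree on the open set \<open>U\<close>. The closure
  properties below are inductions with this rule.\<close>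

lemma Ck_on_SucI:
  assumes U: "openin (top_of_set (Cspace n)) U" and cont: "continuous_on U g"
    and D: "\<And>v j u. v \<in> U \<Longrightarrow> j < n \<Longrightarrow> u \<in> {1, \<i>} \<Longrightarrow>
      ((\<lambda>t::real. g (v(j := v j + of_real t * u))) has_vector_derivative D j u v) (at 0)"
    and C: "\<And>j u. j < n \<Longrightarrow> u \<in> {1, \<i>} \<Longrightarrow> Ck_on n k U (D j u)"
  shows "Ck_on n (Suc k) U g"
proof -
  have "Ck_on n k U (pderiv_dir j u g)" if "j < n" "u \<in> {1, \<i>}" for j u
    by (rule Ck_on_cong[OF U pderiv_dir_eqI[OF D, symmetric] C[OF that]]) (use that in auto)
  moreover have "(\<lambda>t::real. g (v(j := v j + of_real t * u))) differentiable at 0"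
    if "v \<in> U" "j < n" "u \<in> {1, \<i>}" for v j u
    using D[OF that] by (rule differentiableI_vector)
  ultimately show ?thesis using cont unfolding Ck_on.simps by blast
qed

lemma Ck_on_linear:
  assumes U: "openin (top_of_set (Cspace n)) U" and "Ck_on n k U f" "Ck_on n k U g"
  shows "Ck_on n k U (\<lambda>v. a * f v + b * g v)"
  using assms(2,3)
proof (induction k arbitrary: f g)
  case 0
  then show ?case by (auto intro!: continuous_intros)
next
  case (Suc k)
  show ?case
  proof (rule Ck_on_SucI[OF U, where D = "\<lambda>j u v. a * pderiv_dir j u f v + b * pderiv_dir j u g v"])
    show "continuous_on U (\<lambda>v. a * f v + b * g v)"
      using Suc.prems by (intro continuous_intros Ck_on_imp_continuous_on)
    fix j and u :: complex assume ju: "j < n" "u \<in> {1, \<i>}"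
    show "Ck_on n k U (\<lambda>v. a * pderiv_dir j u f v + b * pderiv_dir j u g v)"
      by (intro Suc.IH Ck_on_pderiv_dir[OF Suc.prems(1) ju] Ck_on_pderiv_dir[OF Suc.prems(2) ju])
    fix v assume v: "v \<in> U"
    show "((\<lambda>t::real. a * f (v(j := v j + of_real t * u)) + b * g (v(j := v j + of_real t * u)))
      has_vector_derivative a * pderiv_dir j u f v + b * pderiv_dir j u g v) (at 0)"
      by (intro derivative_intros pderiv_dir_works[OF Suc.prems(1) v ju] pderiv_dir_works[OF Suc.prems(2) v ju])
  qed
qed

lemma Ck_on_dz_dzbar:
  assumes U: "openin (top_of_set (Cspace n)) U" and g: "Ck_on n (Suc k) U g" and j: "j < n"
  shows "Ck_on n k U (dz j g)" "Ck_on n k U (dzbar j g)"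
proof -
  have P: "Ck_on n k U (pderiv_dir j 1 g)" "Ck_on n k U (pderiv_dir j \<i> g)"
    using Ck_on_pderiv_dir[OF g j] by auto
  show "Ck_on n k U (dz j g)"
    by (rule Ck_on_cong[OF U _ Ck_on_linear[OF U P, of "1/2" "- \<i>/2"]]) (simp add: dz_def field_simps)
  show "Ck_on n k U (dzbar j g)"
    by (rule Ck_on_cong[OF U _ Ck_on_linear[OF U P, of "1/2" "\<i>/2"]]) (simp add: dzbar_def field_simps)
qed

lemma Ck_on_mult:
  assumes U: "openin (top_of_set (Cspace n)) U" and "Ck_on n k U f" "Ck_on n k U g"
  shows "Ck_on n k U (\<lambda>v. f v * g v)"
  using assms(2,3)
proof (induction k arbitrary: f g)
  case 0
  then show ?case by (auto intro!: continuous_intros)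
next
  case (Suc k)
  show ?case
  proof (rule Ck_on_SucI[OF U, where D = "\<lambda>j u v. f v * pderiv_dir j u g v + pderiv_dir j u f v * g v"])
    show "continuous_on U (\<lambda>v. f v * g v)"
      using Suc.prems by (intro continuous_intros Ck_on_imp_continuous_on)
    fix j and u :: complex assume ju: "j < n" "u \<in> {1, \<i>}"
    have "Ck_on n k U (\<lambda>v. f v * pderiv_dir j u g v)" "Ck_on n k U (\<lambda>v. pderiv_dir j u f v * g v)"
      by (intro Suc.IH Ck_on_mono[OF Suc.prems(1)] Ck_on_mono[OF Suc.prems(2)]
          Ck_on_pderiv_dir[OF Suc.prems(1) ju] Ck_on_pderiv_dir[OF Suc.prems(2) ju])+
    from Ck_on_linear[OF U this, of 1 1]
    show "Ck_on n k U (\<lambda>v. f v * pderiv_dir j u g v + pderiv_dir j u f v * g v)" by simp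
    fix v assume v: "v \<in> U"
    have "v(j := v j + of_real 0 * u) = v" by simp
    then show "((\<lambda>t::real. f (v(j := v j + of_real t * u)) * g (v(j := v j + of_real t * u)))
      has_vector_derivative f v * pderiv_dir j u g v + pderiv_dir j u f v * g v) (at 0)"
      using has_vector_derivative_mult[OF pderiv_dir_works[OF Suc.prems(1) v ju] pderiv_dir_works[OF Suc.prems(2) v ju]]
      by (simp only:)
  qed
qed

lemma Ck_on_inverse:
  assumes U: "openin (top_of_set (Cspace n)) U" and "Ck_on n k U f" "\<And>v. v \<in> U \<Longrightarrow> f v \<noteq> 0"
  shows "Ck_on n k U (\<lambda>v. inverse (f v))"
  using assms(2,3)
proof (induction k arbitrary: f)
  case 0
  then show ?case by (auto intro!: continuous_intros)
next
  case (Suc k)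
  show ?case
  proof (rule Ck_on_SucI[OF U, where D = "\<lambda>j u v. - 1 * (inverse (f v) * inverse (f v) * pderiv_dir j u f v) + 0 * f v"])
    show "continuous_on U (\<lambda>v. inverse (f v))"
      using Ck_on_imp_continuous_on[OF Suc.prems(1)] Suc.prems(2) by (auto intro!: continuous_intros)
    fix j and u :: complex assume ju: "j < n" "u \<in> {1, \<i>}"
    have f: "Ck_on n k U f" using Suc.prems(1) by (rule Ck_on_mono)
    have "Ck_on n k U (\<lambda>v. inverse (f v))" using Suc.IH[OF f] Suc.prems by blast
    moreover have "Ck_on n k U (pderiv_dir j u f)" by (rule Ck_on_pderiv_dir[OF Suc.prems(1) ju])
    ultimately show "Ck_on n k U (\<lambda>v. - 1 * (inverse (f v) * inverse (f v) * pderiv_dir j u f v) + 0 * f v)"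
      by (intro Ck_on_linear[OF U] Ck_on_mult[OF U] f)
    fix v assume v: "v \<in> U"
    have nz: "f (v(j := v j + of_real 0 * u)) \<noteq> 0" using Suc.prems v by simp
    show "((\<lambda>t::real. inverse (f (v(j := v j + of_real t * u))))
      has_vector_derivative - 1 * (inverse (f v) * inverse (f v) * pderiv_dir j u f v) + 0 * f v) (at 0)"
      using pderiv_dir_works[OF Suc.prems(1) v ju] nz unfolding has_vector_derivative_def
      by (auto intro!: derivative_eq_intros simp: fun_eq_iff)
  qed
qed

lemma Ck_on_Re:
  assumes U: "openin (top_of_set (Cspace n)) U" and "Ck_on n k U f"
  shows "Ck_on n k U (\<lambda>v. of_real (Re (f v)))"
  using assms(2)
proof (induction k arbitrary: f)
  case 0
  then show ?case by (auto intro!: continuous_intros)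
next
  case (Suc k)
  show ?case
  proof (rule Ck_on_SucI[OF U, where D = "\<lambda>j u v. of_real (Re (pderiv_dir j u f v))"])
    show "continuous_on U (\<lambda>v. complex_of_real (Re (f v)))"
      using Ck_on_imp_continuous_on[OF Suc.prems] by (auto intro!: continuous_intros)
    fix j and u :: complex assume ju: "j < n" "u \<in> {1, \<i>}"
    show "Ck_on n k U (\<lambda>v. of_real (Re (pderiv_dir j u f v)))"
      by (rule Suc.IH[OF Ck_on_pderiv_dir[OF Suc.prems ju]])
    fix v assume v: "v \<in> U"
    show "((\<lambda>t::real. complex_of_real (Re (f (v(j := v j + of_real t * u)))))
      has_vector_derivative of_real (Re (pderiv_dir j u f v))) (at 0)"
      using pderiv_dir_works[OF Suc.prems(1) v ju] unfolding has_vector_derivative_def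
      by (auto intro!: derivative_eq_intros simp: scaleR_conv_of_real)
  qed
qed

lemma Ck_on_ln:
  assumes U: "openin (top_of_set (Cspace n)) U" and f: "Ck_on n k U f" and pos: "\<And>v. v \<in> U \<Longrightarrow> Re (f v) > 0"
  shows "Ck_on n k U (\<lambda>v. of_real (ln (Re (f v))))"
proof (cases k)
  case 0
  then show ?thesis using f by (auto intro!: continuous_intros dest: pos)
next
  case (Suc k')
  show ?thesis unfolding Suc
  proof (rule Ck_on_SucI[OF U, where D = "\<lambda>j u v. inverse (of_real (Re (f v))) * of_real (Re (pderiv_dir j u f v))"])
    have "continuous_on U f" using f Ck_on_imp_continuous_on by blast
    then show "continuous_on U (\<lambda>v. complex_of_real (ln (Re (f v))))"
      by (auto intro!: continuous_intros dest: pos)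
    fix j and u :: complex assume ju: "j < n" "u \<in> {1, \<i>}"
    have f': "Ck_on n k' U f" using f Suc by (simp add: Ck_on_mono)
    show "Ck_on n k' U (\<lambda>v. inverse (of_real (Re (f v))) * of_real (Re (pderiv_dir j u f v)))"
      by (intro Ck_on_mult[OF U] Ck_on_inverse[OF U] Ck_on_Re[OF U] f' Ck_on_pderiv_dir[OF f[unfolded Suc] ju])
        (auto dest: pos)
    fix v assume v: "v \<in> U"
    have "Re (f (v(j := v j + of_real 0 * u))) > 0" using pos v by simp
    then show "((\<lambda>t::real. complex_of_real (ln (Re (f (v(j := v j + of_real t * u))))))
      has_vector_derivative inverse (of_real (Re (f v))) * of_real (Re (pderiv_dir j u f v))) (at 0)"
      using pderiv_dir_works[OF f[unfolded Suc] v ju] unfolding has_vector_derivative_def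
      by (auto intro!: derivative_eq_intros simp: fun_eq_iff field_simps scaleR_conv_of_real)
  qed
qed

section \<open>Restriction to holomorphic curves and complex lines\<close>

lemma chain_rule_holo:
  fixes g :: "cvec \<Rightarrow> complex" and \<gamma> :: "complex \<Rightarrow> cvec"
  assumes U: "openin (top_of_set (Cspace n)) U" and g: "Ck_on n (Suc 0) U g"
    and \<gamma>: "\<forall>\<^sub>F t in nhds t0. \<gamma> t \<in> Cspace n" "\<gamma> t0 \<in> U"
      "\<And>j. j < n \<Longrightarrow> ((\<lambda>t. \<gamma> t j) has_field_derivative b j) (at t0)"
    and holo: "\<And>j. j < n \<Longrightarrow> dzbar j g (\<gamma> t0) = 0"
  shows "((\<lambda>t. g (\<gamma> t)) has_field_derivative (\<Sum>j<n. dz j g (\<gamma> t0) * b j)) (at t0)"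
proof -
  have "((\<lambda>t. g (\<gamma> t)) has_derivative
    (\<lambda>h. \<Sum>j<n. dz j g (\<gamma> t0) * (b j * h) + dzbar j g (\<gamma> t0) * cnj (b j * h))) (at t0)"
    by (rule chain_rule_Cspace[OF U g \<gamma>(1,2)]) (use \<gamma>(3) in \<open>simp add: has_field_derivative_def\<close>)
  then show ?thesis
    unfolding has_field_derivative_def
    by (rule has_derivative_eq_rhs) (simp add: holo sum_distrib_right mult.assoc fun_eq_iff)
qed

definition cline :: "cvec \<Rightarrow> cvec \<Rightarrow> complex \<Rightarrow> cvec" where
  "cline v b t = (\<lambda>k. v k + t * b k)"

lemma cline_0 [simp]: "cline v b 0 = v"
  by (simp add: cline_def)

lemma cline_Cspace: "v \<in> Cspace n \<Longrightarrow> b \<in> Cspace n \<Longrightarrow> cline v b t \<in> Cspace n"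
  by (auto simp: cline_def Cspace_def)

lemma cline_deriv: "((\<lambda>t. cline v b t j) has_field_derivative b j) (at t0)"
  unfolding cline_def by (auto intro!: derivative_eq_intros)

lemma ex_uniform_bound: "\<exists>K>0. \<forall>j<n::nat. norm (b j :: complex) \<le> K"
proof -
  have "norm (b j) \<le> 1 + (\<Sum>i<n. norm (b i))" if "j < n" for j
  proof -
    have "norm (b j) \<le> (\<Sum>i<n. norm (b i))" by (rule member_le_sum) (use that in auto)
    then show ?thesis by simp
  qed
  moreover have "1 + (\<Sum>i<n. norm (b i)) > 0" by (simp add: add_pos_nonneg sum_nonneg)
  ultimately show ?thesis by blast
qed

lemma cline_in_open:
  assumes U: "openin (top_of_set (Cspace n)) U" and v: "v \<in> U" and b: "b \<in> Cspace n"
  obtains r where "r > 0" "\<And>t. norm t \<le> r \<Longrightarrow> cline v b t \<in> U"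
proof -
  obtain e where e: "e > 0" "\<And>w. w \<in> Cspace n \<Longrightarrow> (\<And>j. j < n \<Longrightarrow> norm (w j - v j) < e) \<Longrightarrow> w \<in> U"
    using Cspace_box[OF U v] by metis
  obtain K where K: "K > 0" "\<forall>j<n. norm (b j) \<le> K" using ex_uniform_bound by blast
  have "cline v b t \<in> U" if t: "norm t \<le> e / (2 * K)" for t
  proof (rule e(2))
    show "cline v b t \<in> Cspace n"
      using b v U by (auto intro: cline_Cspace dest: openin_Cspace_subset)
    fix j assume "j < n"
    then have "norm t * norm (b j) \<le> e / (2 * K) * K" using t K e(1) by (intro mult_mono) auto
    also have "\<dots> < e" using e(1) K by (simp add: field_simps)
    finally show "norm (cline v b t j - v j) < e" by (simp add: cline_def norm_mult)
  qed
  then show ?thesis using that[of "e / (2 * K)"] e K by auto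
qed

lemma continuous_on_cvec:
  fixes \<gamma> :: "'p::topological_space \<Rightarrow> cvec"
  assumes "\<And>j. continuous_on S (\<lambda>t. \<gamma> t j)"
  shows "continuous_on S \<gamma>"
  using assms by (rule continuous_on_coordinatewise_then_product)

text \<open>The difference quotients in direction \<open>l\<close> are holomorphic along complex lines, and they
  converge uniformly to \<open>dz l g\<close>.\<close>

lemma dz_holomorphic_on_cline:
  assumes U: "openin (top_of_set (Cspace n)) U" and g: "Ck_on n (Suc 0) U g"
    and holo: "\<And>j w. j < n \<Longrightarrow> w \<in> U \<Longrightarrow> dzbar j g w = 0"
    and v: "v \<in> U" and b: "b \<in> Cspace n" and l: "l < n"
  obtains r where "r > 0" "\<And>t. norm t \<le> r \<Longrightarrow> cline v b t \<in> U"
    "(\<lambda>t. dz l g (cline v b t)) holomorphic_on ball 0 r"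
proof -
  define z where "z t s = (cline v b t)(l := cline v b t l + of_real s * 1)" for t and s :: real
  have vC: "v \<in> Cspace n" using U v openin_Cspace_subset by blast
  have zC: "z t s \<in> Cspace n" for t s
    unfolding z_def by (intro Cspace_upd cline_Cspace vC b l)
  obtain e where e: "e > 0" "\<And>w. w \<in> Cspace n \<Longrightarrow> (\<And>j. j < n \<Longrightarrow> norm (w j - v j) < e) \<Longrightarrow> w \<in> U"
    using Cspace_box[OF U v] by metis
  obtain K where K: "K > 0" "\<forall>j<n. norm (b j) \<le> K" using ex_uniform_bound by blast
  \<comment> \<open>The displacement \<open>t * b\<close> and the real increment \<open>s\<close>
    each use at most a third of the radius \<open>e\<close> of the box.\<close>
  define r where "r = e / (3 * K)"
  define d where "d = e / 3"
  have pos: "r > 0" "d > 0" using e K by (auto simp: r_def d_def)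
  have zU: "z t s \<in> U" if t: "norm t \<le> r" and s: "\<bar>s\<bar> \<le> d" for t s
  proof (rule e(2)[OF zC])
    fix j assume j: "j < n"
    have "norm t * norm (b j) \<le> r * K" using t K e(1) j pos by (intro mult_mono) auto
    also have "\<dots> = e / 3" using K by (simp add: r_def)
    finally have 1: "norm (t * b j) \<le> e / 3" by (simp add: norm_mult)
    have "norm (t * b j + of_real s) \<le> e / 3 + e / 3"
      using 1 s by (intro norm_triangle_mono) (auto simp: d_def)
    then show "norm (z t s j - v j) < e"
      using 1 e(1) by (auto simp: z_def cline_def algebra_simps)
  qed
  let ?P = "pderiv_dir l 1 g"
  have Pc: "continuous_on U ?P"
    using Ck_on_pderiv_dir[OF g l] by simp
  \<comment> \<open>By the Cauchy--Riemann equation the Wirtinger derivative is the derivative in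
    the real direction, so real increments suffice for the difference quotients.\<close>
  have Pdz: "dz l g w = ?P w" if "w \<in> U" for w
  proof -
    have "?P w + \<i> * pderiv_dir l \<i> g w = 0"
      using holo[OF l that] by (simp add: dzbar_def)
    then have "\<i> * pderiv_dir l \<i> g w = - ?P w" by (simp add: add_eq_0_iff)
    then show ?thesis by (simp add: dz_def)
  qed
  have cz: "continuous_on S (\<lambda>x. z (fst x) (snd x))" for S
  proof (rule continuous_on_cvec)
    show "continuous_on S (\<lambda>x. z (fst x) (snd x) j)" for j
      unfolding z_def cline_def by (cases "j = l") (auto intro!: continuous_intros)
  qed
  have "uniformly_continuous_on (cball 0 r \<times> {-d..d}) (\<lambda>x. ?P (z (fst x) (snd x)))"
  proof (rule compact_uniformly_continuous)
    show "continuous_on (cball 0 r \<times> {- d..d}) (\<lambda>x. ?P (z (fst x) (snd x)))"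
      by (rule continuous_on_compose2[OF Pc cz]) (use zU in auto)
  qed (intro compact_Times compact_cball compact_Icc)
  note uc = this[unfolded uniformly_continuous_on_def, THEN spec, THEN mp]
  have quot: "norm ((g (z t s) - g (z t 0)) / of_real s - ?P (z t 0)) \<le> \<epsilon>"
    if t: "norm t \<le> r" and s: "0 < s" "s \<le> d" and
      est: "\<And>s'. 0 \<le> s' \<Longrightarrow> s' \<le> s \<Longrightarrow> norm (?P (z t s') - ?P (z t 0)) \<le> \<epsilon>" for t s \<epsilon>
  proof -
    have "norm (g (z t s) - g (z t 0) - (s - 0) *\<^sub>R ?P (z t 0)) \<le> norm (s - 0) * \<epsilon>"
    proof (rule vector_differentiable_bound_linearization[where f' = "\<lambda>s. ?P (z t s)" and S = "{0..s}"])
      fix x assume x: "x \<in> {0..s}"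
      have zx: "z t x \<in> U" using x s t by (intro zU) auto
      have "((\<lambda>s. g (z t s)) has_vector_derivative ?P (z t x)) (at x)"
        unfolding z_def
        by (rule pderiv_dir_shift[of g "cline v b t" l x 1])
          (rule Ck_on_differentiable[OF g zx[unfolded z_def] l], simp)
      then show "((\<lambda>s. g (z t s)) has_vector_derivative ?P (z t x)) (at x within {0..s})"
        by (rule has_vector_derivative_at_within)
    qed (use s est in \<open>auto simp: closed_segment_eq_real_ivl\<close>)
    moreover have "(g (z t s) - g (z t 0)) / of_real s - ?P (z t 0) =
      (g (z t s) - g (z t 0) - (s - 0) *\<^sub>R ?P (z t 0)) / of_real s"
      using s by (simp add: diff_divide_distrib scaleR_conv_of_real)
    ultimately show ?thesis
      using s by (simp add: norm_divide field_simps)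
  qed
  define h where "h k = d / real (Suc k)" for k
  have h: "0 < h k" "h k \<le> d" for k using pos by (auto simp: h_def field_simps)
  have hlim: "h \<longlonglongrightarrow> 0"
    unfolding h_def using LIMSEQ_Suc[OF lim_const_over_n[of d]] by simp
  define \<Psi> where "\<Psi> k t = (g (z t (h k)) - g (z t 0)) / of_real (h k)" for k t
  have ul: "uniform_limit (cball 0 r) \<Psi> (\<lambda>t. ?P (z t 0)) sequentially"
    unfolding uniform_limit_iff
  proof (intro allI impI)
    fix \<epsilon> :: real assume eps: "\<epsilon> > 0"
    obtain \<delta> where \<delta>: "\<delta> > 0" "\<And>x x'. x \<in> cball 0 r \<times> {-d..d} \<Longrightarrow> x' \<in> cball 0 r \<times> {-d..d} \<Longrightarrow>
      dist x' x < \<delta> \<Longrightarrow> dist (?P (z (fst x') (snd x'))) (?P (z (fst x) (snd x))) < \<epsilon> / 2"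
      using uc[OF half_gt_zero[OF eps]] by blast
    have "\<forall>\<^sub>F k in sequentially. dist (h k) 0 < \<delta>"
      using hlim \<delta>(1) by (rule tendstoD)
    then show "\<forall>\<^sub>F k in sequentially. \<forall>t\<in>cball 0 r. dist (\<Psi> k t) (?P (z t 0)) < \<epsilon>"
    proof eventually_elim
      case (elim k)
      have "norm (\<Psi> k t - ?P (z t 0)) \<le> \<epsilon> / 2" if t: "t \<in> cball 0 r" for t
        unfolding \<Psi>_def
      proof (rule quot)
        fix s' assume s': "0 \<le> s'" "s' \<le> h k"
        show "norm (?P (z t s') - ?P (z t 0)) \<le> \<epsilon> / 2"
          using \<delta>(2)[of "(t, 0)" "(t, s')"] s' h[of k] elim t pos
          by (auto simp: dist_norm dist_Pair_Pair dist_real_def)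
      qed (use t h in auto)
      then show ?case using \<open>\<epsilon> > 0\<close> by (force simp: dist_norm)
    qed
  qed
  have \<Psi>h: "\<Psi> k field_differentiable (at t)" if t: "norm t \<le> r" for k t
  proof -
    have "((\<lambda>t. g (z t s)) has_field_derivative (\<Sum>j<n. dz j g (z t s) * b j)) (at t)"
      if "\<bar>s\<bar> \<le> d" for s
    proof (rule chain_rule_holo[OF U g])
      fix j
      show "((\<lambda>t. z t s j) has_field_derivative b j) (at t)"
        unfolding z_def cline_def by (cases "j = l") (auto intro!: derivative_eq_intros)
    qed (use zC zU t that holo in auto)
    from this[of "h k"] this[of 0] show ?thesis
      unfolding \<Psi>_def using h[of k] pos
      by (intro field_differentiable_divide field_differentiable_diff field_differentiable_const)
        (auto simp: field_differentiable_def)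
  qed
  have \<Psi>1: "\<Psi> k holomorphic_on cball 0 r" for k
    unfolding holomorphic_on_def using \<Psi>h by (auto intro: field_differentiable_at_within)
  have "\<forall>\<^sub>F k in sequentially. continuous_on (cball 0 r) (\<Psi> k) \<and> \<Psi> k holomorphic_on ball 0 r"
    using \<Psi>1 holomorphic_on_subset[OF \<Psi>1 ball_subset_cball]
    by (auto intro!: always_eventually holomorphic_on_imp_continuous_on)
  then obtain "(\<lambda>t. ?P (z t 0)) holomorphic_on ball 0 r"
    using holomorphic_uniform_limit[OF _ ul] by (metis trivial_limit_sequentially)
  then have "(\<lambda>t. dz l g (cline v b t)) holomorphic_on ball 0 r"
    by (rule holomorphic_transform) (use Pdz zU[of _ 0] pos in \<open>auto simp: z_def\<close>)
  then show ?thesis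
    using that[of r] zU[of _ 0] pos by (auto simp: z_def)
qed

section \<open>Second derivatives and Laplacians at the origin\<close>

text \<open>The first derivative \<open>p\<close> is carried along because the second derivative of
  a logarithm involves it.\<close>

definition deriv2_at0 :: "(real \<Rightarrow> real) \<Rightarrow> real \<Rightarrow> real \<Rightarrow> bool" where
  "deriv2_at0 \<psi> p a \<longleftrightarrow> (\<exists>\<psi>'. (\<forall>\<^sub>F x in nhds 0. (\<psi> has_real_derivative \<psi>' x) (at x)) \<and>
     \<psi>' 0 = p \<and> (\<psi>' has_real_derivative a) (at 0))"

lemma deriv2_at0_cmult: "deriv2_at0 \<psi> p a \<Longrightarrow> deriv2_at0 (\<lambda>x. c * \<psi> x) (c * p) (c * a)"
  unfolding deriv2_at0_def
proof (elim exE conjE)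
  fix \<psi>' assume *: "\<forall>\<^sub>F x in nhds 0. (\<psi> has_real_derivative \<psi>' x) (at x)" "\<psi>' 0 = p"
    "(\<psi>' has_real_derivative a) (at 0)"
  show "\<exists>\<psi>'. (\<forall>\<^sub>F x in nhds 0. ((\<lambda>x. c * \<psi> x) has_real_derivative \<psi>' x) (at x)) \<and>
     \<psi>' 0 = c * p \<and> (\<psi>' has_real_derivative c * a) (at 0)"
    using * by (intro exI[of _ "\<lambda>x. c * \<psi>' x"])
      (auto elim!: eventually_mono intro: DERIV_cmult)
qed

lemma deriv2_at0_add:
  "deriv2_at0 \<psi> p a \<Longrightarrow> deriv2_at0 \<phi> q b \<Longrightarrow> deriv2_at0 (\<lambda>x. \<psi> x + \<phi> x) (p + q) (a + b)"
  unfolding deriv2_at0_def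
proof (elim exE conjE)
  fix \<psi>' \<phi>' assume *: "\<forall>\<^sub>F x in nhds 0. (\<psi> has_real_derivative \<psi>' x) (at x)" "\<psi>' 0 = p"
    "(\<psi>' has_real_derivative a) (at 0)"
    "\<forall>\<^sub>F x in nhds 0. (\<phi> has_real_derivative \<phi>' x) (at x)" "\<phi>' 0 = q"
    "(\<phi>' has_real_derivative b) (at 0)"
  have "\<forall>\<^sub>F x in nhds 0. ((\<lambda>x. \<psi> x + \<phi> x) has_real_derivative \<psi>' x + \<phi>' x) (at x)"
    using *(1,4) by eventually_elim (rule DERIV_add)
  then show "\<exists>\<psi>'. (\<forall>\<^sub>F x in nhds 0. ((\<lambda>x. \<psi> x + \<phi> x) has_real_derivative \<psi>' x) (at x)) \<and>
     \<psi>' 0 = p + q \<and> (\<psi>' has_real_derivative a + b) (at 0)"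
    using * by (intro exI[of _ "\<lambda>x. \<psi>' x + \<phi>' x"]) (auto intro: DERIV_add)
qed

lemma deriv2_at0_const: "deriv2_at0 (\<lambda>x. c) 0 0"
  unfolding deriv2_at0_def by (intro exI[of _ "\<lambda>x. 0"]) auto

lemma deriv2_at0_ln:
  assumes "deriv2_at0 \<psi> p a" "\<psi> 0 > 0"
  shows "deriv2_at0 (\<lambda>x. ln (\<psi> x)) (p / \<psi> 0) (a / \<psi> 0 - (p / \<psi> 0)\<^sup>2)"
proof -
  obtain \<psi>' where *: "\<forall>\<^sub>F x in nhds 0. (\<psi> has_real_derivative \<psi>' x) (at x)" "\<psi>' 0 = p"
    "(\<psi>' has_real_derivative a) (at 0)"
    using assms(1) unfolding deriv2_at0_def by blast
  have d0: "(\<psi> has_real_derivative p) (at 0)" using *(1,2) eventually_nhds_x_imp_x by fastforce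
  then have "isCont \<psi> 0" by (rule DERIV_isCont)
  then have "(\<psi> \<longlongrightarrow> \<psi> 0) (nhds 0)" by (simp add: continuous_at tendsto_at_iff_tendsto_nhds)
  then have "\<forall>\<^sub>F x in nhds 0. \<psi> x > 0" using assms(2) by (rule order_tendstoD)
  with *(1) have "\<forall>\<^sub>F x in nhds 0. ((\<lambda>x. ln (\<psi> x)) has_real_derivative \<psi>' x / \<psi> x) (at x)"
    by eventually_elim (auto intro!: derivative_eq_intros)
  moreover have "((\<lambda>x. \<psi>' x / \<psi> x) has_real_derivative a / \<psi> 0 - (p / \<psi> 0)\<^sup>2) (at 0)"
    using *(2,3) d0 assms(2) by (auto intro!: derivative_eq_intros simp: power2_eq_square field_simps)
  ultimately show ?thesis
    unfolding deriv2_at0_def using *(2) by (intro exI[of _ "\<lambda>x. \<psi>' x / \<psi> x"]) auto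
qed

lemma deriv2_at0_cong:
  assumes "deriv2_at0 \<psi> p a" "\<forall>\<^sub>F x in nhds 0. \<psi> x = \<phi> x"
  shows "deriv2_at0 \<phi> p a"
proof -
  obtain \<psi>' where *: "\<forall>\<^sub>F x in nhds 0. (\<psi> has_real_derivative \<psi>' x) (at x)" "\<psi>' 0 = p"
    "(\<psi>' has_real_derivative a) (at 0)"
    using assms(1) unfolding deriv2_at0_def by blast
  have "\<forall>\<^sub>F x in nhds 0. \<forall>\<^sub>F y in nhds x. \<psi> y = \<phi> y"
    using assms(2) by (simp add: eventually_eventually)
  with *(1) have "\<forall>\<^sub>F x in nhds 0. (\<phi> has_real_derivative \<psi>' x) (at x)"
    by eventually_elim (metis DERIV_cong_ev)
  then show ?thesis using * unfolding deriv2_at0_def by blast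
qed

text \<open>At a maximum the first derivative is 0. A positive second derivative would make it
  positive just to the right of 0, and the function would increase strictly there.\<close>

lemma deriv2_at0_local_max:
  assumes "deriv2_at0 \<psi> p a" "\<forall>\<^sub>F x in nhds 0. \<psi> x \<le> \<psi> 0"
  shows "a \<le> 0"
proof (rule ccontr)
  assume "\<not> a \<le> 0"
  then have a: "a > 0" by simp
  obtain \<psi>' where *: "\<forall>\<^sub>F x in nhds 0. (\<psi> has_real_derivative \<psi>' x) (at x)" "\<psi>' 0 = p"
    "(\<psi>' has_real_derivative a) (at 0)"
    using assms(1) unfolding deriv2_at0_def by blast
  obtain e where e: "e > 0" "\<And>x. \<bar>x\<bar> < e \<Longrightarrow> (\<psi> has_real_derivative \<psi>' x) (at x) \<and> \<psi> x \<le> \<psi> 0"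
    using eventually_conj[OF *(1) assms(2)] unfolding eventually_nhds_metric by (auto simp: dist_real_def)
  have p0: "p = 0"
    using DERIV_local_max[of \<psi> p 0 e] e(2) e *(2) by force
  obtain d where d: "d > 0" "\<And>h. 0 < h \<Longrightarrow> h < d \<Longrightarrow> \<psi>' 0 < \<psi>' (0 + h)"
    using DERIV_pos_inc_right[OF *(3) a] by auto
  define x where "x = min e d / 2"
  have x: "0 < x" "x < e" "x < d" using e d by (auto simp: x_def)
  have "\<psi> 0 < \<psi> x"
  proof (rule DERIV_pos_imp_increasing_open[OF x(1)])
    fix y assume "0 < y" "y < x"
    then show "\<exists>l. (\<psi> has_real_derivative l) (at y) \<and> 0 < l"
      using e(2)[of y] d(2)[of y] x p0 *(2) by auto
  next
    show "continuous_on {0..x} \<psi>"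
    proof (intro continuous_at_imp_continuous_on ballI)
      fix y assume "y \<in> {0..x}"
      then have "(\<psi> has_real_derivative \<psi>' y) (at y)" using e(2)[of y] x by auto
      then show "isCont \<psi> y" by (rule DERIV_isCont)
    qed
  qed
  then show False using e(2)[of x] x by auto
qed

definition laplacian_at0 :: "(complex \<Rightarrow> real) \<Rightarrow> real \<Rightarrow> bool" where
  "laplacian_at0 \<phi> L \<longleftrightarrow> (\<exists>p a q b. deriv2_at0 (\<lambda>x. \<phi> (of_real x)) p a \<and>
     deriv2_at0 (\<lambda>x. \<phi> (of_real x * \<i>)) q b \<and> L = a + b)"

lemma laplacian_at0_cmult: "laplacian_at0 \<phi> L \<Longrightarrow> laplacian_at0 (\<lambda>t. c * \<phi> t) (c * L)"
  unfolding laplacian_at0_def using deriv2_at0_cmult by (metis distrib_left)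

lemma laplacian_at0_add:
  "laplacian_at0 \<phi> L \<Longrightarrow> laplacian_at0 \<phi>' L' \<Longrightarrow> laplacian_at0 (\<lambda>t. \<phi> t + \<phi>' t) (L + L')"
  unfolding laplacian_at0_def
proof (elim exE conjE)
  fix p a q b p' a' q' b'
  assume *: "deriv2_at0 (\<lambda>x. \<phi> (of_real x)) p a" "deriv2_at0 (\<lambda>x. \<phi> (of_real x * \<i>)) q b" "L = a + b"
    "deriv2_at0 (\<lambda>x. \<phi>' (of_real x)) p' a'" "deriv2_at0 (\<lambda>x. \<phi>' (of_real x * \<i>)) q' b'" "L' = a' + b'"
  show "\<exists>p a q b. deriv2_at0 (\<lambda>x. \<phi> (of_real x) + \<phi>' (of_real x)) p a \<and>
     deriv2_at0 (\<lambda>x. \<phi> (of_real x * \<i>) + \<phi>' (of_real x * \<i>)) q b \<and> L + L' = a + b"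
    using deriv2_at0_add[OF *(1,4)] deriv2_at0_add[OF *(2,5)] *(3,6)
    by (intro exI[of _ "p + p'"] exI[of _ "a + a'"] exI[of _ "q + q'"] exI[of _ "b + b'"]) simp
qed

lemma eventually_nhds_direction:
  assumes "\<forall>\<^sub>F t in nhds (0::complex). P t"
  shows "\<forall>\<^sub>F x in nhds (0::real). P (of_real x * u)"
proof -
  have "((\<lambda>x::real. of_real x * u) \<longlongrightarrow> of_real 0 * u) (nhds 0)"
    by (intro tendsto_intros) (auto simp: filterlim_ident)
  then have "filterlim (\<lambda>x::real. of_real x * u) (nhds 0) (nhds 0)" by simp
  then show ?thesis using assms by (rule eventually_compose_filterlim[rotated])
qed

lemma laplacian_at0_cong:
  assumes "laplacian_at0 \<phi> L" "\<forall>\<^sub>F t in nhds 0. \<phi> t = \<phi>' t"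
  shows "laplacian_at0 \<phi>' L"
proof -
  have "\<forall>\<^sub>F x in nhds 0. \<phi> (of_real x) = \<phi>' (of_real x)" "\<forall>\<^sub>F x in nhds 0. \<phi> (of_real x * \<i>) = \<phi>' (of_real x * \<i>)"
    using eventually_nhds_direction[OF assms(2), of 1] eventually_nhds_direction[OF assms(2), of \<i>] by auto
  then show ?thesis
    using assms(1) unfolding laplacian_at0_def by (blast intro: deriv2_at0_cong)
qed

lemma laplacian_at0_local_max:
  assumes "laplacian_at0 \<phi> L" "\<forall>\<^sub>F t in nhds 0. \<phi> t \<le> \<phi> 0"
  shows "L \<le> 0"
proof -
  have "\<forall>\<^sub>F x in nhds 0. \<phi> (of_real x) \<le> \<phi> (of_real 0)" "\<forall>\<^sub>F x in nhds 0. \<phi> (of_real x * \<i>) \<le> \<phi> (of_real 0 * \<i>)"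
    using eventually_nhds_direction[OF assms(2), of 1] eventually_nhds_direction[OF assms(2), of \<i>] by auto
  then show ?thesis
    using assms(1) deriv2_at0_local_max unfolding laplacian_at0_def
    by (metis add_nonpos_nonpos)
qed

lemma pderiv_dir_real:
  assumes "Ck_on n (Suc k) U (\<lambda>v. of_real (g v))" "v \<in> U" "j < n" "u \<in> {1, \<i>}"
  shows "Im (pderiv_dir j u (\<lambda>v. complex_of_real (g v)) v) = 0"
proof -
  have "((\<lambda>t::real. complex_of_real (g (v(j := v j + of_real t * u)))) has_vector_derivative
      pderiv_dir j u (\<lambda>v. complex_of_real (g v)) v) (at 0)"
    by (rule pderiv_dir_works[OF assms])
  then have "((\<lambda>t::real. Im (complex_of_real (g (v(j := v j + of_real t * u))))) has_vector_derivative
      Im (pderiv_dir j u (\<lambda>v. complex_of_real (g v)) v)) (at 0)"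
    by (rule bounded_linear.has_vector_derivative[OF bounded_linear_Im])
  then show ?thesis
    by (simp add: has_vector_derivative_const vector_derivative_unique_at)
qed

lemma dz_eq_cnj_dzbar:
  assumes "Ck_on n (Suc k) U (\<lambda>v. of_real (g v))" "v \<in> U" "j < n"
  shows "dz j (\<lambda>v. complex_of_real (g v)) v = cnj (dzbar j (\<lambda>v. complex_of_real (g v)) v)"
proof -
  have "Im (pderiv_dir j u (\<lambda>v. complex_of_real (g v)) v) = 0" if "u \<in> {1, \<i>}" for u
    using pderiv_dir_real[OF assms that] .
  then show ?thesis
    unfolding dz_def dzbar_def by (simp add: complex_eq_iff)
qed

lemma has_vector_derivative_direction:
  assumes "(h has_field_derivative D) (at (of_real x * u))"
  shows "((\<lambda>x::real. h (of_real x * u)) has_vector_derivative D * u) (at x)"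
proof -
  have "((\<lambda>x::real. of_real x * u) has_vector_derivative 1 * u) (at x)"
    using bounded_linear.has_vector_derivative[OF bounded_linear_of_real has_vector_derivative_id]
    by (intro has_vector_derivative_mult_left) simp
  from field_vector_diff_chain_at[OF this assms] show ?thesis
    by (simp add: o_def mult.commute)
qed

lemma eventually_direction_ball:
  assumes "\<rho> > 0"
  shows "\<forall>\<^sub>F x in nhds (0::real). of_real x * u \<in> ball (0::complex) \<rho>"
  by (rule eventually_nhds_direction, rule eventually_nhds_in_open) (use assms in auto)

text \<open>Since \<open>G\<close> is real, its \<open>dz\<close> terms are conjugate to its
  \<open>dzbar\<close> terms, and the first derivative along the curve is twice the real part of the
  \<open>dzbar\<close> terms. Differentiating these again meets either the coefficient or the
  velocity of the curve.\<close>

lemma deriv2_at0_comp: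
  fixes \<beta> :: "complex \<Rightarrow> cvec" and u :: complex
  assumes U: "openin (top_of_set (Cspace n)) U" and g: "Ck_on n (Suc (Suc 0)) U (\<lambda>v. of_real (g v))"
    and r: "\<rho> > 0" and holo: "\<And>j. j < n \<Longrightarrow> (\<lambda>t. \<beta> t j) holomorphic_on ball 0 \<rho>"
    and \<beta>U: "\<And>t. t \<in> ball 0 \<rho> \<Longrightarrow> \<beta> t \<in> U"
  defines "G \<equiv> \<lambda>v. complex_of_real (g v)"
  defines "B \<equiv> \<lambda>j. deriv (\<lambda>t. \<beta> t j)"
  shows "\<exists>p. deriv2_at0 (\<lambda>x. g (\<beta> (of_real x * u))) p
    (2 * Re (\<Sum>j<n. (\<Sum>l<n. dz l (dzbar j G) (\<beta> 0) * (B l 0 * u) + dzbar l (dzbar j G) (\<beta> 0) * cnj (B l 0 * u))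
        * cnj (B j 0 * u) + dzbar j G (\<beta> 0) * cnj (deriv (B j) 0 * u * u)))"
proof -
  have G1: "Ck_on n (Suc 0) U G" using g unfolding G_def by (rule Ck_on_mono)
  have dB: "((\<lambda>t. \<beta> t j) has_field_derivative B j t) (at t)" if "j < n" "t \<in> ball 0 \<rho>" for j t
    unfolding B_def by (rule holomorphic_derivI[OF holo]) (use that in auto)
  have hB: "B j holomorphic_on ball 0 \<rho>" if "j < n" for j
    unfolding B_def by (rule holomorphic_deriv[OF holo]) (use that in auto)
  have curve: "((\<lambda>x::real. h (\<beta> (of_real x * u))) has_vector_derivative
      (\<Sum>j<n. dz j h (\<beta> (of_real x * u)) * (B j (of_real x * u) * u) +
         dzbar j h (\<beta> (of_real x * u)) * cnj (B j (of_real x * u) * u))) (at x)"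
    if h: "Ck_on n (Suc 0) U h" and x: "of_real x * u \<in> ball 0 \<rho>" for h and x :: real
  proof -
    have "open ((\<lambda>x::real. of_real x * u) -` ball 0 \<rho>)"
      by (intro open_vimage continuous_intros) auto
    then have "\<forall>\<^sub>F y in nhds x. y \<in> (\<lambda>x::real. of_real x * u) -` ball 0 \<rho>"
      using x by (intro eventually_nhds_in_open) auto
    then have ev: "\<forall>\<^sub>F y in nhds x. \<beta> (of_real y * u) \<in> Cspace n"
      by eventually_elim (use \<beta>U U openin_Cspace_subset in blast)
    have "((\<lambda>x::real. h (\<beta> (of_real x * u))) has_derivative
      (\<lambda>k. \<Sum>j<n. dz j h (\<beta> (of_real x * u)) * (k *\<^sub>R (B j (of_real x * u) * u)) +
         dzbar j h (\<beta> (of_real x * u)) * cnj (k *\<^sub>R (B j (of_real x * u) * u)))) (at x)"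
      by (rule chain_rule_Cspace[OF U h ev \<beta>U[OF x]])
        (use has_vector_derivative_direction[OF dB[OF _ x]] in \<open>simp add: has_vector_derivative_def\<close>)
    then show ?thesis
      unfolding has_vector_derivative_def
      by (rule has_derivative_eq_rhs)
        (simp add: fun_eq_iff scaleR_conv_of_real sum_distrib_left distrib_left mult.left_commute)
  qed
  define S where "S x = (\<Sum>j<n. dzbar j G (\<beta> (of_real x * u)) * cnj (B j (of_real x * u) * u))" for x :: real
  have "\<forall>\<^sub>F x in nhds 0. ((\<lambda>x. g (\<beta> (of_real x * u))) has_real_derivative 2 * Re (S x)) (at x)"
    using eventually_direction_ball[OF r, of u]
  proof eventually_elim
    case (elim x)
    have "((\<lambda>x. Re (G (\<beta> (of_real x * u)))) has_vector_derivative
       Re (\<Sum>j<n. dz j G (\<beta> (of_real x * u)) * (B j (of_real x * u) * u) +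
         dzbar j G (\<beta> (of_real x * u)) * cnj (B j (of_real x * u) * u))) (at x)"
      by (rule bounded_linear.has_vector_derivative[OF bounded_linear_Re curve[OF G1 elim]])
    moreover have "Re (\<Sum>j<n. dz j G (\<beta> (of_real x * u)) * (B j (of_real x * u) * u) +
         dzbar j G (\<beta> (of_real x * u)) * cnj (B j (of_real x * u) * u)) = 2 * Re (S x)"
      unfolding S_def Re_sum sum_distrib_left
    proof (rule sum.cong)
      fix j assume "j \<in> {..<n}"
      then have *: "dz j G (\<beta> (of_real x * u)) = cnj (dzbar j G (\<beta> (of_real x * u)))"
        unfolding G_def by (intro dz_eq_cnj_dzbar[OF g \<beta>U[OF elim]]) simp
      show "Re (dz j G (\<beta> (of_real x * u)) * (B j (of_real x * u) * u) +
           dzbar j G (\<beta> (of_real x * u)) * cnj (B j (of_real x * u) * u)) =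
         2 * Re (dzbar j G (\<beta> (of_real x * u)) * cnj (B j (of_real x * u) * u))"
        unfolding * by (simp add: algebra_simps)
    qed simp
    ultimately show ?case
      by (simp add: G_def has_real_derivative_iff_has_vector_derivative)
  qed
  moreover have "((\<lambda>x. 2 * Re (S x)) has_real_derivative
    (2 * Re (\<Sum>j<n. (\<Sum>l<n. dz l (dzbar j G) (\<beta> 0) * (B l 0 * u) + dzbar l (dzbar j G) (\<beta> 0) * cnj (B l 0 * u))
        * cnj (B j 0 * u) + dzbar j G (\<beta> 0) * cnj (deriv (B j) 0 * u * u)))) (at 0)"
  proof -
    have 0: "of_real 0 * u \<in> ball (0::complex) \<rho>" using r by simp
    have "(S has_vector_derivative (\<Sum>j<n. (\<Sum>l<n. dz l (dzbar j G) (\<beta> 0) * (B l 0 * u) + dzbar l (dzbar j G) (\<beta> 0) * cnj (B l 0 * u))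
        * cnj (B j 0 * u) + dzbar j G (\<beta> 0) * cnj (deriv (B j) 0 * u * u))) (at 0)"
      unfolding S_def
    proof (rule has_vector_derivative_sum)
      fix j assume "j \<in> {..<n}"
      then have j: "j < n" by simp
      have "Ck_on n (Suc 0) U (dzbar j G)"
        using Ck_on_dz_dzbar(2)[OF U g j] by (simp add: G_def)
      from curve[OF this 0]
      have 1: "((\<lambda>x::real. dzbar j G (\<beta> (of_real x * u))) has_vector_derivative
        (\<Sum>l<n. dz l (dzbar j G) (\<beta> 0) * (B l 0 * u) + dzbar l (dzbar j G) (\<beta> 0) * cnj (B l 0 * u))) (at 0)"
        by simp
      have "(B j has_field_derivative deriv (B j) 0) (at (of_real 0 * u))"
        using holomorphic_derivI[OF hB[OF j], of 0] r by simp
      from has_vector_derivative_direction[OF this]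
      have "((\<lambda>x::real. cnj (B j (of_real x * u) * u)) has_vector_derivative cnj (deriv (B j) 0 * u * u)) (at 0)"
        by (intro has_vector_derivative_cnj has_vector_derivative_mult_left)
      from has_vector_derivative_mult[OF 1 this]
      show "((\<lambda>x. dzbar j G (\<beta> (complex_of_real x * u)) * cnj (B j (complex_of_real x * u) * u)) has_vector_derivative
         (\<Sum>l<n. dz l (dzbar j G) (\<beta> 0) * (B l 0 * u) + dzbar l (dzbar j G) (\<beta> 0) * cnj (B l 0 * u)) * cnj (B j 0 * u) +
         dzbar j G (\<beta> 0) * cnj (deriv (B j) 0 * u * u)) (at 0)"
        by (simp add: add.commute)
    qed
    from bounded_linear.has_vector_derivative[OF bounded_linear_Re this]
    show ?thesis
      by (intro DERIV_cmult) (simp add: has_real_derivative_iff_has_vector_derivative)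
  qed
  ultimately show ?thesis
    unfolding deriv2_at0_def by (intro exI[of _ "2 * Re (S 0)"] exI[of _ "\<lambda>x. 2 * Re (S x)"] conjI refl)
qed

text \<open>Summing over the directions \<open>1\<close> and \<open>\<i>\<close> cancels all terms but those of the complex Hessian, so
  that the symmetry of second derivatives is not needed.\<close>

lemma laplacian_at0_comp:
  fixes \<beta> :: "complex \<Rightarrow> cvec"
  assumes U: "openin (top_of_set (Cspace n)) U" and g: "Ck_on n (Suc (Suc 0)) U (\<lambda>v. of_real (g v))"
    and r: "\<rho> > 0" and holo: "\<And>j. j < n \<Longrightarrow> (\<lambda>t. \<beta> t j) holomorphic_on ball 0 \<rho>"
    and \<beta>U: "\<And>t. t \<in> ball 0 \<rho> \<Longrightarrow> \<beta> t \<in> U"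
  shows "laplacian_at0 (\<lambda>t. g (\<beta> t)) (4 * Re (\<Sum>l<n. \<Sum>j<n.
    dz l (dzbar j (\<lambda>v. complex_of_real (g v))) (\<beta> 0) * deriv (\<lambda>t. \<beta> t l) 0 * cnj (deriv (\<lambda>t. \<beta> t j) 0)))"
proof -
  define G where "G = (\<lambda>v. complex_of_real (g v))"
  define b where "b l = deriv (\<lambda>t. \<beta> t l) 0" for l
  define c where "c l = deriv (deriv (\<lambda>t. \<beta> t l)) 0" for l
  define Q where "Q u = 2 * Re (\<Sum>j<n. (\<Sum>l<n. dz l (dzbar j G) (\<beta> 0) * (b l * u) +
     dzbar l (dzbar j G) (\<beta> 0) * cnj (b l * u)) * cnj (b j * u) + dzbar j G (\<beta> 0) * cnj (c j * u * u))" for u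
  have "\<exists>p. deriv2_at0 (\<lambda>x. g (\<beta> (of_real x * u))) p (Q u)" for u
    using deriv2_at0_comp[OF U g r holo \<beta>U, of u] unfolding Q_def b_def c_def G_def by blast
  then obtain p q where "deriv2_at0 (\<lambda>x. g (\<beta> (of_real x * 1))) p (Q 1)"
    "deriv2_at0 (\<lambda>x. g (\<beta> (of_real x * \<i>))) q (Q \<i>)" by blast
  then have "laplacian_at0 (\<lambda>t. g (\<beta> t)) (Q 1 + Q \<i>)"
    unfolding laplacian_at0_def by (simp only: mult_1_right) blast
  also have "Q 1 + Q \<i> = 4 * Re (\<Sum>j<n. \<Sum>l<n. dz l (dzbar j G) (\<beta> 0) * b l * cnj (b j))"
    unfolding Q_def sum_distrib_right
    by (simp add: sum.distrib sum_subtractf sum_negf sum_distrib_left algebra_simps)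
  also have "(\<Sum>j<n. \<Sum>l<n. dz l (dzbar j G) (\<beta> 0) * b l * cnj (b j)) =
    (\<Sum>l<n. \<Sum>j<n. dz l (dzbar j G) (\<beta> 0) * b l * cnj (b j))"
    by (rule sum.swap)
  finally show ?thesis unfolding G_def b_def .
qed

text \<open>One computation for three functions: \<open>\<kappa> = 0\<close>, \<open>s = 1\<close>
  for a squared modulus, \<open>\<kappa> = 1\<close>, \<open>s = 1\<close> for the Fubini--Study
  potential, and \<open>\<kappa> = \<rho>\<close>, \<open>s = -1\<close> for the cutoff. The terms
  with second derivatives of \<open>V\<close> carry the factor \<open>u * u\<close> and cancel
  between the directions 1 and \<i>.\<close>

lemma laplacian_at0_ln_norm:
  fixes V :: "'i \<Rightarrow> complex \<Rightarrow> complex" and J :: "'i set" and \<kappa> s :: real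
  assumes r: "\<rho> > 0" and holo: "\<And>j. j \<in> J \<Longrightarrow> V j holomorphic_on ball 0 \<rho>"
    and pos: "\<kappa> + s * (\<Sum>j\<in>J. (norm (V j 0))\<^sup>2) > 0"
  defines "q \<equiv> \<kappa> + s * (\<Sum>j\<in>J. (norm (V j 0))\<^sup>2)"
  defines "S \<equiv> \<Sum>j\<in>J. deriv (V j) 0 * cnj (V j 0)"
  shows "laplacian_at0 (\<lambda>t. ln (\<kappa> + s * (\<Sum>j\<in>J. (norm (V j t))\<^sup>2)))
    (4 * s * (\<Sum>j\<in>J. (norm (deriv (V j) 0))\<^sup>2) / q - 4 * (s * norm S)\<^sup>2 / q\<^sup>2)"
proof -
  define N where "N t = (\<Sum>j\<in>J. (norm (V j t))\<^sup>2)" for t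
  define W where "W = (\<Sum>j\<in>J. deriv (deriv (V j)) 0 * cnj (V j 0))"
  define E where "E = (\<Sum>j\<in>J. (norm (deriv (V j) 0))\<^sup>2)"
  have dV: "(V j has_field_derivative deriv (V j) t) (at t)" if "j \<in> J" "t \<in> ball 0 \<rho>" for j t
    by (rule holomorphic_derivI[OF holo]) (use that in auto)
  have dV': "(deriv (V j) has_field_derivative deriv (deriv (V j)) t) (at t)" if "j \<in> J" "t \<in> ball 0 \<rho>" for j t
    by (rule holomorphic_derivI[OF holomorphic_deriv[OF holo]]) (use that in auto)
  have N: "deriv2_at0 (\<lambda>x. N (of_real x * u)) (2 * Re (S * u)) (2 * E + 2 * Re (W * u * u))"
    if u: "norm u = 1" for u
  proof -
    define T where "T x = (\<Sum>j\<in>J. deriv (V j) (of_real x * u) * u * cnj (V j (of_real x * u)))" for x :: real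
    have "\<forall>\<^sub>F x in nhds 0. ((\<lambda>x. N (of_real x * u)) has_real_derivative 2 * Re (T x)) (at x)"
      using eventually_direction_ball[OF r, of u]
    proof eventually_elim
      case (elim x)
      have 1: "((\<lambda>x. V j (of_real x * u)) has_vector_derivative deriv (V j) (of_real x * u) * u) (at x)"
        if "j \<in> J" for j by (rule has_vector_derivative_direction[OF dV[OF that elim]])
      have "((\<lambda>x. V j (of_real x * u) * cnj (V j (of_real x * u))) has_vector_derivative
        V j (of_real x * u) * cnj (deriv (V j) (of_real x * u) * u) +
        deriv (V j) (of_real x * u) * u * cnj (V j (of_real x * u))) (at x)"
        if "j \<in> J" for j
        by (rule has_vector_derivative_mult[OF 1[OF that] has_vector_derivative_cnj[OF 1[OF that]]])
      then have "((\<lambda>x. \<Sum>j\<in>J. V j (of_real x * u) * cnj (V j (of_real x * u))) has_vector_derivative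
        (\<Sum>j\<in>J. V j (of_real x * u) * cnj (deriv (V j) (of_real x * u) * u) +
        deriv (V j) (of_real x * u) * u * cnj (V j (of_real x * u)))) (at x)"
        by (rule has_vector_derivative_sum)
      from bounded_linear.has_vector_derivative[OF bounded_linear_Re this]
      have "((\<lambda>x. N (of_real x * u)) has_vector_derivative
        Re (\<Sum>j\<in>J. V j (of_real x * u) * cnj (deriv (V j) (of_real x * u) * u) +
        deriv (V j) (of_real x * u) * u * cnj (V j (of_real x * u)))) (at x)"
        by (simp add: N_def complex_mult_cnj cmod_power2)
      moreover have "Re (\<Sum>j\<in>J. V j (of_real x * u) * cnj (deriv (V j) (of_real x * u) * u) +
        deriv (V j) (of_real x * u) * u * cnj (V j (of_real x * u))) = 2 * Re (T x)"
        unfolding T_def Re_sum sum_distrib_left by (intro sum.cong) (auto simp: algebra_simps)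
      ultimately show ?case by (simp add: has_real_derivative_iff_has_vector_derivative)
    qed
    moreover have "((\<lambda>x. 2 * Re (T x)) has_real_derivative 2 * E + 2 * Re (W * u * u)) (at 0)"
    proof -
      have 0: "of_real 0 * u \<in> ball (0::complex) \<rho>" using r by simp
      have "(T has_vector_derivative
        (\<Sum>j\<in>J. deriv (V j) 0 * u * cnj (deriv (V j) 0 * u) + deriv (deriv (V j)) 0 * u * u * cnj (V j 0))) (at 0)"
        unfolding T_def
      proof (rule has_vector_derivative_sum)
        fix j assume j: "j \<in> J"
        have 1: "((\<lambda>x. cnj (V j (of_real x * u))) has_vector_derivative cnj (deriv (V j) 0 * u)) (at 0)"
          using has_vector_derivative_cnj[OF has_vector_derivative_direction[OF dV[OF j 0]]] by simp
        have 2: "((\<lambda>x. deriv (V j) (of_real x * u) * u) has_vector_derivative deriv (deriv (V j)) 0 * u * u) (at 0)"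
          using has_vector_derivative_mult_left[OF has_vector_derivative_direction[OF dV'[OF j 0]], of u] by simp
        from has_vector_derivative_mult[OF 2 1]
        show "((\<lambda>x. deriv (V j) (complex_of_real x * u) * u * cnj (V j (complex_of_real x * u))) has_vector_derivative
         deriv (V j) 0 * u * cnj (deriv (V j) 0 * u) + deriv (deriv (V j)) 0 * u * u * cnj (V j 0)) (at 0)"
          by simp
      qed
      from bounded_linear.has_vector_derivative[OF bounded_linear_Re this]
      have 3: "((\<lambda>x. 2 * Re (T x)) has_real_derivative 2 * Re (\<Sum>j\<in>J. deriv (V j) 0 * u * cnj (deriv (V j) 0 * u) +
         deriv (deriv (V j)) 0 * u * u * cnj (V j 0))) (at 0)"
        by (intro DERIV_cmult) (simp add: has_real_derivative_iff_has_vector_derivative)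
      have "deriv (V j) 0 * u * cnj (deriv (V j) 0 * u) = of_real ((norm (deriv (V j) 0))\<^sup>2)" for j
        unfolding complex_norm_square[symmetric] using u by (simp add: norm_mult)
      then have "(\<Sum>j\<in>J. deriv (V j) 0 * u * cnj (deriv (V j) 0 * u) + deriv (deriv (V j)) 0 * u * u * cnj (V j 0)) =
        of_real E + W * u * u"
        by (simp add: E_def W_def sum.distrib sum_distrib_left sum_distrib_right mult_ac)
      then show ?thesis using 3 by simp
    qed
    moreover have "T 0 = S * u"
      unfolding T_def S_def sum_distrib_right by (rule sum.cong) (auto simp: mult_ac)
    then have "2 * Re (T 0) = 2 * Re (S * u)" by simp
    ultimately show ?thesis
      unfolding deriv2_at0_def by (intro exI[of _ "\<lambda>x. 2 * Re (T x)"] conjI)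
  qed
  have L: "deriv2_at0 (\<lambda>x. ln (\<kappa> + s * N (of_real x * u))) (s * (2 * Re (S * u)) / q)
    (s * (2 * E + 2 * Re (W * u * u)) / q - (s * (2 * Re (S * u)) / q)\<^sup>2)" if u: "norm u = 1" for u
    using deriv2_at0_ln[OF deriv2_at0_add[OF deriv2_at0_const[of \<kappa>] deriv2_at0_cmult[OF N[OF u], of s]]] pos
    by (simp add: q_def N_def)
  have "laplacian_at0 (\<lambda>t. ln (\<kappa> + s * N t))
     ((s * (2 * E + 2 * Re (W * 1 * 1)) / q - (s * (2 * Re (S * 1)) / q)\<^sup>2) +
      (s * (2 * E + 2 * Re (W * \<i> * \<i>)) / q - (s * (2 * Re (S * \<i>)) / q)\<^sup>2))"
    unfolding laplacian_at0_def using L[of 1] L[of \<i>] by (simp only: mult_1_right norm_one norm_ii) blast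
  also have "((s * (2 * E + 2 * Re (W * 1 * 1)) / q - (s * (2 * Re (S * 1)) / q)\<^sup>2) +
      (s * (2 * E + 2 * Re (W * \<i> * \<i>)) / q - (s * (2 * Re (S * \<i>)) / q)\<^sup>2)) =
      4 * s * E / q - 4 * (s * norm S)\<^sup>2 / q\<^sup>2"
    unfolding power_mult_distrib cmod_power2
    by (simp add: power_mult_distrib power_divide add_divide_distrib[symmetric] diff_divide_distrib[symmetric])
      (simp add: algebra_simps add_divide_distrib diff_divide_distrib)
  finally show ?thesis unfolding N_def E_def .
qed

lemma norm_sum_cnj_le:
  "(norm (\<Sum>j\<in>J. a j * cnj (b j)))\<^sup>2 \<le> (\<Sum>j\<in>J. (norm (a j))\<^sup>2) * (\<Sum>j\<in>J. (norm (b j))\<^sup>2)"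
proof -
  have "norm (\<Sum>j\<in>J. a j * cnj (b j)) \<le> (\<Sum>j\<in>J. norm (a j) * norm (b j))"
    by (rule order_trans[OF norm_sum]) (simp add: norm_mult)
  then have "(norm (\<Sum>j\<in>J. a j * cnj (b j)))\<^sup>2 \<le> (\<Sum>j\<in>J. norm (a j) * norm (b j))\<^sup>2"
    by (intro power_mono) auto
  also have "\<dots> \<le> (\<Sum>j\<in>J. (norm (a j))\<^sup>2) * (\<Sum>j\<in>J. (norm (b j))\<^sup>2)"
    by (rule Cauchy_Schwarz_ineq_sum)
  finally show ?thesis .
qed

text \<open>For a single function Cauchy--Schwarz is an equality and the two terms cancel: the
  logarithm is harmonic. Hence passing from a vector to its normalized multiple does not change any
  Laplacian.\<close>

lemma laplacian_at0_ln_norm_single: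
  assumes "\<rho> > 0" "V holomorphic_on ball 0 \<rho>" "V 0 \<noteq> 0"
  shows "laplacian_at0 (\<lambda>t. ln ((norm (V t))\<^sup>2)) 0"
  using laplacian_at0_ln_norm[of \<rho> "{()}" "\<lambda>_. V" 0 1] assms
  by (simp add: norm_mult power_mult_distrib power2_eq_square)

text \<open>Lower bound for the Fubini--Study form in affine coordinates: with \<open>E\<close>,
  \<open>N\<close>, \<open>S\<close> as below, Cauchy--Schwarz gives
  \<open>E * (1 + N) - (norm S)\<^sup>2 \<ge> E\<close>.\<close>

lemma laplacian_at0_ln_one_plus:
  assumes "\<rho> > 0" "finite J" "\<And>j. j \<in> J \<Longrightarrow> V j holomorphic_on ball 0 \<rho>"
  obtains L where "laplacian_at0 (\<lambda>t. ln (1 + (\<Sum>j\<in>J. (norm (V j t))\<^sup>2))) L"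
    "L \<ge> 4 * (\<Sum>j\<in>J. (norm (deriv (V j) 0))\<^sup>2) / (1 + (\<Sum>j\<in>J. (norm (V j 0))\<^sup>2))\<^sup>2"
proof -
  define N where "N = (\<Sum>j\<in>J. (norm (V j 0))\<^sup>2)"
  define E where "E = (\<Sum>j\<in>J. (norm (deriv (V j) 0))\<^sup>2)"
  define S where "S = (\<Sum>j\<in>J. deriv (V j) 0 * cnj (V j 0))"
  have nn: "N \<ge> 0" "E \<ge> 0" by (auto simp: N_def E_def sum_nonneg)
  have "laplacian_at0 (\<lambda>t. ln (1 + (\<Sum>j\<in>J. (norm (V j t))\<^sup>2))) (4 * E / (1 + N) - 4 * (norm S)\<^sup>2 / (1 + N)\<^sup>2)"
    using laplacian_at0_ln_norm[of \<rho> J V 1 1] assms nn by (simp add: N_def E_def S_def add_pos_nonneg sum_nonneg)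
  moreover have "4 * E / (1 + N)\<^sup>2 \<le> 4 * E / (1 + N) - 4 * (norm S)\<^sup>2 / (1 + N)\<^sup>2"
  proof -
    have "(norm S)\<^sup>2 \<le> E * N" unfolding S_def E_def N_def by (rule norm_sum_cnj_le)
    then have "4 * E \<le> 4 * E * (1 + N) - 4 * (norm S)\<^sup>2" by (simp add: algebra_simps)
    then have "4 * E / (1 + N)\<^sup>2 \<le> (4 * E * (1 + N) - 4 * (norm S)\<^sup>2) / (1 + N)\<^sup>2"
      by (intro divide_right_mono) auto
    also have "\<dots> = 4 * E / (1 + N) - 4 * (norm S)\<^sup>2 / (1 + N)\<^sup>2"
      using nn by (simp add: diff_divide_distrib power2_eq_square)
    finally show ?thesis .
  qed
  ultimately show ?thesis using that unfolding E_def N_def by blast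
qed

section \<open>Charts and Jacobian matrices\<close>

lemma holo_on_Ck_on: "holo_on n U g \<Longrightarrow> Ck_on n k U g"
  by (simp add: holo_on_def smooth_on_def)

lemma holo_on_dzbar: "holo_on n U g \<Longrightarrow> j < n \<Longrightarrow> v \<in> U \<Longrightarrow> dzbar j g v = 0"
  by (simp add: holo_on_def)

text \<open>The outer function is holomorphic, so the terms with its \<open>dzbar\<close>
  derivatives vanish and the conjugates of the inner derivatives do not enter.\<close>

lemma dz_comp:
  assumes U: "openin (top_of_set (Cspace m)) U" and T: "holo_on m U T"
    and W: "openin (top_of_set (Cspace n)) W" and F: "\<And>k. k < m \<Longrightarrow> Ck_on n (Suc 0) W (\<lambda>w. F w k)"
    and FU: "\<And>w. w \<in> W \<Longrightarrow> F w \<in> U" and v: "v \<in> W" and i: "i < n"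
  shows "dz i (\<lambda>w. T (F w)) v = (\<Sum>k<m. dz k T (F v) * dz i (\<lambda>w. F w k) v)"
proof -
  have P: "pderiv_dir i u (\<lambda>w. T (F w)) v = (\<Sum>k<m. dz k T (F v) * pderiv_dir i u (\<lambda>w. F w k) v)"
    if u: "u \<in> {1, \<i>}" for u
  proof (rule pderiv_dir_eqI)
    have ev: "\<forall>\<^sub>F t in nhds (0::real). F (v(i := v i + of_real t * u)) \<in> Cspace m"
      using eventually_coordinate_line[OF W v i, of u]
      by eventually_elim (use FU U openin_Cspace_subset in blast)
    have 0: "v(i := v i + of_real 0 * u) = v" by simp
    have "((\<lambda>t::real. T (F (v(i := v i + of_real t * u)))) has_derivative
      (\<lambda>h. \<Sum>k<m. dz k T (F (v(i := v i + of_real 0 * u))) * (h *\<^sub>R pderiv_dir i u (\<lambda>w. F w k) v) +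
        dzbar k T (F (v(i := v i + of_real 0 * u))) * cnj (h *\<^sub>R pderiv_dir i u (\<lambda>w. F w k) v))) (at 0)"
    proof (rule chain_rule_Cspace[OF U _ ev])
      show "Ck_on m (Suc 0) U T" using T by (rule holo_on_Ck_on)
      show "F (v(i := v i + of_real 0 * u)) \<in> U" unfolding 0 by (rule FU[OF v])
      fix k assume "k < m"
      show "((\<lambda>t. F (v(i := v i + of_real t * u)) k) has_derivative
        (\<lambda>h. h *\<^sub>R pderiv_dir i u (\<lambda>w. F w k) v)) (at 0)"
        using pderiv_dir_works[OF F[OF \<open>k < m\<close>] v i u] by (simp add: has_vector_derivative_def)
    qed
    then show "((\<lambda>t::real. T (F (v(i := v i + of_real t * u)))) has_vector_derivative
      (\<Sum>k<m. dz k T (F v) * pderiv_dir i u (\<lambda>w. F w k) v)) (at 0)"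
      unfolding has_vector_derivative_def 0
      by (rule has_derivative_eq_rhs)
        (simp add: fun_eq_iff holo_on_dzbar[OF T _ FU[OF v]] scaleR_sum_right)
  qed
  have "dz i (\<lambda>w. T (F w)) v =
    (\<Sum>k<m. dz k T (F v) * pderiv_dir i 1 (\<lambda>w. F w k) v - \<i> * (dz k T (F v) * pderiv_dir i \<i> (\<lambda>w. F w k) v)) / 2"
    unfolding dz_def[of i] by (simp add: P sum_subtractf sum_distrib_left)
  also have "\<dots> = (\<Sum>k<m. dz k T (F v) * dz i (\<lambda>w. F w k) v)"
    unfolding sum_divide_distrib dz_def[of i] by (intro sum.cong) (auto simp: field_simps)
  finally show ?thesis .
qed

context
  fixes X :: "'a cmanifold" and c :: "'a chart"
  assumes X: "complex_manifold X" and c: "c \<in> atlas X"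
begin

lemma chart_facts:
  "openin (mtop X) (fst c) \<and> openin (top_of_set (Cspace (mdim X))) (snd c ` fst c) \<and>
    homeomorphic_map (subtopology (mtop X) (fst c)) (top_of_set (snd c ` fst c)) (snd c)"
proof -
  have "\<forall>(U, \<phi>)\<in>atlas X. openin (mtop X) U \<and> openin (top_of_set (Cspace (mdim X))) (\<phi> ` U) \<and>
        homeomorphic_map (subtopology (mtop X) U) (top_of_set (\<phi> ` U)) \<phi>"
    using X unfolding complex_manifold_def by (elim conjE)
  from bspec[OF this c] show ?thesis by (simp add: case_prod_unfold)
qed

lemma chart_homeo:
  "homeomorphic_map (subtopology (mtop X) (fst c)) (top_of_set (snd c ` fst c)) (snd c)"
  and chart_dom_open: "openin (mtop X) (fst c)"
  and chart_image_open: "openin (top_of_set (Cspace (mdim X))) (snd c ` fst c)"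
  using chart_facts by blast+

lemma chart_dom_subset: "fst c \<subseteq> topspace (mtop X)"
  using chart_dom_open by (rule openin_subset)

lemma chart_inj: "inj_on (snd c) (fst c)"
  using homeomorphic_imp_injective_map[OF chart_homeo] chart_dom_subset by (simp add: Int_absorb1)

lemma chart_inv_apply [simp]: "p \<in> fst c \<Longrightarrow> chart_inv c (snd c p) = p"
  by (rule inv_into_f_f[OF chart_inj])

lemma chart_apply_inv [simp]: "v \<in> snd c ` fst c \<Longrightarrow> snd c (chart_inv c v) = v"
  by (rule f_inv_into_f)

lemma chart_inv_in [simp]: "v \<in> snd c ` fst c \<Longrightarrow> chart_inv c v \<in> fst c"
  by (rule inv_into_into)

lemma chart_Cspace: "p \<in> fst c \<Longrightarrow> snd c p \<in> Cspace (mdim X)"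
  using openin_imp_subset[OF chart_image_open] by auto

lemma chart_open_image:
  assumes "openin (mtop X) V"
  shows "openin (top_of_set (Cspace (mdim X))) (snd c ` (fst c \<inter> V))"
proof -
  have "openin (subtopology (mtop X) (fst c)) (fst c \<inter> V)"
    using assms by (metis openin_subtopology Int_commute)
  then have "openin (top_of_set (snd c ` fst c)) (snd c ` (fst c \<inter> V))"
    using homeomorphic_imp_open_map[OF chart_homeo] by (simp add: open_map_def)
  then show ?thesis using chart_image_open by (rule openin_trans)
qed

lemma chart_open_preimage:
  assumes "openin (top_of_set (Cspace (mdim X))) S"
  shows "openin (mtop X) {p \<in> fst c. snd c p \<in> S}"
proof -
  have cont: "continuous_map (subtopology (mtop X) (fst c)) (top_of_set (snd c ` fst c)) (snd c)"
    using chart_homeo by (rule homeomorphic_imp_continuous_map)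
  obtain T where T: "open T" "S = Cspace (mdim X) \<inter> T" using assms by (auto simp: openin_open)
  then have "openin (top_of_set (snd c ` fst c)) (snd c ` fst c \<inter> T)" by (auto simp: openin_open)
  from openin_continuous_map_preimage[OF cont this]
  have "openin (subtopology (mtop X) (fst c)) {p \<in> fst c. snd c p \<in> T}"
    using chart_dom_subset by (simp add: Int_absorb1 cong: conj_cong)
  moreover have "{p \<in> fst c. snd c p \<in> T} = {p \<in> fst c. snd c p \<in> S}"
    using chart_Cspace T by auto
  ultimately show ?thesis using chart_dom_open by (metis openin_trans_full)
qed

end

lemma ex_chart:
  assumes "complex_manifold X" "p \<in> topspace (mtop X)"
  shows "\<exists>c\<in>atlas X. p \<in> fst c"
  using assms unfolding complex_manifold_def by blast

lemma holomorphic_map_id: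
  assumes "complex_manifold X"
  shows "holomorphic_map X X (\<lambda>p. p)"
proof -
  have "{p \<in> fst c. p \<in> fst c'} = fst c \<inter> fst c'" for c c' :: "'a chart" by auto
  then show ?thesis
    using assms unfolding complex_manifold_def holomorphic_map_def by auto
qed

text \<open>The Jacobian matrix of \<open>f\<close> in charts. For the identity it is
  \<open>jac\<close>, so one chain rule yields the cocycle rule for coordinate changes as well as
  the independence of the differential from the charts.\<close>

definition dmat :: "('a \<Rightarrow> 'b) \<Rightarrow> 'a chart \<Rightarrow> 'b chart \<Rightarrow> 'a \<Rightarrow> nat \<Rightarrow> nat \<Rightarrow> complex" where
  "dmat f c c' p j i = dz i (\<lambda>v. snd c' (f (chart_inv c v)) j) (snd c p)"

lemma jac_eq_dmat: "jac c c' = dmat (\<lambda>p. p) c c'"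
  by (simp add: fun_eq_iff jac_def dmat_def)

context
  fixes X :: "'a cmanifold" and Y :: "'b cmanifold" and f :: "'a \<Rightarrow> 'b" and c c'
  assumes X: "complex_manifold X" and Y: "complex_manifold Y" and f: "holomorphic_map X Y f"
    and c: "c \<in> atlas X" and c': "c' \<in> atlas Y"
begin

lemma overlap_open: "openin (mtop X) {p \<in> fst c. f p \<in> fst c'}"
proof -
  have "openin (mtop X) {p \<in> topspace (mtop X). f p \<in> fst c'}"
    using f chart_dom_open[OF Y c'] unfolding holomorphic_map_def
    by (intro openin_continuous_map_preimage) auto
  then have "openin (mtop X) (fst c \<inter> {p \<in> topspace (mtop X). f p \<in> fst c'})"
    using chart_dom_open[OF X c] by (rule openin_Int[rotated])
  moreover have "fst c \<inter> {p \<in> topspace (mtop X). f p \<in> fst c'} = {p \<in> fst c. f p \<in> fst c'}"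
    using chart_dom_subset[OF X c] by auto
  ultimately show ?thesis by simp
qed

lemma overlap_image_open: "openin (top_of_set (Cspace (mdim X))) (snd c ` {p \<in> fst c. f p \<in> fst c'})"
proof -
  have "fst c \<inter> {p \<in> fst c. f p \<in> fst c'} = {p \<in> fst c. f p \<in> fst c'}" by auto
  then show ?thesis using chart_open_image[OF X c overlap_open] by simp
qed

lemma holo_component:
  "j < mdim Y \<Longrightarrow> holo_on (mdim X) (snd c ` {p \<in> fst c. f p \<in> fst c'}) (\<lambda>v. snd c' (f (chart_inv c v)) j)"
  using f c c' unfolding holomorphic_map_def by blast

end

lemma dmat_chain:
  assumes X: "complex_manifold X" and Y: "complex_manifold Y" and Z: "complex_manifold Z"
    and f: "holomorphic_map X Y f" and g: "holomorphic_map Y Z g"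
    and c: "c \<in> atlas X" "p \<in> fst c" and c': "c' \<in> atlas Y" "f p \<in> fst c'"
    and c'': "c'' \<in> atlas Z" "g (f p) \<in> fst c''" and ij: "i < mdim X" "j < mdim Z"
  shows "dmat (\<lambda>x. g (f x)) c c'' p j i = (\<Sum>k<mdim Y. dmat g c' c'' (f p) j k * dmat f c c' p k i)"
proof -
  define F where "F v = snd c' (f (chart_inv c v))" for v
  define T where "T y = snd c'' (g (chart_inv c' y)) j" for y
  define U where "U = snd c' ` {q \<in> fst c'. g q \<in> fst c''}"
  have U: "openin (top_of_set (Cspace (mdim Y))) U"
    unfolding U_def by (rule overlap_image_open[OF Y Z g c'(1) c''(1)])
  \<comment> \<open>The part of the chart \<open>c\<close> on which both inner coordinate
    expressions are defined; only there is the coordinate expression of the composition the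
    composition of the coordinate expressions.\<close>
  define W where "W = snd c ` {x \<in> fst c. f x \<in> {q \<in> fst c'. g q \<in> fst c''}}"
  have "openin (mtop X) {x \<in> topspace (mtop X). f x \<in> {q \<in> fst c'. g q \<in> fst c''}}"
    using f overlap_open[OF Y Z g c'(1) c''(1)] unfolding holomorphic_map_def
    by (intro openin_continuous_map_preimage) auto
  then have "openin (top_of_set (Cspace (mdim X))) (snd c ` (fst c \<inter> {x \<in> topspace (mtop X). f x \<in> {q \<in> fst c'. g q \<in> fst c''}}))"
    by (rule chart_open_image[OF X c(1)])
  moreover have "fst c \<inter> {x \<in> topspace (mtop X). f x \<in> {q \<in> fst c'. g q \<in> fst c''}} = {x \<in> fst c. f x \<in> {q \<in> fst c'. g q \<in> fst c''}}"
    using chart_dom_subset[OF X c(1)] by auto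
  ultimately have W: "openin (top_of_set (Cspace (mdim X))) W" by (simp add: W_def)
  have WU: "W \<subseteq> snd c ` {x \<in> fst c. f x \<in> fst c'}" by (auto simp: W_def)
  have v: "snd c p \<in> W" using c c' c'' by (auto simp: W_def)
  have inv: "chart_inv c (snd c p) = p" using chart_inv_apply[OF X c(1,2)] .
  have TF: "T (F w) = snd c'' (g (f (chart_inv c w))) j" if "w \<in> W" for w
    using that chart_inv_apply[OF X c(1)] chart_inv_apply[OF Y c'(1)] by (auto simp: W_def T_def F_def)
  have "dmat (\<lambda>x. g (f x)) c c'' p j i = dz i (\<lambda>w. T (F w)) (snd c p)"
    unfolding dmat_def by (rule dz_cong[OF W v ij(1)]) (simp add: TF)
  also have "\<dots> = (\<Sum>k<mdim Y. dz k T (F (snd c p)) * dz i (\<lambda>w. F w k) (snd c p))"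
  proof (rule dz_comp[OF U _ W _ _ v ij(1)])
    show "holo_on (mdim Y) U T"
      unfolding U_def T_def by (rule holo_component[OF Y Z g c'(1) c''(1) ij(2)])
    show "F w \<in> U" if "w \<in> W" for w
      using that chart_inv_apply[OF X c(1)] by (auto simp: W_def U_def F_def)
    fix k assume k: "k < mdim Y"
    have h: "holo_on (mdim X) (snd c ` {x \<in> fst c. f x \<in> fst c'}) (\<lambda>w. F w k)"
      unfolding F_def by (rule holo_component[OF X Y f c(1) c'(1) k])
    show "Ck_on (mdim X) (Suc 0) W (\<lambda>w. F w k)"
    proof (rule Ck_on_SucI[OF W])
      show "continuous_on W (\<lambda>w. F w k)"
        using Ck_on_imp_continuous_on[OF holo_on_Ck_on[OF h, of 0]] WU by (rule continuous_on_subset)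
      show "Ck_on (mdim X) 0 W (pderiv_dir j u (\<lambda>w. F w k))" if "j < mdim X" "u \<in> {1, \<i>}" for j u
        using Ck_on_pderiv_dir[OF holo_on_Ck_on[OF h, of "Suc 0"] that] WU continuous_on_subset by auto
      show "((\<lambda>t. F (v(j := v j + of_real t * u)) k) has_vector_derivative pderiv_dir j u (\<lambda>w. F w k) v) (at 0)"
        if "v \<in> W" "j < mdim X" "u \<in> {1, \<i>}" for v j u
        by (rule pderiv_dir_works[OF holo_on_Ck_on[OF h, of "Suc 0"] _ that(2,3)]) (use that(1) WU in blast)
    qed
  qed
  also have "\<dots> = (\<Sum>k<mdim Y. dmat g c' c'' (f p) j k * dmat f c c' p k i)"
    unfolding dmat_def T_def F_def inv ..
  finally show ?thesis .
qed

lemma jac_chain: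
  assumes X: "complex_manifold X" and c: "c \<in> atlas X" "p \<in> fst c" and c': "c' \<in> atlas X" "p \<in> fst c'"
    and c'': "c'' \<in> atlas X" "p \<in> fst c''" and ij: "i < mdim X" "j < mdim X"
  shows "jac c c'' p j i = (\<Sum>k<mdim X. jac c' c'' p j k * jac c c' p k i)"
  unfolding jac_eq_dmat
  by (rule dmat_chain[OF X X X holomorphic_map_id[OF X] holomorphic_map_id[OF X] c c' c'' ij])

lemma jac_refl:
  assumes X: "complex_manifold X" and c: "c \<in> atlas X" "p \<in> fst c" and ij: "i < mdim X"
  shows "jac c c p j i = (if j = i then 1 else 0)"
proof -
  have v: "snd c p \<in> snd c ` fst c" using c by auto
  have "jac c c p j i = dz i (\<lambda>w. w j) (snd c p)"
    unfolding jac_def by (rule dz_cong[OF chart_image_open[OF X c(1)] v ij]) (simp add: chart_apply_inv[OF X c(1)])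
  also have "pderiv_dir i u (\<lambda>w. w j) (snd c p) = (if j = i then u else 0)" for u
    by (rule pderiv_dir_eqI) (cases "j = i", auto intro!: derivative_eq_intros simp: has_vector_derivative_def fun_eq_iff scaleR_conv_of_real)
  then have "dz i (\<lambda>w. w j) (snd c p) = (if j = i then 1 else 0)"
    by (simp add: dz_def)
  finally show ?thesis .
qed

section \<open>Tangent vectors and the differential\<close>

lemma tangent_spaceI:
  assumes "\<And>c j. c \<notin> atlas X \<or> p \<notin> fst c \<or> j \<ge> mdim X \<Longrightarrow> W (c, j) = 0"
    and "\<And>c c' j. c \<in> atlas X \<Longrightarrow> p \<in> fst c \<Longrightarrow> c' \<in> atlas X \<Longrightarrow> p \<in> fst c' \<Longrightarrow> j < mdim X \<Longrightarrow>
      W (c', j) = (\<Sum>i<mdim X. jac c c' p j i * W (c, i))"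
  shows "W \<in> tangent_space X p"
  unfolding tangent_space_def using assms by blast

lemma tangent_space_zero:
  "W \<in> tangent_space X p \<Longrightarrow> c \<notin> atlas X \<or> p \<notin> fst c \<or> \<not> j < mdim X \<Longrightarrow> W (c, j) = 0"
  unfolding tangent_space_def mem_Collect_eq not_less by blast

lemma tangent_space_change:
  "W \<in> tangent_space X p \<Longrightarrow> c \<in> atlas X \<Longrightarrow> p \<in> fst c \<Longrightarrow> c' \<in> atlas X \<Longrightarrow> p \<in> fst c' \<Longrightarrow>
    j < mdim X \<Longrightarrow> W (c', j) = (\<Sum>i<mdim X. jac c c' p j i * W (c, i))"
  unfolding tangent_space_def by blast

definition mkvec :: "'a cmanifold \<Rightarrow> 'a chart \<Rightarrow> 'a \<Rightarrow> (nat \<Rightarrow> complex) \<Rightarrow> 'a tvec" where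
  "mkvec X c p w = (\<lambda>(c', j). if c' \<in> atlas X \<and> p \<in> fst c' \<and> j < mdim X
     then \<Sum>i<mdim X. jac c c' p j i * w i else 0)"

lemma mkvec_apply:
  assumes "complex_manifold X" "c \<in> atlas X" "p \<in> fst c" "j < mdim X"
  shows "mkvec X c p w (c, j) = w j"
proof -
  have "mkvec X c p w (c, j) = (\<Sum>i<mdim X. (if j = i then 1 else 0) * w i)"
    using assms by (simp add: mkvec_def jac_refl)
  also have "\<dots> = (\<Sum>i<mdim X. if j = i then w i else 0)"
    by (rule sum.cong) auto
  also have "\<dots> = w j" using assms(4) by simp
  finally show ?thesis .
qed

text \<open>Components in one chart can be prescribed freely. Those in the other charts are then
  forced, and the cocycle rule \<open>jac_chain\<close> makes them consistent with each
  other.\<close>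

lemma mkvec_tangent:
  assumes X: "complex_manifold X" and c: "c \<in> atlas X" "p \<in> fst c"
  shows "mkvec X c p w \<in> tangent_space X p"
proof -
  have "mkvec X c p w (c'', j) = (\<Sum>k<mdim X. jac c' c'' p j k * mkvec X c p w (c', k))"
    if c': "c' \<in> atlas X" "p \<in> fst c'" and c'': "c'' \<in> atlas X" "p \<in> fst c''" and j: "j < mdim X" for c' c'' j
  proof -
    have "mkvec X c p w (c'', j) = (\<Sum>i<mdim X. (\<Sum>k<mdim X. jac c' c'' p j k * jac c c' p k i) * w i)"
      using c'' j by (simp add: mkvec_def jac_chain[OF X c c' c''])
    also have "\<dots> = (\<Sum>k<mdim X. jac c' c'' p j k * (\<Sum>i<mdim X. jac c c' p k i * w i))"
      unfolding sum_distrib_left sum_distrib_right by (subst sum.swap) (simp add: mult.assoc)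
    also have "\<dots> = (\<Sum>k<mdim X. jac c' c'' p j k * mkvec X c p w (c', k))"
      using c' by (simp add: mkvec_def)
    finally show ?thesis .
  qed
  then show ?thesis
    by (intro tangent_spaceI) (auto simp only: mkvec_def split: if_splits)
qed

lemma tangent_eq_mkvec:
  assumes "complex_manifold X" "c \<in> atlas X" "p \<in> fst c" "W \<in> tangent_space X p"
  shows "W = mkvec X c p (\<lambda>i. W (c, i))"
proof (rule ext)
  fix s :: "'a chart \<times> nat"
  obtain c' j where s: "s = (c', j)" by (cases s)
  show "W s = mkvec X c p (\<lambda>i. W (c, i)) s"
    using tangent_space_zero[OF assms(4), of c' j] tangent_space_change[OF assms(4,2,3), of c' j]
    unfolding s mkvec_def by auto
qed

lemma tangent_scale:
  "W \<in> tangent_space X p \<Longrightarrow> (\<lambda>s. a * W s) \<in> tangent_space X p"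
proof (rule tangent_spaceI)
  assume W: "W \<in> tangent_space X p"
  show "a * W (c, j) = 0" if "c \<notin> atlas X \<or> p \<notin> fst c \<or> j \<ge> mdim X" for c j
    using tangent_space_zero[OF W, of c j] that by auto
  show "a * W (c', j) = (\<Sum>i<mdim X. jac c c' p j i * (a * W (c, i)))"
    if "c \<in> atlas X" "p \<in> fst c" "c' \<in> atlas X" "p \<in> fst c'" "j < mdim X" for c c' j
    unfolding tangent_space_change[OF W that] sum_distrib_left by (simp add: mult.left_commute)
qed

lemma tangent_nonzero_component:
  assumes "complex_manifold X" "c \<in> atlas X" "p \<in> fst c" "W \<in> tangent_space X p" "W \<noteq> (\<lambda>s. 0)"
  shows "\<exists>i<mdim X. W (c, i) \<noteq> 0"
proof (rule ccontr)
  assume "\<not> ?thesis"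
  then have "mkvec X c p (\<lambda>i. W (c, i)) = (\<lambda>s. 0)" by (auto simp: mkvec_def fun_eq_iff)
  then show False using tangent_eq_mkvec[OF assms(1-4)] assms(5) by simp
qed

text \<open>The differential of \<open>f\<close>. Its value is computed in an arbitrarily chosen
  chart around \<open>p\<close>; by \<open>push_apply\<close> every other chart gives the
  same.\<close>

definition push :: "'a cmanifold \<Rightarrow> 'b cmanifold \<Rightarrow> ('a \<Rightarrow> 'b) \<Rightarrow> 'a \<Rightarrow> 'a tvec \<Rightarrow> 'b tvec" where
  "push X Y f p W = (\<lambda>(c', j). if c' \<in> atlas Y \<and> f p \<in> fst c' \<and> j < mdim Y
     then let c = SOME c. c \<in> atlas X \<and> p \<in> fst c in \<Sum>i<mdim X. dmat f c c' p j i * W (c, i) else 0)"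

context
  fixes X :: "'a cmanifold" and Y :: "'b cmanifold" and f :: "'a \<Rightarrow> 'b" and p :: 'a and W :: "'a tvec"
  assumes X: "complex_manifold X" and Y: "complex_manifold Y" and f: "holomorphic_map X Y f"
    and W: "W \<in> tangent_space X p"
begin

lemma push_apply:
  assumes c: "c \<in> atlas X" "p \<in> fst c" and c': "c' \<in> atlas Y" "f p \<in> fst c'" and j: "j < mdim Y"
  shows "push X Y f p W (c', j) = (\<Sum>i<mdim X. dmat f c c' p j i * W (c, i))"
proof -
  define c0 where "c0 = (SOME c. c \<in> atlas X \<and> p \<in> fst c)"
  have c0: "c0 \<in> atlas X" "p \<in> fst c0" unfolding c0_def using someI[of "\<lambda>c. c \<in> atlas X \<and> p \<in> fst c"] c by auto
  have "push X Y f p W (c', j) = (\<Sum>i<mdim X. dmat f c0 c' p j i * W (c0, i))"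
    using c' j by (simp add: push_def c0_def Let_def)
  also have "\<dots> = (\<Sum>i<mdim X. dmat f c0 c' p j i * (\<Sum>l<mdim X. jac c c0 p i l * W (c, l)))"
    using tangent_space_change[OF W c c0] by (intro sum.cong refl arg_cong2[where f = "(*)"]) auto
  also have "\<dots> = (\<Sum>l<mdim X. (\<Sum>i<mdim X. dmat f c0 c' p j i * jac c c0 p i l) * W (c, l))"
    unfolding sum_distrib_left sum_distrib_right by (subst sum.swap) (simp add: mult.assoc)
  also have "\<dots> = (\<Sum>l<mdim X. dmat f c c' p j l * W (c, l))"
    using dmat_chain[OF X X Y holomorphic_map_id[OF X] f c c0 c' _ j] by (simp add: jac_eq_dmat)
  finally show ?thesis .
qed

lemma push_tangent:
  assumes p: "p \<in> topspace (mtop X)"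
  shows "push X Y f p W \<in> tangent_space Y (f p)"
proof -
  obtain c where c: "c \<in> atlas X" "p \<in> fst c" using ex_chart[OF X p] by blast
  have "push X Y f p W (c'', j) = (\<Sum>k<mdim Y. jac c' c'' (f p) j k * push X Y f p W (c', k))"
    if c': "c' \<in> atlas Y" "f p \<in> fst c'" and c'': "c'' \<in> atlas Y" "f p \<in> fst c''" and j: "j < mdim Y" for c' c'' j
  proof -
    have "push X Y f p W (c'', j) = (\<Sum>i<mdim X. (\<Sum>k<mdim Y. jac c' c'' (f p) j k * dmat f c c' p k i) * W (c, i))"
      using dmat_chain[OF X Y Y f holomorphic_map_id[OF Y] c c' c'' _ j] push_apply[OF c c'' j]
      by (simp add: jac_eq_dmat)
    also have "\<dots> = (\<Sum>k<mdim Y. jac c' c'' (f p) j k * (\<Sum>i<mdim X. dmat f c c' p k i * W (c, i)))"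
      unfolding sum_distrib_left sum_distrib_right by (subst sum.swap) (simp add: mult.assoc)
    also have "\<dots> = (\<Sum>k<mdim Y. jac c' c'' (f p) j k * push X Y f p W (c', k))"
      by (simp add: push_apply[OF c c'])
    finally show ?thesis .
  qed
  then show ?thesis
    by (intro tangent_spaceI) (auto simp only: push_def split: if_splits)
qed

end

section \<open>Coordinates on the projectivized tangent bundle\<close>

definition proj_line :: "('s \<Rightarrow> complex) \<Rightarrow> ('s \<Rightarrow> complex) set" where
  "proj_line W = {\<lambda>s. a * W s |a. True}"

definition base_coord :: "nat \<Rightarrow> cvec \<Rightarrow> cvec" where
  "base_coord n v = (\<lambda>k. if k < n then v k else 0)"

text \<open>Recovers homogeneous coordinates from affine ones: the components other than the
  \<open>i\<close>-th are stored consecutively from position \<open>n\<close> on, so indices above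
  \<open>i\<close> move down by one. \<open>skip_index\<close> is the shift in the opposite
  direction.\<close>

definition hom_coord :: "nat \<Rightarrow> nat \<Rightarrow> cvec \<Rightarrow> nat \<Rightarrow> complex" where
  "hom_coord n i v = (\<lambda>j. if j = i then 1 else v (n + (if j < i then j else j - 1)))"

definition skip_index :: "nat \<Rightarrow> nat \<Rightarrow> nat" where
  "skip_index i k = (if k < i then k else Suc k)"

text \<open>The image of the chart \<open>PT_coord X c i\<close>. It is the same for all
  \<open>i\<close>, because the fibre coordinates are unrestricted.\<close>

definition PT_region :: "'a cmanifold \<Rightarrow> 'a chart \<Rightarrow> cvec set" where
  "PT_region X c = {v \<in> Cspace (2 * mdim X - 1). base_coord (mdim X) v \<in> snd c ` fst c}"

definition PT_base :: "'a cmanifold \<Rightarrow> 'a chart \<Rightarrow> cvec \<Rightarrow> 'a" where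
  "PT_base X c v = chart_inv c (base_coord (mdim X) v)"

definition PT_vec :: "'a cmanifold \<Rightarrow> 'a chart \<Rightarrow> nat \<Rightarrow> cvec \<Rightarrow> 'a tvec" where
  "PT_vec X c i v = mkvec X c (PT_base X c v) (hom_coord (mdim X) i v)"

text \<open>\<open>PT_coord\<close> of the line through \<open>W\<close>, written in terms of the
  vector. Continuity and holomorphy in a moving vector can be read off from this form.\<close>

definition vec_coord :: "'a cmanifold \<Rightarrow> 'a chart \<Rightarrow> nat \<Rightarrow> 'a \<Rightarrow> 'a tvec \<Rightarrow> cvec" where
  "vec_coord X c i p W = (\<lambda>k. if k < mdim X then snd c p k
     else if k < 2 * mdim X - 1 then W (c, skip_index i (k - mdim X)) / W (c, i) else 0)"

lemma proj_line_self: "W \<in> proj_line W"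
  unfolding proj_line_def by (auto intro!: exI[of _ 1])

lemma proj_line_scale:
  assumes "a \<noteq> 0"
  shows "proj_line (\<lambda>s. a * W s) = proj_line W"
proof -
  have "(\<lambda>s. b * W s) = (\<lambda>s. (b / a) * (a * W s))" for b
    using assms by (simp add: fun_eq_iff)
  moreover have "(\<lambda>s. b * (a * W s)) = (\<lambda>s. (b * a) * W s)" for b
    by (simp add: fun_eq_iff)
  ultimately show ?thesis unfolding proj_line_def by blast
qed

lemma taut_frame_proj_line:
  assumes "W (c, i) \<noteq> 0"
  shows "taut_frame c i (p, proj_line W) = (\<lambda>s. W s / W (c, i))"
  unfolding taut_frame_def prod.case
proof (rule the_equality)
  show "(\<lambda>s. W s / W (c, i)) \<in> proj_line W \<and> W (c, i) / W (c, i) = 1"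
    using assms unfolding proj_line_def by (auto intro!: exI[of _ "inverse (W (c, i))"] simp: fun_eq_iff divide_inverse mult.commute)
  fix V assume V: "V \<in> proj_line W \<and> V (c, i) = 1"
  then obtain a where "V = (\<lambda>s. a * W s)" unfolding proj_line_def by blast
  with V assms show "V = (\<lambda>s. W s / W (c, i))"
    by (auto simp: fun_eq_iff field_simps)
qed

lemma continuous_on_cvec_apply: "continuous_on S (\<lambda>v::cvec. v j)"
  using continuous_on_product_coordinates by (rule continuous_on_subset) simp

lemma base_coord_continuous: "continuous_on S (base_coord n)"
  unfolding base_coord_def
proof (rule continuous_on_cvec)
  show "continuous_on S (\<lambda>v. if j < n then v j else 0)" for j
    by (cases "j < n") (auto intro: continuous_on_cvec_apply)
qed

lemma PT_base_in:
  assumes "complex_manifold X" "c \<in> atlas X" "v \<in> PT_region X c"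
  shows "PT_base X c v \<in> fst c"
  using chart_inv_in[OF assms(1,2)] assms(3) unfolding PT_base_def PT_region_def by blast

lemma PT_region_open:
  assumes X: "complex_manifold X" and c: "c \<in> atlas X"
  shows "openin (top_of_set (Cspace (2 * mdim X - 1))) (PT_region X c)"
proof -
  have "PT_region X c = Cspace (2 * mdim X - 1) \<inter> base_coord (mdim X) -` (snd c ` fst c)"
    by (auto simp: PT_region_def)
  then show ?thesis
    using continuous_openin_preimage[OF base_coord_continuous[of "Cspace (2 * mdim X - 1)"] _ chart_image_open[OF X c]]
    by (simp add: base_coord_def Cspace_def image_subset_iff_funcset Pi_def)
qed

context
  fixes X :: "'a cmanifold" and c :: "'a chart" and i :: nat
  assumes X: "complex_manifold X" and c: "c \<in> atlas X" and i: "i < mdim X"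
begin

lemma PT_vec_tangent: "v \<in> PT_region X c \<Longrightarrow> PT_vec X c i v \<in> tangent_space X (PT_base X c v)"
  unfolding PT_vec_def by (intro mkvec_tangent X c PT_base_in[OF X c])

lemma PT_vec_apply:
  "v \<in> PT_region X c \<Longrightarrow> j < mdim X \<Longrightarrow> PT_vec X c i v (c, j) = hom_coord (mdim X) i v j"
  unfolding PT_vec_def by (intro mkvec_apply X c PT_base_in[OF X c])

lemma PT_vec_apply_self: "v \<in> PT_region X c \<Longrightarrow> PT_vec X c i v (c, i) = 1"
  using PT_vec_apply[of v i] i by (simp add: hom_coord_def)

lemma vec_coord_PT_vec:
  assumes v: "v \<in> PT_region X c"
  shows "vec_coord X c i (PT_base X c v) (PT_vec X c i v) = v"
proof (rule ext)
  fix k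
  have b: "snd c (PT_base X c v) = base_coord (mdim X) v"
    unfolding PT_base_def by (rule chart_apply_inv[OF X c]) (use v in \<open>simp add: PT_region_def\<close>)
  consider "k < mdim X" | "mdim X \<le> k" "k < 2 * mdim X - 1" | "2 * mdim X - 1 \<le> k" by linarith
  then show "vec_coord X c i (PT_base X c v) (PT_vec X c i v) k = v k"
  proof cases
    case 2
    then have "skip_index i (k - mdim X) < mdim X" unfolding skip_index_def by auto
    then have "PT_vec X c i v (c, skip_index i (k - mdim X)) = v k"
      unfolding PT_vec_apply[OF v \<open>skip_index i (k - mdim X) < mdim X\<close>]
      using 2 by (auto simp: hom_coord_def skip_index_def)
    then show ?thesis using 2 by (simp add: vec_coord_def PT_vec_apply_self[OF v])
  next
    case 3
    then have "v k = 0" using v by (simp add: PT_region_def Cspace_def)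
    then show ?thesis using 3 i by (simp add: vec_coord_def)
  qed (simp add: vec_coord_def b base_coord_def)
qed

context
  fixes p W
  assumes p: "p \<in> fst c" and W: "W \<in> tangent_space X p" "W (c, i) \<noteq> 0"
begin

lemma base_coord_vec_coord: "base_coord (mdim X) (vec_coord X c i p W) = snd c p"
  using chart_Cspace[OF X c p] by (auto simp: base_coord_def vec_coord_def Cspace_def fun_eq_iff)

lemma vec_coord_in: "vec_coord X c i p W \<in> PT_region X c"
  unfolding PT_region_def using base_coord_vec_coord p i by (auto simp: vec_coord_def Cspace_def)

lemma hom_coord_vec_coord:
  assumes j: "j < mdim X"
  shows "hom_coord (mdim X) i (vec_coord X c i p W) j = W (c, j) / W (c, i)"
proof (cases "j = i")
  case False
  let ?k = "if j < i then j else j - 1"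
  have "?k < mdim X - 1" "skip_index i ?k = j" using False i j by (auto simp: skip_index_def)
  then show ?thesis using False by (simp add: hom_coord_def vec_coord_def)
qed (use W in \<open>simp add: hom_coord_def\<close>)

lemma PT_base_vec_coord: "PT_base X c (vec_coord X c i p W) = p"
  unfolding PT_base_def base_coord_vec_coord by (rule chart_inv_apply[OF X c p])

lemma PT_vec_vec_coord: "PT_vec X c i (vec_coord X c i p W) = (\<lambda>s. W s / W (c, i))"
proof -
  have "PT_vec X c i (vec_coord X c i p W) = mkvec X c p (\<lambda>j. W (c, j) / W (c, i))"
    unfolding PT_vec_def PT_base_vec_coord mkvec_def by (auto simp: fun_eq_iff hom_coord_vec_coord)
  also have "\<dots> = (\<lambda>s. inverse (W (c, i)) * W s)"
    using tangent_eq_mkvec[OF X c p tangent_scale[OF W(1), of "inverse (W (c, i))"]]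
    by (simp add: divide_inverse mult.commute)
  finally show ?thesis by (simp add: divide_inverse mult.commute)
qed

lemma PT_dom_proj_line: "(p, proj_line W) \<in> PT_dom X c i"
  unfolding PT_dom_def PT_points_def
  using p W chart_dom_subset[OF X c] proj_line_self[of W] by (auto simp: proj_line_def)

lemma PT_coord_proj_line: "PT_coord X c i (p, proj_line W) = vec_coord X c i p W"
  unfolding PT_coord_def vec_coord_def skip_index_def
  by (simp add: taut_frame_proj_line W fun_eq_iff)

end

lemma PT_dom_cases:
  assumes "y \<in> PT_dom X c i"
  obtains p W where "y = (p, proj_line W)" "p \<in> fst c" "W \<in> tangent_space X p" "W (c, i) \<noteq> 0"
proof -
  obtain p W where *: "y = (p, proj_line W)" "p \<in> fst c" "W \<in> tangent_space X p" "\<exists>V\<in>proj_line W. V (c, i) \<noteq> 0"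
    using assms unfolding PT_dom_def PT_points_def proj_line_def by auto
  then have "W (c, i) \<noteq> 0" unfolding proj_line_def by auto
  with * that show ?thesis by blast
qed

lemma PT_point:
  assumes v: "v \<in> PT_region X c"
  defines "y \<equiv> (PT_base X c v, proj_line (PT_vec X c i v))"
  shows "y \<in> PT_dom X c i" "PT_coord X c i y = v" "taut_frame c i y = PT_vec X c i v"
proof -
  have nz: "PT_vec X c i v (c, i) \<noteq> 0" by (simp add: PT_vec_apply_self[OF v])
  note a = PT_base_in[OF X c v] PT_vec_tangent[OF v] nz
  show "y \<in> PT_dom X c i" unfolding y_def by (rule PT_dom_proj_line[OF a])
  show "PT_coord X c i y = v" unfolding y_def PT_coord_proj_line[OF a] by (rule vec_coord_PT_vec[OF v])
  show "taut_frame c i y = PT_vec X c i v"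
    unfolding y_def taut_frame_proj_line[of "PT_vec X c i v" c i, OF nz] by (simp add: PT_vec_apply_self[OF v])
qed

lemma PT_coord_image: "PT_coord X c i ` PT_dom X c i = PT_region X c"
proof
  show "PT_coord X c i ` PT_dom X c i \<subseteq> PT_region X c"
    by (auto elim!: PT_dom_cases simp: PT_coord_proj_line vec_coord_in)
  show "PT_region X c \<subseteq> PT_coord X c i ` PT_dom X c i"
    using PT_point by (metis image_eqI subsetI)
qed

lemma PT_point_coord:
  assumes "y \<in> PT_dom X c i"
  shows "(PT_base X c (PT_coord X c i y), proj_line (PT_vec X c i (PT_coord X c i y))) = y"
  using assms
proof (rule PT_dom_cases)
  fix p W assume y: "y = (p, proj_line W)" and a: "p \<in> fst c" "W \<in> tangent_space X p" "W (c, i) \<noteq> 0"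
  have "proj_line (\<lambda>s. W s / W (c, i)) = proj_line W"
    using proj_line_scale[of "inverse (W (c, i))" W] a(3) by (simp add: divide_inverse mult.commute)
  then show ?thesis
    unfolding y PT_coord_proj_line[OF a] PT_base_vec_coord[OF a] PT_vec_vec_coord[OF a] by simp
qed

lemma PT_coord_inj: "inj_on (PT_coord X c i) (PT_dom X c i)"
  by (rule inj_on_inverseI[of _ "\<lambda>v. (PT_base X c v, proj_line (PT_vec X c i v))"]) (rule PT_point_coord)

text \<open>From here on the inverse chart is an explicit point and line, in which metrics and
  frames can be evaluated.\<close>

lemma PT_chart_inv:
  assumes v: "v \<in> PT_region X c"
  shows "chart_inv (PT_dom X c i, PT_coord X c i) v = (PT_base X c v, proj_line (PT_vec X c i v))"
  using inv_into_f_f[OF PT_coord_inj PT_point(1)[OF v]] by (simp add: PT_point(2)[OF v])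

lemma PT_chart_in_atlas: "(PT_dom X c i, PT_coord X c i) \<in> atlas (proj_tangent X)"
  unfolding proj_tangent_def cmanifold.select_convs mem_Collect_eq using c i by blast

lemma PT_dom_topspace: "PT_dom X c i \<subseteq> topspace (mtop (proj_tangent X))"
proof
  fix y assume y: "y \<in> PT_dom X c i"
  have "PT_coord X c i y \<in> Cspace (2 * mdim X - 1)"
    using y PT_coord_image by (auto simp: PT_region_def)
  then have "y \<in> {y \<in> PT_dom X c i. PT_coord X c i y \<in> Cspace (2 * mdim X - 1)}" using y by simp
  then show "y \<in> topspace (mtop (proj_tangent X))"
    unfolding proj_tangent_def cmanifold.select_convs topology_generated_by_topspace
    using c i openin_subtopology_self[of "Cspace (2 * mdim X - 1)"]
    by (intro UnionI[of "{y \<in> PT_dom X c i. PT_coord X c i y \<in> Cspace (2 * mdim X - 1)}"]) blast+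
qed

end

lemma mdim_proj_tangent [simp]: "mdim (proj_tangent X) = 2 * mdim X - 1"
  by (simp add: proj_tangent_def)

section \<open>Metrics on the tautological bundle as functions of tangent vectors\<close>

text \<open>The local potential of the metric: the logarithm of the squared length of the frame
  vector whose \<open>i\<close>-th component is 1.\<close>

definition log_norm :: "'a cmanifold \<Rightarrow> ('a \<Rightarrow> 'a tvec \<Rightarrow> real) \<Rightarrow> 'a chart \<Rightarrow> nat \<Rightarrow> cvec \<Rightarrow> real" where
  "log_norm X K c i v = ln (K (PT_base X c v) (PT_vec X c i v))"

text \<open>A metric on the tautological bundle is the same as a function of nonzero tangent vectors that
  is homogeneous under complex multiples; \<open>K\<close> is the square of the length.\<close>

definition finsler :: "'a cmanifold \<Rightarrow> ('a \<Rightarrow> 'a tvec \<Rightarrow> real) \<Rightarrow> bool" where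
  "finsler X K \<longleftrightarrow>
     (\<forall>p\<in>topspace (mtop X). \<forall>W\<in>tangent_space X p. W \<noteq> (\<lambda>s. 0) \<longrightarrow>
        K p W > 0 \<and> (\<forall>a. a \<noteq> 0 \<longrightarrow> K p (\<lambda>s. a * W s) = (norm a)\<^sup>2 * K p W)) \<and>
     (\<forall>c\<in>atlas X. \<forall>i<mdim X.
        Ck_on (2 * mdim X - 1) (Suc (Suc 0)) (PT_region X c) (\<lambda>v. of_real (log_norm X K c i v)))"

text \<open>Homogeneity splits off the squared modulus of one component. Along holomorphic curves
  the logarithm of that factor is harmonic, so only the potential contributes to Laplacians.\<close>

lemma finsler_coord:
  assumes X: "complex_manifold X" and K: "finsler X K" and c: "c \<in> atlas X" and i: "i < mdim X"
    and p: "p \<in> fst c" and W: "W \<in> tangent_space X p" "W (c, i) \<noteq> 0"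
  shows "K p W = (norm (W (c, i)))\<^sup>2 * exp (log_norm X K c i (vec_coord X c i p W))"
proof -
  let ?V = "\<lambda>s. W s / W (c, i)"
  have V: "?V = (\<lambda>s. inverse (W (c, i)) * W s)" by (simp add: divide_inverse mult.commute)
  have nz: "W \<noteq> (\<lambda>s. 0)" using W(2) by auto
  have p': "p \<in> topspace (mtop X)" using chart_dom_subset[OF X c] p by auto
  have KV: "K p ?V = (norm (inverse (W (c, i))))\<^sup>2 * K p W" "K p W > 0"
    using K p' W nz unfolding finsler_def V by auto
  then have "K p ?V > 0" using W(2) by simp
  then show ?thesis
    using W(2) KV unfolding log_norm_def PT_base_vec_coord[OF X c i p W] PT_vec_vec_coord[OF X c i p W]
    by (simp add: norm_inverse power_inverse)
qed

lemma tangent_line_topspace: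
  assumes X: "complex_manifold X" and p: "p \<in> topspace (mtop X)"
    and W: "W \<in> tangent_space X p" "W \<noteq> (\<lambda>s. 0)"
  shows "(p, proj_line W) \<in> topspace (mtop (proj_tangent X))"
proof -
  obtain c where c: "c \<in> atlas X" "p \<in> fst c" using ex_chart[OF X p] by blast
  obtain i where "i < mdim X" "W (c, i) \<noteq> 0"
    using tangent_nonzero_component[OF X c W] by blast
  then show ?thesis
    using PT_dom_proj_line[OF X c(1) _ c(2) W(1)] PT_dom_topspace[OF X c(1)] by blast
qed

lemma hermitian_inner_scale:
  assumes h: "hermitian_inner E h" and u: "u \<in> E" "(\<lambda>s. a * u s) \<in> E"
  shows "Re (h (\<lambda>s. a * u s) (\<lambda>s. a * u s)) = (norm a)\<^sup>2 * Re (h u u)"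
proof -
  have lin: "h (\<lambda>s. a * x s) y = a * h x y" if "x \<in> E" "y \<in> E" for a x y
    using h that unfolding hermitian_inner_def by blast
  have sym: "h x y = cnj (h y x)" if "x \<in> E" "y \<in> E" for x y
    using h that unfolding hermitian_inner_def by blast
  have "h (\<lambda>s. a * u s) (\<lambda>s. a * u s) = a * cnj (h (\<lambda>s. a * u s) u)"
    unfolding lin[OF u(1) u(2)] using sym[OF u] by simp
  also have "\<dots> = a * (cnj a * cnj (h u u))" unfolding lin[OF u(1) u(1)] by simp
  also have "cnj (h u u) = h u u" using sym[OF u(1) u(1)] by simp
  finally have "h (\<lambda>s. a * u s) (\<lambda>s. a * u s) = of_real ((norm a)\<^sup>2) * h u u"
    by (simp only: complex_norm_square mult.assoc)
  then show ?thesis by simp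
qed

lemma smooth_in_PT_chart:
  assumes X: "complex_manifold X" and c: "c \<in> atlas X" and i: "i < mdim X"
    and g: "smooth_fun (proj_tangent X) (PT_dom X c i) g"
  shows "Ck_on (2 * mdim X - 1) k (PT_region X c) (\<lambda>v. g (chart_inv (PT_dom X c i, PT_coord X c i) v))"
  using g PT_chart_in_atlas[OF X c i] PT_coord_image[OF X c i]
  unfolding smooth_fun_def smooth_on_def by force

definition taut_norm :: "('a ptangent \<Rightarrow> 'a tvec \<Rightarrow> 'a tvec \<Rightarrow> complex) \<Rightarrow> 'a \<Rightarrow> 'a tvec \<Rightarrow> real" where
  "taut_norm h p W = Re (h (p, proj_line W) W W)"

text \<open>At the point with coordinates \<open>v\<close> the frame vector is
  \<open>PT_vec X c i v\<close>, so the weight in the Chern curvature is exactly the potential of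
  \<open>taut_norm\<close>.\<close>

lemma
  assumes X: "complex_manifold X" and h: "bundle_metric (proj_tangent X) (tautological X) h"
  shows finsler_taut_norm: "finsler X (taut_norm h)"
    and chern_curv_tautological: "\<And>c i v l j. c \<in> atlas X \<Longrightarrow> i < mdim X \<Longrightarrow> v \<in> PT_region X c \<Longrightarrow>
      l < 2 * mdim X - 1 \<Longrightarrow> j < 2 * mdim X - 1 \<Longrightarrow>
      chern_curv h (taut_frame c i) (PT_dom X c i, PT_coord X c i) (PT_base X c v, proj_line (PT_vec X c i v)) l j
        = - dz l (dzbar j (\<lambda>v. of_real (log_norm X (taut_norm h) c i v))) v"
proof -
  have herm: "hermitian_inner (snd y) (h y)" if "y \<in> topspace (mtop (proj_tangent X))" for y
    using h that unfolding bundle_metric_def tautological_def by simp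
  have pos: "taut_norm h p W > 0 \<and> (\<forall>a. a \<noteq> 0 \<longrightarrow> taut_norm h p (\<lambda>s. a * W s) = (norm a)\<^sup>2 * taut_norm h p W)"
    if "p \<in> topspace (mtop X)" "W \<in> tangent_space X p" "W \<noteq> (\<lambda>s. 0)" for p W
  proof -
    have H: "hermitian_inner (proj_line W) (h (p, proj_line W))"
      using herm[OF tangent_line_topspace[OF X that]] by simp
    have "taut_norm h p W > 0"
      unfolding taut_norm_def using H that(3) proj_line_self[of W] unfolding hermitian_inner_def by blast
    moreover have "taut_norm h p (\<lambda>s. a * W s) = (norm a)\<^sup>2 * taut_norm h p W" if "a \<noteq> 0" for a
    proof -
      have "(\<lambda>s. a * W s) \<in> proj_line W" unfolding proj_line_def by blast
      from hermitian_inner_scale[OF H proj_line_self this] show ?thesis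
        unfolding taut_norm_def proj_line_scale[OF that] .
    qed
    ultimately show ?thesis by blast
  qed
  have eq: "Re (let x = chart_inv (PT_dom X c i, PT_coord X c i) v in h x (taut_frame c i x) (taut_frame c i x))
      = taut_norm h (PT_base X c v) (PT_vec X c i v)"
    if "c \<in> atlas X" "i < mdim X" "v \<in> PT_region X c" for c i v
    unfolding PT_chart_inv[OF X that] Let_def PT_point(3)[OF X that] taut_norm_def ..
  show "finsler X (taut_norm h)"
    unfolding finsler_def
  proof (intro conjI ballI allI impI)
    fix c i assume ci: "c \<in> atlas X" "i < mdim X"
    let ?g = "\<lambda>v. let x = chart_inv (PT_dom X c i, PT_coord X c i) v in h x (taut_frame c i x) (taut_frame c i x)"
    have fr: "(PT_dom X c i, taut_frame c i) \<in> frames (tautological X)"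
      unfolding tautological_def line_bundle.select_convs mem_Collect_eq using ci by blast
    then have "smooth_fun (proj_tangent X) (PT_dom X c i) (\<lambda>y. h y (taut_frame c i y) (taut_frame c i y))"
      using h unfolding bundle_metric_def by fastforce
    from smooth_in_PT_chart[OF X ci this]
    have sm: "Ck_on (2 * mdim X - 1) (Suc (Suc 0)) (PT_region X c) ?g" by (simp add: Let_def)
    have "Re (?g v) > 0" if v: "v \<in> PT_region X c" for v
    proof -
      have "PT_vec X c i v \<noteq> (\<lambda>s. 0)" using PT_vec_apply_self[OF X ci v] by auto
      then show ?thesis
        unfolding eq[OF ci v]
        using pos[OF _ PT_vec_tangent[OF X ci(1,2) v]] PT_base_in[OF X ci(1) v] chart_dom_subset[OF X ci(1)] by blast
    qed
    from Ck_on_ln[OF PT_region_open[OF X ci(1)] sm this]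
    show "Ck_on (2 * mdim X - 1) (Suc (Suc 0)) (PT_region X c) (\<lambda>v. of_real (log_norm X (taut_norm h) c i v))"
    proof (rule Ck_on_cong[OF PT_region_open[OF X ci(1)], rotated])
      fix w assume w: "w \<in> PT_region X c"
      show "complex_of_real (ln (Re (?g w))) = complex_of_real (log_norm X (taut_norm h) c i w)"
        unfolding log_norm_def eq[OF ci w, symmetric] ..
    qed
  qed (use pos in auto)
  fix c i v l j
  assume ci: "c \<in> atlas X" "i < mdim X" and v: "v \<in> PT_region X c" and l: "l < 2 * mdim X - 1" and j: "j < 2 * mdim X - 1"
  note op = PT_region_open[OF X ci(1)]
  have s: "snd (PT_dom X c i, PT_coord X c i) (PT_base X c v, proj_line (PT_vec X c i v)) = v"
    by (simp add: PT_point(2)[OF X ci v])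
  have e: "complex_of_real (ln (Re (let x = chart_inv (PT_dom X c i, PT_coord X c i) w
      in h x (taut_frame c i x) (taut_frame c i x)))) = of_real (log_norm X (taut_norm h) c i w)"
    if w: "w \<in> PT_region X c" for w
    unfolding log_norm_def eq[OF ci w, symmetric] ..
  show "chern_curv h (taut_frame c i) (PT_dom X c i, PT_coord X c i) (PT_base X c v, proj_line (PT_vec X c i v)) l j
        = - dz l (dzbar j (\<lambda>v. of_real (log_norm X (taut_norm h) c i v))) v"
    unfolding chern_curv_def s
    by (intro arg_cong[where f = uminus] dz_cong[OF op v l] dzbar_cong[OF op _ j] e)
qed

text \<open>The Levi form in direction \<open>b\<close>. By \<open>laplacian_at0_comp\<close>, four
  times its value is the Laplacian of \<open>g\<close> along a holomorphic curve with velocity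
  \<open>b\<close>.\<close>

definition levi :: "nat \<Rightarrow> (cvec \<Rightarrow> real) \<Rightarrow> cvec \<Rightarrow> cvec \<Rightarrow> real" where
  "levi n g v b = Re (\<Sum>l<n. \<Sum>j<n. dz l (dzbar j (\<lambda>v. complex_of_real (g v))) v * b l * cnj (b j))"

lemma RC_positive_levi:
  assumes X: "complex_manifold X" and RC: "RC_positive (proj_tangent X) (tautological X)"
  obtains K where "finsler X K"
    "\<And>c i v. c \<in> atlas X \<Longrightarrow> i < mdim X \<Longrightarrow> v \<in> PT_region X c \<Longrightarrow>
      \<exists>b\<in>Cspace (2 * mdim X - 1). levi (2 * mdim X - 1) (log_norm X K c i) v b < 0"
proof -
  let ?m = "2 * mdim X - 1"
  obtain h where h: "bundle_metric (proj_tangent X) (tautological X) h"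
    and pos: "\<forall>y\<in>topspace (mtop (proj_tangent X)). \<forall>c\<in>atlas (proj_tangent X).
       \<forall>(V, e)\<in>frames (tautological X). y \<in> fst c \<and> y \<in> V \<longrightarrow>
         (\<exists>k::real. k > 0 \<and> eigenvalue (mat (mdim (proj_tangent X)) (mdim (proj_tangent X))
            (\<lambda>(i, j). chern_curv h e c y i j)) (complex_of_real k))"
    using RC unfolding RC_positive_def by blast
  have "\<exists>b\<in>Cspace ?m. levi ?m (log_norm X (taut_norm h) c i) v b < 0"
    if ci: "c \<in> atlas X" "i < mdim X" and v: "v \<in> PT_region X c" for c i v
  proof -
    let ?y = "(PT_base X c v, proj_line (PT_vec X c i v))"
    let ?c = "(PT_dom X c i, PT_coord X c i)"
    let ?A = "mat ?m ?m (\<lambda>(l, j). - dz l (dzbar j (\<lambda>v. complex_of_real (log_norm X (taut_norm h) c i v))) v)"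
    have y: "?y \<in> PT_dom X c i" by (rule PT_point(1)[OF X ci v])
    then have yt: "?y \<in> topspace (mtop (proj_tangent X))" using PT_dom_topspace[OF X ci] by blast
    have fr: "(PT_dom X c i, taut_frame c i) \<in> frames (tautological X)"
      unfolding tautological_def line_bundle.select_convs mem_Collect_eq using ci by blast
    obtain k :: real where k: "k > 0" "eigenvalue (mat (mdim (proj_tangent X)) (mdim (proj_tangent X))
            (\<lambda>(l, j). chern_curv h (taut_frame c i) ?c ?y l j)) (complex_of_real k)"
      using bspec[OF bspec[OF bspec[OF pos yt] PT_chart_in_atlas[OF X ci]] fr] y by auto
    have "mat (mdim (proj_tangent X)) (mdim (proj_tangent X)) (\<lambda>(l, j). chern_curv h (taut_frame c i) ?c ?y l j) = ?A"
      by (rule eq_matI) (simp_all add: chern_curv_tautological[OF X h ci v])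
    then obtain x where x: "x \<in> carrier_vec ?m" "x \<noteq> 0\<^sub>v ?m" "?A *\<^sub>v x = complex_of_real k \<cdot>\<^sub>v x"
      using k(2) unfolding eigenvalue_def eigenvector_def by auto
    \<comment> \<open>Conjugated, because multiplying the matrix with a vector contracts its second
      index, and that is the index which carries the conjugate in \<open>levi\<close>. With this
      choice the form is \<open>- k\<close> times the squared norm of \<open>x\<close>.\<close>
    define b where "b l = (if l < ?m then cnj (x $ l) else 0)" for l
    have row: "(\<Sum>j<?m. - dz l (dzbar j (\<lambda>v. complex_of_real (log_norm X (taut_norm h) c i v))) v * x $ j) = k * x $ l"
      if l: "l < ?m" for l
    proof -
      have "(?A *\<^sub>v x) $ l = (complex_of_real k \<cdot>\<^sub>v x) $ l" using x(3) by simp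
      then show ?thesis using l x(1)
        by (simp add: scalar_prod_def lessThan_atLeast0)
    qed
    have "(\<Sum>l<?m. \<Sum>j<?m. dz l (dzbar j (\<lambda>v. complex_of_real (log_norm X (taut_norm h) c i v))) v * b l * cnj (b j))
      = (\<Sum>l<?m. - (cnj (x $ l) * (\<Sum>j<?m. - dz l (dzbar j (\<lambda>v. complex_of_real (log_norm X (taut_norm h) c i v))) v * x $ j)))"
      unfolding sum_distrib_left by (simp add: b_def sum_negf mult_ac)
    also have "\<dots> = (\<Sum>l<?m. - complex_of_real (k * (norm (x $ l))\<^sup>2))"
    proof (intro sum.cong refl)
      fix l assume "l \<in> {..<?m}"
      then have "(\<Sum>j<?m. - dz l (dzbar j (\<lambda>v. complex_of_real (log_norm X (taut_norm h) c i v))) v * x $ j) = k * x $ l"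
        using row by blast
      then show "- (cnj (x $ l) * (\<Sum>j<?m. - dz l (dzbar j (\<lambda>v. complex_of_real (log_norm X (taut_norm h) c i v))) v * x $ j))
        = - complex_of_real (k * (norm (x $ l))\<^sup>2)"
        by (simp only: of_real_mult complex_norm_square mult_ac)
    qed
    finally have "levi ?m (log_norm X (taut_norm h) c i) v b = - k * (\<Sum>l<?m. (norm (x $ l))\<^sup>2)"
      unfolding levi_def by (simp add: sum_distrib_left sum_negf)
    moreover have "(\<Sum>l<?m. (norm (x $ l))\<^sup>2) > 0"
    proof -
      obtain l where "l < ?m" "x $ l \<noteq> 0"
        using x(1,2) by (metis carrier_vecD eq_vecI index_zero_vec)
      then show ?thesis by (intro sum_pos2[of _ l]) auto
    qed
    ultimately have "levi ?m (log_norm X (taut_norm h) c i) v b < 0" using k(1) by simp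
    moreover have "b \<in> Cspace ?m" by (simp add: b_def Cspace_def)
    ultimately show ?thesis by blast
  qed
  then show ?thesis using that[OF finsler_taut_norm[OF X h]] by blast
qed

text \<open>The functional on the line of \<open>W\<close> that is 1 at \<open>W\<close>, extended
  by 0 to all other arguments as the fibres of \<open>dual_bundle\<close> require.\<close>

definition dual_vec :: "('s \<Rightarrow> complex) \<Rightarrow> ('s \<Rightarrow> complex) \<Rightarrow> complex" where
  "dual_vec W u = (if u \<in> proj_line W then (THE a. u = (\<lambda>s. a * W s)) else 0)"

lemma dual_vec_apply:
  assumes "W \<noteq> (\<lambda>s. 0)"
  shows "dual_vec W (\<lambda>s. a * W s) = a"
proof -
  obtain s where "W s \<noteq> 0" using assms by auto
  then have "(THE b. (\<lambda>s. a * W s) = (\<lambda>s. b * W s)) = a"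
    by (intro the_equality) (auto dest: fun_cong[of _ _ s])
  moreover have "(\<lambda>s. a * W s) \<in> proj_line W" unfolding proj_line_def by blast
  ultimately show ?thesis by (simp add: dual_vec_def)
qed

lemma dual_vec_scale:
  assumes "W \<noteq> (\<lambda>s. 0)" "a \<noteq> 0"
  shows "dual_vec (\<lambda>s. a * W s) = (\<lambda>u. inverse a * dual_vec W u)"
proof
  fix u
  show "dual_vec (\<lambda>s. a * W s) u = inverse a * dual_vec W u"
  proof (cases "u \<in> proj_line W")
    case True
    then obtain b where b: "u = (\<lambda>s. b * W s)" unfolding proj_line_def by blast
    then have u: "u = (\<lambda>s. (b / a) * (a * W s))" using assms(2) by (simp add: fun_eq_iff)
    obtain s where "W s \<noteq> 0" using assms by auto
    then have nz: "(\<lambda>s. a * W s) \<noteq> (\<lambda>s. 0)" using assms(2) by (auto dest: fun_cong[of _ _ s])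
    have "dual_vec (\<lambda>s. a * W s) u = b / a"
      by (subst u) (rule dual_vec_apply[OF nz])
    moreover have "dual_vec W u = b" unfolding b by (rule dual_vec_apply[OF assms(1)])
    ultimately show ?thesis by (simp add: divide_inverse mult.commute)
  qed (use assms(2) in \<open>simp add: dual_vec_def proj_line_scale\<close>)
qed

lemma dual_vec_in_fibre:
  assumes "W \<noteq> (\<lambda>s. 0)"
  shows "dual_vec W \<in> fibre (dual_bundle (tautological X)) (p, proj_line W)"
proof -
  have add: "(\<lambda>s. a * W s + b * W s) = (\<lambda>s. (a + b) * W s)" for a b by (simp add: distrib_right)
  have mul: "(\<lambda>s. a * (b * W s)) = (\<lambda>s. (a * b) * W s)" for a b by (simp add: mult.assoc)
  have "dual_vec W (\<lambda>s. u s + v s) = dual_vec W u + dual_vec W v" "dual_vec W (\<lambda>s. a * u s) = a * dual_vec W u"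
    if "u \<in> proj_line W" "v \<in> proj_line W" for u v a
    using that unfolding proj_line_def by (auto simp: add mul dual_vec_apply[OF assms])
  moreover have "dual_vec W u = 0" if "u \<notin> proj_line W" for u using that by (simp add: dual_vec_def)
  ultimately show ?thesis
    unfolding dual_bundle_def tautological_def by simp
qed

text \<open>The inverse turns a metric on the dual bundle into one on the tautological bundle: when
  \<open>W\<close> is multiplied by \<open>a\<close>, \<open>dual_vec W\<close> is divided by
  \<open>a\<close>, and the result scales by the squared modulus of \<open>a\<close>. Both curvature
  hypotheses thus become statements about functions of tangent vectors.\<close>

definition dual_norm :: "('a ptangent \<Rightarrow> ('a tvec \<Rightarrow> complex) \<Rightarrow> ('a tvec \<Rightarrow> complex) \<Rightarrow> complex) \<Rightarrow>
    'a \<Rightarrow> 'a tvec \<Rightarrow> real" where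
  "dual_norm h p W = inverse (Re (h (p, proj_line W) (dual_vec W) (dual_vec W)))"

definition dual_frame :: "'a chart \<Rightarrow> nat \<Rightarrow> 'a ptangent \<Rightarrow> 'a tvec \<Rightarrow> complex" where
  "dual_frame c i y u = (if u \<in> snd y then (THE a. u = (\<lambda>s. a * taut_frame c i y s)) else 0)"

lemma dual_frame_in_frames:
  assumes "c \<in> atlas X" "i < mdim X"
  shows "(PT_dom X c i, dual_frame c i) \<in> frames (dual_bundle (tautological X))"
proof -
  have "(PT_dom X c i, taut_frame c i) \<in> frames (tautological X)"
    unfolding tautological_def line_bundle.select_convs mem_Collect_eq using assms by blast
  moreover have "dual_frame c i = (\<lambda>y u. if u \<in> fibre (tautological X) y
      then (THE a. u = (\<lambda>s. a * taut_frame c i y s)) else 0)"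
    by (simp add: dual_frame_def tautological_def fun_eq_iff)
  ultimately show ?thesis
    unfolding dual_bundle_def by (auto simp: image_iff split: prod.splits intro!: bexI)
qed

text \<open>The dual frame at a point is the dual vector of the tautological frame, so its potential
  is minus that of \<open>dual_norm\<close>. This sign cancels the one in the Chern curvature, and
  nefness will bound a Levi form from below.\<close>

lemma
  assumes X: "complex_manifold X" and h: "bundle_metric (proj_tangent X) (dual_bundle (tautological X)) h"
  shows finsler_dual_norm: "finsler X (dual_norm h)"
    and chern_curv_dual: "\<And>c i v l j. c \<in> atlas X \<Longrightarrow> i < mdim X \<Longrightarrow> v \<in> PT_region X c \<Longrightarrow>
      l < 2 * mdim X - 1 \<Longrightarrow> j < 2 * mdim X - 1 \<Longrightarrow>
      chern_curv h (dual_frame c i) (PT_dom X c i, PT_coord X c i) (PT_base X c v, proj_line (PT_vec X c i v)) l j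
        = dz l (dzbar j (\<lambda>v. of_real (log_norm X (dual_norm h) c i v))) v"
proof -
  have herm: "hermitian_inner (fibre (dual_bundle (tautological X)) y) (h y)" if "y \<in> topspace (mtop (proj_tangent X))" for y
    using h that unfolding bundle_metric_def by blast
  have pos0: "Re (h (p, proj_line W) (dual_vec W) (dual_vec W)) > 0"
    and pos: "dual_norm h p W > 0 \<and> (\<forall>a. a \<noteq> 0 \<longrightarrow> dual_norm h p (\<lambda>s. a * W s) = (norm a)\<^sup>2 * dual_norm h p W)"
    if W: "p \<in> topspace (mtop X)" "W \<in> tangent_space X p" "W \<noteq> (\<lambda>s. 0)" for p W
  proof -
    let ?F = "fibre (dual_bundle (tautological X)) (p, proj_line W)"
    have H: "hermitian_inner ?F (h (p, proj_line W))"
      by (rule herm[OF tangent_line_topspace[OF X W]])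
    have "dual_vec W W = 1" using dual_vec_apply[OF W(3), of 1] by simp
    then have "dual_vec W \<noteq> (\<lambda>u. 0)" by (metis zero_neq_one)
    then show p: "Re (h (p, proj_line W) (dual_vec W) (dual_vec W)) > 0"
      using H dual_vec_in_fibre[OF W(3)] unfolding hermitian_inner_def by blast
    have "dual_norm h p (\<lambda>s. a * W s) = (norm a)\<^sup>2 * dual_norm h p W" if a: "a \<noteq> 0" for a
    proof -
      obtain s where "W s \<noteq> 0" using W(3) by (metis ext)
      then have nz: "(\<lambda>s. a * W s) \<noteq> (\<lambda>s. 0)" using a by (auto dest: fun_cong[of _ _ s])
      have "(\<lambda>u. inverse a * dual_vec W u) \<in> ?F"
        using dual_vec_in_fibre[OF nz, of X p] unfolding dual_vec_scale[OF W(3) a] proj_line_scale[OF a] .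
      note E = hermitian_inner_scale[OF H dual_vec_in_fibre[OF W(3)] this]
      show ?thesis
        unfolding dual_norm_def dual_vec_scale[OF W(3) a] proj_line_scale[OF a] E
        by (simp add: norm_inverse power_inverse)
    qed
    then show "dual_norm h p W > 0 \<and> (\<forall>a. a \<noteq> 0 \<longrightarrow> dual_norm h p (\<lambda>s. a * W s) = (norm a)\<^sup>2 * dual_norm h p W)"
      using p by (simp add: dual_norm_def)
  qed
  have fr: "dual_frame c i (PT_base X c v, proj_line (PT_vec X c i v)) = dual_vec (PT_vec X c i v)"
    if "c \<in> atlas X" "i < mdim X" "v \<in> PT_region X c" for c i v
    by (simp add: fun_eq_iff dual_frame_def dual_vec_def PT_point(3)[OF X that])
  have pos_v: "Re (h (PT_base X c v, proj_line (PT_vec X c i v)) (dual_vec (PT_vec X c i v)) (dual_vec (PT_vec X c i v))) > 0"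
    if "c \<in> atlas X" "i < mdim X" "v \<in> PT_region X c" for c i v
  proof -
    have "PT_vec X c i v \<noteq> (\<lambda>s. 0)" using PT_vec_apply_self[OF X that] by auto
    then show ?thesis
      using pos0[OF _ PT_vec_tangent[OF X that]] PT_base_in[OF X that(1,3)] chart_dom_subset[OF X that(1)] by blast
  qed
  let ?g = "\<lambda>c i v. let x = chart_inv (PT_dom X c i, PT_coord X c i) v in h x (dual_frame c i x) (dual_frame c i x)"
  have eq: "Re (?g c i v) = Re (h (PT_base X c v, proj_line (PT_vec X c i v)) (dual_vec (PT_vec X c i v)) (dual_vec (PT_vec X c i v)))"
    if "c \<in> atlas X" "i < mdim X" "v \<in> PT_region X c" for c i v
    unfolding PT_chart_inv[OF X that] Let_def fr[OF that] ..
  have ln: "complex_of_real (ln (Re (?g c i v))) = - of_real (log_norm X (dual_norm h) c i v)"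
    if "c \<in> atlas X" "i < mdim X" "v \<in> PT_region X c" for c i v
    unfolding log_norm_def dual_norm_def eq[OF that] using pos_v[OF that] by (simp add: ln_inverse)
  have Ck: "Ck_on (2 * mdim X - 1) (Suc (Suc 0)) (PT_region X c) (\<lambda>v. of_real (log_norm X (dual_norm h) c i v))"
    if ci: "c \<in> atlas X" "i < mdim X" for c i
  proof -
    have "smooth_fun (proj_tangent X) (PT_dom X c i) (\<lambda>y. h y (dual_frame c i y) (dual_frame c i y))"
      using h dual_frame_in_frames[OF ci] unfolding bundle_metric_def by fastforce
    from smooth_in_PT_chart[OF X ci this]
    have sm: "Ck_on (2 * mdim X - 1) (Suc (Suc 0)) (PT_region X c) (?g c i)" by (simp add: Let_def)
    have "Re (?g c i v) > 0" if v: "v \<in> PT_region X c" for v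
      unfolding eq[OF ci v] by (rule pos_v[OF ci v])
    note L = Ck_on_ln[OF PT_region_open[OF X ci(1)] sm this]
    show ?thesis
    proof (rule Ck_on_cong[OF PT_region_open[OF X ci(1)] _ Ck_on_linear[OF PT_region_open[OF X ci(1)] L L, of "-1" 0]])
      fix w assume "w \<in> PT_region X c"
      from ln[OF ci this]
      show "- 1 * complex_of_real (ln (Re (?g c i w))) + 0 * complex_of_real (ln (Re (?g c i w))) =
        complex_of_real (log_norm X (dual_norm h) c i w)" by simp
    qed
  qed
  show "finsler X (dual_norm h)"
    unfolding finsler_def using pos Ck by blast
  fix c i v l j
  assume ci: "c \<in> atlas X" "i < mdim X" and v: "v \<in> PT_region X c" and l: "l < 2 * mdim X - 1" and j: "j < 2 * mdim X - 1"
  note op = PT_region_open[OF X ci(1)]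
  let ?k = "\<lambda>v. complex_of_real (log_norm X (dual_norm h) c i v)"
  have s: "snd (PT_dom X c i, PT_coord X c i) (PT_base X c v, proj_line (PT_vec X c i v)) = v"
    by (simp add: PT_point(2)[OF X ci v])
  have neg: "pderiv_dir j u (\<lambda>v. - g v) w = - pderiv_dir j u g w"
    if g: "Ck_on (2 * mdim X - 1) (Suc 0) (PT_region X c) g" and w: "w \<in> PT_region X c" "j < 2 * mdim X - 1" "u \<in> {1, \<i>}" for g w j u
    by (rule pderiv_dir_eqI) (rule has_vector_derivative_minus[OF pderiv_dir_works[OF g w]])
  have 1: "dzbar j (\<lambda>v. complex_of_real (ln (Re (?g c i v)))) w = - dzbar j ?k w" if w: "w \<in> PT_region X c" for w
  proof -
    have "dzbar j (\<lambda>v. complex_of_real (ln (Re (?g c i v)))) w = dzbar j (\<lambda>v. - ?k v) w"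
      by (rule dzbar_cong[OF op w j]) (rule ln[OF ci])
    also have "\<dots> = - dzbar j ?k w"
      using neg[OF Ck_on_mono[OF Ck[OF ci]] w j] by (simp add: dzbar_def field_simps)
    finally show ?thesis .
  qed
  have "dz l (dzbar j (\<lambda>v. complex_of_real (ln (Re (?g c i v))))) v = dz l (\<lambda>w. - dzbar j ?k w) v"
    by (rule dz_cong[OF op v l 1])
  also have "\<dots> = - dz l (dzbar j ?k) v"
    using neg[OF Ck_on_dz_dzbar(2)[OF op Ck[OF ci] j] v l] by (simp add: dz_def field_simps)
  finally show "chern_curv h (dual_frame c i) (PT_dom X c i, PT_coord X c i) (PT_base X c v, proj_line (PT_vec X c i v)) l j
        = dz l (dzbar j ?k) v"
    unfolding chern_curv_def s by simp
qed

text \<open>The form \<open>\<omega>\<close> enters only through the continuity of its coefficients \<open>\<Omega>\<close>.\<close>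

lemma nef_levi:
  assumes X: "complex_manifold X" and nef: "nef (proj_tangent X) (dual_bundle (tautological X))"
  obtains \<Omega> :: "'a chart \<Rightarrow> nat \<Rightarrow> cvec \<Rightarrow> nat \<Rightarrow> nat \<Rightarrow> complex"
  where "\<And>c i l j. c \<in> atlas X \<Longrightarrow> i < mdim X \<Longrightarrow> l < 2 * mdim X - 1 \<Longrightarrow> j < 2 * mdim X - 1 \<Longrightarrow>
      continuous_on (PT_region X c) (\<lambda>v. \<Omega> c i v l j)"
    "\<And>\<epsilon>. \<epsilon> > 0 \<Longrightarrow> \<exists>K. finsler X K \<and> (\<forall>c\<in>atlas X. \<forall>i<mdim X. \<forall>v\<in>PT_region X c. \<forall>a.
      levi (2 * mdim X - 1) (log_norm X K c i) v a \<ge>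
        - \<epsilon> * Re (\<Sum>l<2 * mdim X - 1. \<Sum>j<2 * mdim X - 1. \<Omega> c i v l j * a l * cnj (a j)))"
proof -
  let ?Y = "proj_tangent X" and ?m = "2 * mdim X - 1" and ?L = "dual_bundle (tautological X)"
  let ?c = "\<lambda>c i. (PT_dom X c i, PT_coord X c i)"
  let ?y = "\<lambda>c i v. (PT_base X c v, proj_line (PT_vec X c i v))"
  obtain \<omega> where \<omega>: "manifold_metric ?Y \<omega>"
    and ne: "\<forall>\<epsilon>>0. \<exists>h. bundle_metric ?Y ?L h \<and>
         (\<forall>y\<in>topspace (mtop ?Y). \<forall>c\<in>atlas ?Y. \<forall>(V, e)\<in>frames ?L. y \<in> fst c \<and> y \<in> V \<longrightarrow>
           (\<forall>a::nat \<Rightarrow> complex.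
             Re (\<Sum>i<mdim ?Y. \<Sum>j<mdim ?Y. chern_curv h e c y i j * a i * cnj (a j))
             \<ge> - \<epsilon> * Re (\<Sum>i<mdim ?Y. \<Sum>j<mdim ?Y.
                   \<omega> y (coord_vec ?Y c y i) (coord_vec ?Y c y j) * a i * cnj (a j))))"
    using nef unfolding nef_def by blast
  define \<Omega> where "\<Omega> c i v l j = \<omega> (?y c i v) (coord_vec ?Y (?c c i) (?y c i v) l) (coord_vec ?Y (?c c i) (?y c i v) j)" for c i v l j
  show ?thesis
  proof (rule that[of \<Omega>])
    fix c i l j assume ci: "c \<in> atlas X" "i < mdim X" and lj: "l < ?m" "j < ?m"
    have "smooth_fun ?Y (PT_dom X c i) (\<lambda>y. \<omega> y (coord_vec ?Y (?c c i) y l) (coord_vec ?Y (?c c i) y j))"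
      using \<omega> PT_chart_in_atlas[OF X ci] lj unfolding manifold_metric_def by fastforce
    from smooth_in_PT_chart[OF X ci this, of 0]
    have "continuous_on (PT_region X c) (\<lambda>v. \<omega> (chart_inv (?c c i) v) (coord_vec ?Y (?c c i) (chart_inv (?c c i) v) l) (coord_vec ?Y (?c c i) (chart_inv (?c c i) v) j))"
      by simp
    moreover have "\<omega> (chart_inv (?c c i) v) (coord_vec ?Y (?c c i) (chart_inv (?c c i) v) l) (coord_vec ?Y (?c c i) (chart_inv (?c c i) v) j) = \<Omega> c i v l j"
      if "v \<in> PT_region X c" for v
      unfolding PT_chart_inv[OF X ci that] \<Omega>_def ..
    ultimately show "continuous_on (PT_region X c) (\<lambda>v. \<Omega> c i v l j)"
      by (rule continuous_on_eq)
  next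
    fix \<epsilon> :: real assume "\<epsilon> > 0"
    then obtain h where h: "bundle_metric ?Y ?L h"
      and hn: "\<forall>y\<in>topspace (mtop ?Y). \<forall>c\<in>atlas ?Y. \<forall>(V, e)\<in>frames ?L. y \<in> fst c \<and> y \<in> V \<longrightarrow>
           (\<forall>a::nat \<Rightarrow> complex.
             Re (\<Sum>i<mdim ?Y. \<Sum>j<mdim ?Y. chern_curv h e c y i j * a i * cnj (a j))
             \<ge> - \<epsilon> * Re (\<Sum>i<mdim ?Y. \<Sum>j<mdim ?Y.
                   \<omega> y (coord_vec ?Y c y i) (coord_vec ?Y c y j) * a i * cnj (a j)))"
      using ne by blast
    have "levi ?m (log_norm X (dual_norm h) c i) v a \<ge> - \<epsilon> * Re (\<Sum>l<?m. \<Sum>j<?m. \<Omega> c i v l j * a l * cnj (a j))"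
      if ci: "c \<in> atlas X" "i < mdim X" and v: "v \<in> PT_region X c" for c i v a
    proof -
      have y: "?y c i v \<in> PT_dom X c i" by (rule PT_point(1)[OF X ci v])
      then have yt: "?y c i v \<in> topspace (mtop ?Y)" using PT_dom_topspace[OF X ci] by blast
      have E: "(\<Sum>l<?m. \<Sum>j<?m. chern_curv h (dual_frame c i) (?c c i) (?y c i v) l j * a l * cnj (a j)) =
        (\<Sum>l<?m. \<Sum>j<?m. dz l (dzbar j (\<lambda>v. complex_of_real (log_norm X (dual_norm h) c i v))) v * a l * cnj (a j))"
        by (intro sum.cong refl arg_cong2[where f = "(*)"] chern_curv_dual[OF X h ci v]) auto
      have "\<forall>a. Re (\<Sum>l<mdim ?Y. \<Sum>j<mdim ?Y. chern_curv h (dual_frame c i) (?c c i) (?y c i v) l j * a l * cnj (a j))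
             \<ge> - \<epsilon> * Re (\<Sum>l<mdim ?Y. \<Sum>j<mdim ?Y.
                   \<omega> (?y c i v) (coord_vec ?Y (?c c i) (?y c i v) l) (coord_vec ?Y (?c c i) (?y c i v) j) * a l * cnj (a j))"
        using bspec[OF bspec[OF bspec[OF hn yt] PT_chart_in_atlas[OF X ci]] dual_frame_in_frames[OF ci]] y by simp
      then show ?thesis
        unfolding levi_def \<Omega>_def mdim_proj_tangent E[symmetric] by blast
    qed
    then show "\<exists>K. finsler X K \<and> (\<forall>c\<in>atlas X. \<forall>i<mdim X. \<forall>v\<in>PT_region X c. \<forall>a.
      levi ?m (log_norm X K c i) v a \<ge> - \<epsilon> * Re (\<Sum>l<?m. \<Sum>j<?m. \<Omega> c i v l j * a l * cnj (a j)))"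
      using finsler_dual_norm[OF X h] by blast
  qed
qed

section \<open>Compactness\<close>

text \<open>By Tychonoff's theorem: a product of discs, with the factor {0} from index
  \<open>n\<close> on.\<close>

lemma compact_polydisc: "compact {v \<in> Cspace n. \<forall>k<n. norm (v k) \<le> R k}"
proof -
  have "compactin (product_topology (\<lambda>i. euclidean) UNIV) (Pi\<^sub>E UNIV (\<lambda>k. if k < n then cball (0::complex) (R k) else {0}))"
    by (subst compactin_PiE) auto
  then have "compact (Pi\<^sub>E UNIV (\<lambda>k. if k < n then cball (0::complex) (R k) else {0}))"
    by (simp add: euclidean_product_topology)
  moreover have "Pi\<^sub>E UNIV (\<lambda>k. if k < n then cball (0::complex) (R k) else {0}) = {v \<in> Cspace n. \<forall>k<n. norm (v k) \<le> R k}"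
    by (auto simp: PiE_iff Cspace_def split: if_splits)
  ultimately show ?thesis by simp
qed

text \<open>The parameter \<rho> is the square of the radius. The squared distance keeps the cutoff
  polynomial in the real coordinates.\<close>

definition cball_Cspace :: "nat \<Rightarrow> cvec \<Rightarrow> real \<Rightarrow> cvec set" where
  "cball_Cspace n a \<rho> = {z \<in> Cspace n. (\<Sum>j<n. (norm (z j - a j))\<^sup>2) \<le> \<rho>}"

lemma compact_cball_Cspace: "compact (cball_Cspace n a \<rho>)"
proof -
  let ?R = "\<lambda>k. norm (a k) + sqrt \<bar>\<rho>\<bar>"
  have "norm (z k) \<le> ?R k" if z: "(\<Sum>j<n. (norm (z j - a j))\<^sup>2) \<le> \<rho>" and k: "k < n" for z k
  proof -
    have "(norm (z k - a k))\<^sup>2 \<le> (\<Sum>j<n. (norm (z j - a j))\<^sup>2)"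
      by (rule member_le_sum) (use k in auto)
    then have "norm (z k - a k) \<le> sqrt \<bar>\<rho>\<bar>" using z by (intro real_le_rsqrt) linarith
    then show ?thesis using norm_triangle_sub[of "z k" "a k"] by linarith
  qed
  then have "cball_Cspace n a \<rho> = {v \<in> Cspace n. \<forall>k<n. norm (v k) \<le> ?R k} \<inter> {z. (\<Sum>j<n. (norm (z j - a j))\<^sup>2) \<le> \<rho>}"
    unfolding cball_Cspace_def by auto
  moreover have "closed {z::cvec. (\<Sum>j<n. (norm (z j - a j))\<^sup>2) \<le> \<rho>}"
    by (intro closed_Collect_le continuous_intros continuous_on_cvec_apply)
  ultimately show ?thesis using compact_polydisc by (simp add: compact_Int_closed)
qed

text \<open>Dividing by a component of maximal modulus moves every line over \<open>L\<close> into one of these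
  compact sets, so that finitely many of them replace the compactness of the bundle.\<close>

definition PT_compact :: "nat \<Rightarrow> cvec set \<Rightarrow> cvec set" where
  "PT_compact n L = {v \<in> Cspace (2 * n - 1). base_coord n v \<in> L \<and> (\<forall>k. n \<le> k \<and> k < 2 * n - 1 \<longrightarrow> norm (v k) \<le> 1)}"

lemma compact_PT_compact:
  assumes "compact L"
  shows "compact (PT_compact n L)"
proof -
  have "\<exists>B. \<forall>v\<in>L. norm (v k) \<le> B" for k
    using compact_continuous_image[OF continuous_on_cvec_apply[of L k] assms]
    by (metis bounded_iff compact_imp_bounded imageI)
  then obtain B where B: "\<And>k v. v \<in> L \<Longrightarrow> norm (v k) \<le> B k" by metis
  let ?R = "\<lambda>k. if k < n then B k else 1"
  have "norm (v k) \<le> B k" if "base_coord n v \<in> L" "k < n" for v k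
    using B[OF that(1), of k] that(2) by (simp add: base_coord_def)
  then have "PT_compact n L = {v \<in> Cspace (2 * n - 1). \<forall>k<2 * n - 1. norm (v k) \<le> ?R k} \<inter> base_coord n -` L"
    unfolding PT_compact_def by (auto simp: not_less)
  moreover have "closed (base_coord n -` L)"
    using base_coord_continuous[of UNIV n] continuous_on_eq_continuous_at[OF open_UNIV]
    by (intro continuous_closed_vimage compact_imp_closed[OF assms]) blast
  ultimately show ?thesis using compact_polydisc by (simp add: compact_Int_closed)
qed

lemma PT_compact_subset: "L \<subseteq> snd c ` fst c \<Longrightarrow> PT_compact (mdim X) L \<subseteq> PT_region X c"
  unfolding PT_compact_def PT_region_def by auto

text \<open>Every estimate is phrased so that it survives enlarging its constant; finitely many of
  them can then share one.\<close>

lemma finite_uniform: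
  fixes Q :: "'k \<Rightarrow> real \<Rightarrow> bool"
  assumes "finite F" "\<And>k. k \<in> F \<Longrightarrow> \<exists>C. \<forall>C'\<ge>C. Q k C'"
  shows "\<exists>C>0. \<forall>k\<in>F. \<forall>C'\<ge>C. Q k C'"
  using assms
proof (induction F rule: finite_induct)
  case empty
  then show ?case by (auto intro: exI[of _ 1])
next
  case (insert x F)
  then obtain C1 where "C1 > 0" "\<forall>k\<in>F. \<forall>C'\<ge>C1. Q k C'" by auto
  moreover obtain C2 where "\<forall>C'\<ge>C2. Q x C'" using insert.prems[of x] by blast
  ultimately show ?case by (intro exI[of _ "max C1 C2"]) auto
qed

lemma max_component:
  assumes "\<exists>i<n::nat. w i \<noteq> (0::complex)"
  obtains i where "i < n" "w i \<noteq> 0" "\<And>j. j < n \<Longrightarrow> norm (w j) \<le> norm (w i)"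
proof -
  obtain i0 where i0: "i0 < n" "w i0 \<noteq> 0" using assms by blast
  let ?S = "(\<lambda>i. norm (w i)) ` {..<n}"
  have "Max ?S \<in> ?S" using i0 by (intro Max_in) auto
  then obtain i where i: "i < n" "Max ?S = norm (w i)" by auto
  have le: "norm (w j) \<le> norm (w i)" if "j < n" for j
    unfolding i(2)[symmetric] using that by (intro Max_ge) auto
  moreover have "w i \<noteq> 0" using le[OF i0(1)] i0(2) by auto
  ultimately show ?thesis using that i by blast
qed

lemma vec_coord_PT_compact:
  assumes X: "complex_manifold X" and c: "c \<in> atlas X" and i: "i < mdim X"
    and p: "p \<in> fst c" "snd c p \<in> L" and W: "W \<in> tangent_space X p" "W (c, i) \<noteq> 0"
    and le: "\<And>j. j < mdim X \<Longrightarrow> norm (W (c, j)) \<le> norm (W (c, i))"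
  shows "vec_coord X c i p W \<in> PT_compact (mdim X) L"
  unfolding PT_compact_def
proof (intro CollectI conjI allI impI)
  show "vec_coord X c i p W \<in> Cspace (2 * mdim X - 1)"
    using vec_coord_in[OF X c i p(1) W] by (simp add: PT_region_def)
  show "base_coord (mdim X) (vec_coord X c i p W) \<in> L"
    unfolding base_coord_vec_coord[OF X c i p(1) W] by (rule p(2))
  fix k assume k: "mdim X \<le> k \<and> k < 2 * mdim X - 1"
  then have "skip_index i (k - mdim X) < mdim X" by (auto simp: skip_index_def)
  from le[OF this] show "norm (vec_coord X c i p W k) \<le> 1"
    using k W(2) by (simp add: vec_coord_def norm_divide)
qed

definition coord_sqnorm :: "'a cmanifold \<Rightarrow> 'a chart \<Rightarrow> 'a tvec \<Rightarrow> real" where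
  "coord_sqnorm X c W = (\<Sum>j<mdim X. (norm (W (c, j)))\<^sup>2)"

lemma coord_sqnorm_nonneg: "coord_sqnorm X c W \<ge> 0"
  by (simp add: coord_sqnorm_def sum_nonneg)

lemma log_norm_continuous:
  assumes "finsler X K" "c \<in> atlas X" "i < mdim X"
  shows "continuous_on (PT_region X c) (log_norm X K c i)"
proof -
  have "continuous_on (PT_region X c) (\<lambda>v. complex_of_real (log_norm X K c i v))"
    using assms unfolding finsler_def by (intro Ck_on_imp_continuous_on) blast
  from continuous_on_Re[OF this] show ?thesis by simp
qed

text \<open>After division by a component of maximal modulus the coordinates lie in a compact set,
  where the potentials are bounded by some \<open>B\<close>. The square of that component is at most
  the coordinate length and at least its quotient by the dimension; together this gives
  \<open>(1 + mdim X) * exp B\<close>.\<close>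

lemma finsler_coord_sqnorm_bounds:
  assumes X: "complex_manifold X" and K: "finsler X K" and c: "c \<in> atlas X"
    and L: "compact L" "L \<subseteq> snd c ` fst c"
  obtains C where "C > 0" "\<And>p W. p \<in> fst c \<Longrightarrow> snd c p \<in> L \<Longrightarrow> W \<in> tangent_space X p \<Longrightarrow> W \<noteq> (\<lambda>s. 0) \<Longrightarrow>
    K p W \<le> C * coord_sqnorm X c W \<and> coord_sqnorm X c W \<le> C * K p W"
proof -
  have "\<exists>B. \<forall>B'\<ge>B. \<forall>v\<in>PT_compact (mdim X) L. \<bar>log_norm X K c i v\<bar> \<le> B'" if "i \<in> {..<mdim X}" for i
  proof -
    have "continuous_on (PT_compact (mdim X) L) (log_norm X K c i)"
      using log_norm_continuous[OF K c, of i] that PT_compact_subset[OF L(2)] continuous_on_subset by blast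
    from compact_continuous_image[OF this compact_PT_compact[OF L(1)]]
    obtain B where "\<forall>x\<in>log_norm X K c i ` PT_compact (mdim X) L. norm x \<le> B"
      using compact_imp_bounded bounded_iff by metis
    then show ?thesis by (intro exI[of _ B]) (force intro: order_trans)
  qed
  from finite_uniform[of "{..<mdim X}" "\<lambda>i B'. \<forall>v\<in>PT_compact (mdim X) L. \<bar>log_norm X K c i v\<bar> \<le> B'", OF _ this]
  obtain B where B: "\<And>i v. i < mdim X \<Longrightarrow> v \<in> PT_compact (mdim X) L \<Longrightarrow> \<bar>log_norm X K c i v\<bar> \<le> B" by auto
  have "K p W \<le> (1 + mdim X) * exp B * coord_sqnorm X c W \<and> coord_sqnorm X c W \<le> (1 + mdim X) * exp B * K p W"
    if p: "p \<in> fst c" "snd c p \<in> L" and W: "W \<in> tangent_space X p" "W \<noteq> (\<lambda>s. 0)" for p W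
  proof -
    obtain i where i: "i < mdim X" "W (c, i) \<noteq> 0" "\<And>j. j < mdim X \<Longrightarrow> norm (W (c, j)) \<le> norm (W (c, i))"
      using max_component[of "mdim X" "\<lambda>i. W (c, i)"] tangent_nonzero_component[OF X c p(1) W] by metis
    define s where "s = (norm (W (c, i)))\<^sup>2"
    define l where "l = log_norm X K c i (vec_coord X c i p W)"
    have l: "\<bar>l\<bar> \<le> B" unfolding l_def by (intro B i vec_coord_PT_compact X c p W)
    have KW: "K p W = s * exp l" unfolding s_def l_def by (rule finsler_coord[OF X K c i(1) p(1) W(1) i(2)])
    have s0: "s \<ge> 0" by (simp add: s_def)
    have 1: "s \<le> coord_sqnorm X c W"
      unfolding s_def coord_sqnorm_def by (rule member_le_sum) (use i in auto)
    have "coord_sqnorm X c W \<le> (\<Sum>j<mdim X. s)"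
      unfolding s_def coord_sqnorm_def by (intro sum_mono power_mono i) auto
    then have 2: "coord_sqnorm X c W \<le> mdim X * s" by simp
    have "K p W \<le> s * exp B" unfolding KW using l s0 by (intro mult_left_mono) auto
    also have "\<dots> \<le> coord_sqnorm X c W * exp B" using 1 by (intro mult_right_mono) auto
    also have "\<dots> \<le> (1 + mdim X) * (coord_sqnorm X c W * exp B)"
      using coord_sqnorm_nonneg[of X c W] by (simp add: distrib_right)
    finally have 3: "K p W \<le> (1 + mdim X) * exp B * coord_sqnorm X c W" by (simp add: mult_ac)
    have "s = K p W * exp (- l)" unfolding KW by (simp add: exp_minus)
    also have "\<dots> \<le> K p W * exp B" using l s0 unfolding KW by (intro mult_left_mono) auto
    finally have "mdim X * s \<le> mdim X * (K p W * exp B)" by (intro mult_left_mono) auto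
    moreover have "K p W * exp B \<ge> 0" using s0 unfolding KW by simp
    ultimately have "coord_sqnorm X c W \<le> (1 + mdim X) * exp B * K p W"
      using 2 by (simp add: algebra_simps)
    with 3 show ?thesis by blast
  qed
  moreover have "(1 + mdim X) * exp B > 0" by (simp add: add_pos_nonneg)
  ultimately show ?thesis using that by blast
qed

lemma vec_coord_continuous:
  fixes q :: "'p::topological_space \<Rightarrow> 'a"
  assumes "\<And>j. j < mdim X \<Longrightarrow> continuous_on S (\<lambda>x. snd c (q x) j)"
    and "\<And>j. j < mdim X \<Longrightarrow> continuous_on S (\<lambda>x. V x (c, j))"
    and "\<And>x. x \<in> S \<Longrightarrow> V x (c, i) \<noteq> 0" and i: "i < mdim X"
  shows "continuous_on S (\<lambda>x. vec_coord X c i (q x) (V x))"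
proof (rule continuous_on_cvec)
  fix k
  consider "k < mdim X" | "mdim X \<le> k" "k < 2 * mdim X - 1" | "2 * mdim X - 1 \<le> k" "mdim X \<le> k" by linarith
  then show "continuous_on S (\<lambda>x. vec_coord X c i (q x) (V x) k)"
  proof cases
    case 1
    then show ?thesis using assms(1) by (simp add: vec_coord_def)
  next
    case 2
    then have "skip_index i (k - mdim X) < mdim X" by (auto simp: skip_index_def)
    then have "continuous_on S (\<lambda>x. V x (c, skip_index i (k - mdim X)) / V x (c, i))"
      using assms by (intro continuous_on_divide) auto
    then show ?thesis using 2 by (simp add: vec_coord_def)
  next
    case 3
    then show ?thesis by (simp add: vec_coord_def)
  qed
qed

text \<open>Where \<open>V\<close> is nonzero, some component is nonzero on a neighbourhood and
  \<open>finsler_coord\<close> is a continuous formula there. Where \<open>V\<close> vanishes, the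
  comparison with the coordinate length squeezes the values to 0. The second case occurs at the
  zeros of the differential.\<close>

lemma finsler_continuous:
  fixes q :: "'p::topological_space \<Rightarrow> 'a" and V :: "'p \<Rightarrow> 'a tvec"
  assumes X: "complex_manifold X" and K: "finsler X K" and c: "c \<in> atlas X"
    and L: "compact L" "L \<subseteq> snd c ` fst c"
    and q: "\<And>x. x \<in> S \<Longrightarrow> q x \<in> fst c" "\<And>x. x \<in> S \<Longrightarrow> snd c (q x) \<in> L"
    and V: "\<And>x. x \<in> S \<Longrightarrow> V x \<in> tangent_space X (q x)"
    and qc: "\<And>j. j < mdim X \<Longrightarrow> continuous_on S (\<lambda>x. snd c (q x) j)"
    and Vc: "\<And>j. j < mdim X \<Longrightarrow> continuous_on S (\<lambda>x. V x (c, j))"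
  shows "continuous_on S (\<lambda>x. if V x = (\<lambda>s. 0) then 0 else K (q x) (V x))"
  unfolding continuous_on
proof
  fix x0 assume x0: "x0 \<in> S"
  let ?h = "\<lambda>x. if V x = (\<lambda>s. 0) then 0 else K (q x) (V x)"
  obtain C where C: "C > 0" "\<And>p W. p \<in> fst c \<Longrightarrow> snd c p \<in> L \<Longrightarrow> W \<in> tangent_space X p \<Longrightarrow> W \<noteq> (\<lambda>s. 0) \<Longrightarrow>
    K p W \<le> C * coord_sqnorm X c W \<and> coord_sqnorm X c W \<le> C * K p W"
    using finsler_coord_sqnorm_bounds[OF X K c L] by blast
  have pos: "K (q x) (V x) > 0" if "x \<in> S" "V x \<noteq> (\<lambda>s. 0)" for x
    using K V[OF that(1)] q(1)[OF that(1)] that(2) chart_dom_subset[OF X c] unfolding finsler_def by blast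
  show "(?h \<longlongrightarrow> ?h x0) (at x0 within S)"
  proof (cases "V x0 = (\<lambda>s. 0)")
    case True
    have "continuous_on S (\<lambda>x. C * coord_sqnorm X c (V x))"
      unfolding coord_sqnorm_def by (intro continuous_intros Vc) auto
    then have "((\<lambda>x. C * coord_sqnorm X c (V x)) \<longlongrightarrow> C * coord_sqnorm X c (V x0)) (at x0 within S)"
      using x0 by (simp add: continuous_on)
    then have lim: "((\<lambda>x. C * coord_sqnorm X c (V x)) \<longlongrightarrow> 0) (at x0 within S)"
      by (simp add: True coord_sqnorm_def)
    have "\<forall>\<^sub>F x in at x0 within S. norm (?h x) \<le> C * coord_sqnorm X c (V x)"
      unfolding eventually_at_filter
      using pos C q V coord_sqnorm_nonneg[of X c] by (intro always_eventually) (auto simp: abs_of_pos less_imp_le)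
    from Lim_null_comparison[OF this lim] show ?thesis by (simp add: True)
  next
    case False
    then obtain i where i: "i < mdim X" "V x0 (c, i) \<noteq> 0"
      using tangent_nonzero_component[OF X c q(1)[OF x0] V[OF x0]] by blast
    define S' where "S' = S \<inter> (\<lambda>x. V x (c, i)) -` (- {0})"
    have "openin (top_of_set S) S'"
      unfolding S'_def by (rule continuous_openin_preimage_gen[OF Vc[OF i(1)]]) auto
    then obtain T where T: "open T" "S' = S \<inter> T" by (auto simp: openin_open)
    have x0': "x0 \<in> S'" using x0 i by (simp add: S'_def)
    have S'S: "S' \<subseteq> S" by (auto simp: S'_def)
    have nz: "V x (c, i) \<noteq> 0" if "x \<in> S'" for x using that by (simp add: S'_def)
    have vc: "continuous_on S' (\<lambda>x. vec_coord X c i (q x) (V x))"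
      using qc Vc S'S nz i(1) by (intro vec_coord_continuous) (auto intro: continuous_on_subset)
    have "continuous_on S' (\<lambda>x. (norm (V x (c, i)))\<^sup>2 * exp (log_norm X K c i (vec_coord X c i (q x) (V x))))"
    proof (intro continuous_intros)
      show "continuous_on S' (\<lambda>x. V x (c, i))" using Vc[OF i(1)] S'S by (rule continuous_on_subset)
      show "continuous_on S' (\<lambda>x. log_norm X K c i (vec_coord X c i (q x) (V x)))"
      proof (rule continuous_on_compose2[OF log_norm_continuous[OF K c i(1)] vc])
        show "(\<lambda>x. vec_coord X c i (q x) (V x)) ` S' \<subseteq> PT_region X c"
          using vec_coord_in[OF X c i(1) q(1) V nz] S'S by blast
      qed
    qed
    moreover have "(norm (V x (c, i)))\<^sup>2 * exp (log_norm X K c i (vec_coord X c i (q x) (V x))) = ?h x" if "x \<in> S'" for x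
    proof -
      have "V x \<noteq> (\<lambda>s. 0)" using nz[OF that] by auto
      then show ?thesis
        using finsler_coord[OF X K c i(1) q(1) V nz, of x] that S'S by auto
    qed
    ultimately have "continuous_on S' ?h" by (rule continuous_on_eq)
    then have "(?h \<longlongrightarrow> ?h x0) (at x0 within S')" using x0' by (simp add: continuous_on)
    moreover have "at x0 within S' = at x0 within S"
      by (rule at_within_nhd[of _ T]) (use T x0' in auto)
    ultimately show ?thesis by simp
  qed
qed

lemma levi_scale: "levi n g v (\<lambda>k. of_real s * b k) = s\<^sup>2 * levi n g v b"
proof -
  have "(\<Sum>l<n. \<Sum>j<n. dz l (dzbar j (\<lambda>v. complex_of_real (g v))) v * (of_real s * b l) * cnj (of_real s * b j)) =
    of_real (s\<^sup>2) * (\<Sum>l<n. \<Sum>j<n. dz l (dzbar j (\<lambda>v. complex_of_real (g v))) v * b l * cnj (b j))"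
    unfolding sum_distrib_left by (intro sum.cong) (auto simp: power2_eq_square mult_ac)
  then show ?thesis unfolding levi_def by simp
qed

lemma levi_continuous:
  assumes U: "openin (top_of_set (Cspace n)) U" and g: "Ck_on n (Suc (Suc 0)) U (\<lambda>v. complex_of_real (g v))"
  shows "continuous_on U (\<lambda>v. levi n g v b)"
proof -
  have "continuous_on U (\<lambda>v. dz l (dzbar j (\<lambda>v. complex_of_real (g v))) v)" if "l < n" "j < n" for l j
    using Ck_on_dz_dzbar(1)[OF U Ck_on_dz_dzbar(2)[OF U g that(2)] that(1)] by simp
  then show ?thesis
    unfolding levi_def by (intro continuous_intros) auto
qed

text \<open>A direction that is negative at \<open>v\<close> keeps half of its value on a
  neighbourhood of \<open>v\<close>, and finitely many neighbourhoods cover \<open>D\<close>. The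
  directions are first scaled to have components of modulus at most 1, since a bound on the value
  means nothing without one on the direction.\<close>

lemma levi_uniformly_negative:
  assumes U: "openin (top_of_set (Cspace n)) U" and g: "Ck_on n (Suc (Suc 0)) U (\<lambda>v. complex_of_real (g v))"
    and D: "compact D" "D \<subseteq> U" and neg: "\<And>v. v \<in> D \<Longrightarrow> \<exists>b\<in>Cspace n. levi n g v b < 0"
  obtains C where "C > 0" "\<And>v. v \<in> D \<Longrightarrow> \<exists>b\<in>Cspace n. (\<forall>j. norm (b j) \<le> 1) \<and> levi n g v b \<le> - (1 / C)"
proof -
  have "\<exists>b\<in>Cspace n. (\<forall>j. norm (b j) \<le> 1) \<and> levi n g v b < 0" if v: "v \<in> D" for v
  proof -
    obtain b where b: "b \<in> Cspace n" "levi n g v b < 0" using neg[OF v] by blast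
    obtain K where K: "K > 0" "\<forall>j<n. norm (b j) \<le> K" using ex_uniform_bound by blast
    let ?b = "\<lambda>k. complex_of_real (1 / K) * b k"
    have "norm (?b j) \<le> 1" for j
      using K b(1) by (cases "j < n") (auto simp: norm_divide Cspace_def)
    moreover have "levi n g v ?b < 0" unfolding levi_scale using b K by (simp add: mult_pos_neg)
    moreover have "?b \<in> Cspace n" using b by (auto simp: Cspace_def)
    ultimately show ?thesis by (intro bexI[of _ ?b] conjI allI)
  qed
  then obtain b where b: "\<And>v. v \<in> D \<Longrightarrow> b v \<in> Cspace n" "\<And>v j. v \<in> D \<Longrightarrow> norm (b v j) \<le> 1"
    "\<And>v. v \<in> D \<Longrightarrow> levi n g v (b v) < 0" by metis
  define N where "N v = D \<inter> (\<lambda>w. levi n g w (b v)) -` {..<levi n g v (b v) / 2}" for v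
  have Nop: "openin (top_of_set D) (N v)" for v
    unfolding N_def
    by (rule continuous_openin_preimage_gen[OF continuous_on_subset[OF levi_continuous[OF U g] D(2)]]) auto
  have "D \<subseteq> \<Union> (N ` D)" using b(3) by (fastforce simp: N_def)
  then obtain F where F: "finite F" "F \<subseteq> N ` D" "D \<subseteq> \<Union> F"
    using D(1)[unfolded compact_eq_openin_cover] Nop by (metis (no_types, lifting) imageE)
  then obtain E where E: "finite E" "E \<subseteq> D" "F = N ` E" by (metis finite_subset_image)
  have "\<exists>C. \<forall>C'\<ge>C. C' > 0 \<and> levi n g v (b v) / 2 \<le> - (1 / C')" if "v \<in> E" for v
  proof -
    have neg: "levi n g v (b v) < 0" using b(3) that E by auto
    have "C' > 0 \<and> levi n g v (b v) / 2 \<le> - (1 / C')" if C': "C' \<ge> 2 / (- levi n g v (b v))" for C'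
    proof -
      have 0: "2 / (- levi n g v (b v)) > 0" using neg by simp
      then have "C' > 0" using C' by linarith
      then have "1 / C' \<le> 1 / (2 / (- levi n g v (b v)))" using C' 0 \<open>C' > 0\<close> by (intro divide_left_mono mult_pos_pos) auto
      then show ?thesis using \<open>C' > 0\<close> by simp
    qed
    then show ?thesis by blast
  qed
  from finite_uniform[of E "\<lambda>v C'. C' > 0 \<and> levi n g v (b v) / 2 \<le> - (1 / C')", OF E(1) this]
  obtain C where C: "C > 0" "\<And>v. v \<in> E \<Longrightarrow> levi n g v (b v) / 2 \<le> - (1 / C)" by blast
  show ?thesis
  proof (rule that[OF C(1)])
    fix w assume "w \<in> D"
    then obtain v where v: "v \<in> E" "w \<in> N v" using F E by auto
    then have "levi n g w (b v) \<le> - (1 / C)" using C(2)[OF v(1)] by (auto simp: N_def)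
    then show "\<exists>b\<in>Cspace n. (\<forall>j. norm (b j) \<le> 1) \<and> levi n g w b \<le> - (1 / C)"
      using b v E by blast
  qed
qed

text \<open>Each mixed product is at most the mean of two squares, and every square then occurs
  \<open>n\<close> times.\<close>

lemma hermitian_form_bound:
  fixes \<Omega> :: "nat \<Rightarrow> nat \<Rightarrow> complex"
  assumes "\<And>l j. l < n \<Longrightarrow> j < n \<Longrightarrow> norm (\<Omega> l j) \<le> B"
  shows "Re (\<Sum>l<n. \<Sum>j<n. \<Omega> l j * a l * cnj (a j)) \<le> B * n * (\<Sum>l<n. (norm (a l))\<^sup>2)"
proof -
  have "Re (\<Omega> l j * a l * cnj (a j)) \<le> B * (((norm (a l))\<^sup>2 + (norm (a j))\<^sup>2) / 2)" if "l < n" "j < n" for l j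
  proof -
    have B: "B \<ge> 0" using assms[OF that] norm_ge_zero[of "\<Omega> l j"] by linarith
    have "Re (\<Omega> l j * a l * cnj (a j)) \<le> norm (\<Omega> l j) * (norm (a l) * norm (a j))"
      by (rule order_trans[OF complex_Re_le_cmod]) (simp add: norm_mult)
    also have "\<dots> \<le> B * (norm (a l) * norm (a j))"
      using assms[OF that] by (intro mult_right_mono) auto
    also have "norm (a l) * norm (a j) \<le> ((norm (a l))\<^sup>2 + (norm (a j))\<^sup>2) / 2"
      using sum_squares_bound[of "norm (a l)" "norm (a j)"] by simp
    finally show ?thesis using B by (simp add: mult_left_mono)
  qed
  then have "Re (\<Sum>l<n. \<Sum>j<n. \<Omega> l j * a l * cnj (a j)) \<le> (\<Sum>l<n. \<Sum>j<n. B * (((norm (a l))\<^sup>2 + (norm (a j))\<^sup>2) / 2))"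
    unfolding Re_sum by (intro sum_mono) auto
  also have "\<dots> = B * n * (\<Sum>l<n. (norm (a l))\<^sup>2)"
    by (simp add: sum_distrib_left[symmetric] sum_divide_distrib[symmetric] sum.distrib)
  finally show ?thesis .
qed

section \<open>The maximum principle on the projectivized tangent bundle\<close>

text \<open>The whole closed ball goes into a single chart \<open>c'\<close> of the target, so that
  the coordinate length of image vectors is defined on all of it.\<close>

definition adapted_ball :: "'a cmanifold \<Rightarrow> 'b cmanifold \<Rightarrow> ('a \<Rightarrow> 'b) \<Rightarrow> 'a chart \<times> 'b chart \<times> cvec \<times> real \<Rightarrow> bool" where
  "adapted_ball M N f = (\<lambda>(c, c', a, \<rho>). c \<in> atlas M \<and> c' \<in> atlas N \<and> \<rho> > 0 \<and>
     cball_Cspace (mdim M) a \<rho> \<subseteq> snd c ` {p \<in> fst c. f p \<in> fst c'})"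

definition coord_map :: "('a \<Rightarrow> 'b) \<Rightarrow> 'a chart \<Rightarrow> 'b chart \<Rightarrow> cvec \<Rightarrow> cvec" where
  "coord_map f c c' z = snd c' (f (chart_inv c z))"

text \<open>Zero on the boundary of the ball, so that a positive maximum of the quotient is attained
  over an interior point.\<close>

definition cutoff :: "nat \<Rightarrow> cvec \<Rightarrow> real \<Rightarrow> cvec \<Rightarrow> real" where
  "cutoff n a \<rho> z = \<rho> - (\<Sum>j<n. (norm (z j - a j))\<^sup>2)"

text \<open>\<open>finsler\<close> leaves the value at the zero vector open; 0 is the continuous one
  by \<open>finsler_continuous\<close>.\<close>

definition extend0 :: "('a \<Rightarrow> 'a tvec \<Rightarrow> real) \<Rightarrow> 'a \<Rightarrow> 'a tvec \<Rightarrow> real" where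
  "extend0 K q V = (if V = (\<lambda>s. 0) then 0 else K q V)"

text \<open>\<open>K\<^sup>k S\<^sup>A / H\<^sup>k\<^sup>+\<^sup>A\<close>, where \<open>K\<close> and \<open>S\<close> are squared lengths of the image vector and \<open>H\<close> is the squared
  length of the vector itself. The perturbation \<open>S\<^sup>A\<close> absorbs the derivatives of the direction of
  the image vector, which are not bounded near the zeros of the differential.\<close>

definition ratio :: "'a cmanifold \<Rightarrow> 'b cmanifold \<Rightarrow> ('a \<Rightarrow> 'b) \<Rightarrow> ('b \<Rightarrow> 'b tvec \<Rightarrow> real) \<Rightarrow>
    ('a \<Rightarrow> 'a tvec \<Rightarrow> real) \<Rightarrow> nat \<Rightarrow> nat \<Rightarrow> 'a chart \<times> 'b chart \<times> cvec \<times> real \<Rightarrow> 'a \<Rightarrow> 'a tvec \<Rightarrow> real" where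
  "ratio M N f K H k A = (\<lambda>(c, c', a, \<rho>) p W.
     extend0 K (f p) (push M N f p W) ^ k *
     (cutoff (mdim M) a \<rho> (snd c p) * coord_sqnorm N c' (push M N f p W)) ^ A / H p W ^ (k + A))"

lemma push_scale:
  "push M N f p (\<lambda>s. a * W s) = (\<lambda>s. a * push M N f p W s)"
  by (auto simp: push_def fun_eq_iff Let_def sum_distrib_left mult.left_commute)

lemma coord_sqnorm_scale: "coord_sqnorm X c (\<lambda>s. a * W s) = (norm a)\<^sup>2 * coord_sqnorm X c W"
  by (simp add: coord_sqnorm_def norm_mult power_mult_distrib sum_distrib_left)

lemma finslerD:
  assumes "finsler X K" "p \<in> topspace (mtop X)" "W \<in> tangent_space X p" "W \<noteq> (\<lambda>s. 0)"
  shows "K p W > 0" "a \<noteq> 0 \<Longrightarrow> K p (\<lambda>s. a * W s) = (norm a)\<^sup>2 * K p W"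
  using assms unfolding finsler_def by blast+

text \<open>Numerator and denominator both have degree \<open>k + A\<close> in the squared modulus
  of \<open>a\<close>, so the quotient is a function on the projectivized tangent bundle.\<close>

lemma ratio_scale:
  assumes M: "complex_manifold M" and N: "complex_manifold N" and f: "holomorphic_map M N f"
    and K: "finsler N K" and H: "finsler M H"
    and p: "p \<in> topspace (mtop M)" and W: "W \<in> tangent_space M p" "W \<noteq> (\<lambda>s. 0)" and a: "a \<noteq> 0"
  shows "ratio M N f K H k A \<kappa> p (\<lambda>s. a * W s) = ratio M N f K H k A \<kappa> p W"
proof -
  obtain c c' a' \<rho> where \<kappa>: "\<kappa> = (c, c', a', \<rho>)" by (cases \<kappa>)
  let ?V = "push M N f p W"
  have fp: "f p \<in> topspace (mtop N)"
    using f p unfolding holomorphic_map_def continuous_map_def by auto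
  have VT: "?V \<in> tangent_space N (f p)" by (rule push_tangent[OF M N f W(1) p])
  have eq: "(\<lambda>s. a * ?V s) = (\<lambda>s. 0) \<longleftrightarrow> ?V = (\<lambda>s. 0)" using a by (auto simp: fun_eq_iff)
  have "extend0 K (f p) (\<lambda>s. a * ?V s) = (norm a)\<^sup>2 * extend0 K (f p) ?V"
    unfolding extend0_def eq using finslerD(2)[OF K fp VT _ a] by simp
  moreover have "H p (\<lambda>s. a * W s) = (norm a)\<^sup>2 * H p W" by (rule finslerD(2)[OF H p W a])
  moreover have "(x * y) ^ k * (u * (x * w)) ^ A / (x * z) ^ (k + A) = y ^ k * (u * w) ^ A / z ^ (k + A)"
    if "x \<noteq> 0" for x y z u w :: real
    using that by (simp add: power_mult_distrib power_add field_simps)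
  ultimately show ?thesis
    using a by (simp add: \<kappa> ratio_def push_scale coord_sqnorm_scale)
qed

lemma hom_coord_continuous: "continuous_on S (\<lambda>v. hom_coord n i v l)"
  unfolding hom_coord_def by (cases "l = i") (auto intro: continuous_on_cvec_apply)

context
  fixes M :: "'a cmanifold" and N :: "'b cmanifold" and f :: "'a \<Rightarrow> 'b" and c c' a \<rho>
  assumes M: "complex_manifold M" and N: "complex_manifold N" and f: "holomorphic_map M N f"
    and ball: "adapted_ball M N f (c, c', a, \<rho>)"
begin

lemma ball_charts: "c \<in> atlas M" "c' \<in> atlas N" "\<rho> > 0"
  using ball by (auto simp: adapted_ball_def)

lemma ball_subset: "cball_Cspace (mdim M) a \<rho> \<subseteq> snd c ` {p \<in> fst c. f p \<in> fst c'}"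
  using ball by (auto simp: adapted_ball_def)

lemma ball_subset_chart: "cball_Cspace (mdim M) a \<rho> \<subseteq> snd c ` fst c"
  using ball_subset by auto

lemma coord_map_in: "z \<in> snd c ` {p \<in> fst c. f p \<in> fst c'} \<Longrightarrow> f (chart_inv c z) \<in> fst c'"
  using chart_inv_apply[OF M ball_charts(1)] by auto

lemma coord_map_Cspace: "z \<in> snd c ` {p \<in> fst c. f p \<in> fst c'} \<Longrightarrow> coord_map f c c' z \<in> Cspace (mdim N)"
  unfolding coord_map_def using chart_Cspace[OF N ball_charts(2)] coord_map_in by blast

lemma coord_map_holo:
  "j < mdim N \<Longrightarrow> holo_on (mdim M) (snd c ` {p \<in> fst c. f p \<in> fst c'}) (\<lambda>z. coord_map f c c' z j)"
  unfolding coord_map_def by (rule holo_component[OF M N f ball_charts(1,2)])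

lemma coord_map_continuous: "continuous_on (snd c ` {p \<in> fst c. f p \<in> fst c'}) (coord_map f c c')"
proof (rule continuous_on_cvec)
  fix j
  show "continuous_on (snd c ` {p \<in> fst c. f p \<in> fst c'}) (\<lambda>z. coord_map f c c' z j)"
  proof (cases "j < mdim N")
    case True
    then show ?thesis using Ck_on_imp_continuous_on[OF holo_on_Ck_on[OF coord_map_holo[OF True], of 0]] by simp
  next
    case False
    then have "coord_map f c c' z j = 0" if "z \<in> snd c ` {p \<in> fst c. f p \<in> fst c'}" for z
      using coord_map_Cspace[OF that] by (simp add: Cspace_def)
    then show ?thesis by (simp cong: continuous_on_cong)
  qed
qed

lemma compact_coord_map_ball: "compact (coord_map f c c' ` cball_Cspace (mdim M) a \<rho>)"
  by (rule compact_continuous_image[OF continuous_on_subset[OF coord_map_continuous ball_subset] compact_cball_Cspace])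

lemma coord_map_ball_subset: "coord_map f c c' ` cball_Cspace (mdim M) a \<rho> \<subseteq> snd c' ` fst c'"
  using ball_subset coord_map_in unfolding coord_map_def by blast

lemma dz_coord_map_continuous:
  "j < mdim N \<Longrightarrow> l < mdim M \<Longrightarrow>
    continuous_on (snd c ` {p \<in> fst c. f p \<in> fst c'}) (dz l (\<lambda>z. coord_map f c c' z j))"
  using Ck_on_dz_dzbar(1)[OF overlap_image_open[OF M N f ball_charts(1,2)] holo_on_Ck_on[OF coord_map_holo, of j "Suc 0"], of l]
  by simp

lemma push_coord:
  assumes "p \<in> fst c" "f p \<in> fst c'" "W \<in> tangent_space M p" "j < mdim N"
  shows "push M N f p W (c', j) = (\<Sum>l<mdim M. dz l (\<lambda>z. coord_map f c c' z j) (snd c p) * W (c, l))"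
  unfolding push_apply[OF M N f assms(3) ball_charts(1) assms(1) ball_charts(2) assms(2,4)] dmat_def coord_map_def ..

lemma PT_base_coord: "v \<in> PT_region M c \<Longrightarrow> snd c (PT_base M c v) = base_coord (mdim M) v"
  unfolding PT_base_def by (rule chart_apply_inv[OF M ball_charts(1)]) (simp add: PT_region_def)

lemma PT_compact_ball:
  assumes "v \<in> PT_compact (mdim M) (cball_Cspace (mdim M) a \<rho>)"
  shows "v \<in> PT_region M c" "base_coord (mdim M) v \<in> cball_Cspace (mdim M) a \<rho>"
    "base_coord (mdim M) v \<in> snd c ` {p \<in> fst c. f p \<in> fst c'}"
  using assms PT_compact_subset[OF ball_subset_chart] ball_subset by (auto simp: PT_compact_def)

context
  fixes i assumes i: "i < mdim M"
begin

text \<open>The image vector in terms of the coordinates \<open>v\<close>: derivatives of the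
  coordinate map at the base part times homogeneous coordinates. Both factors are continuous in
  \<open>v\<close> and holomorphic along complex lines.\<close>

lemma PT_push_coord:
  assumes v: "v \<in> PT_region M c" "base_coord (mdim M) v \<in> snd c ` {p \<in> fst c. f p \<in> fst c'}"
  shows "f (PT_base M c v) \<in> fst c'"
    and "snd c' (f (PT_base M c v)) = coord_map f c c' (base_coord (mdim M) v)"
    and "j < mdim N \<Longrightarrow> push M N f (PT_base M c v) (PT_vec M c i v) (c', j) =
      (\<Sum>l<mdim M. dz l (\<lambda>z. coord_map f c c' z j) (base_coord (mdim M) v) * hom_coord (mdim M) i v l)"
proof -
  show fp: "f (PT_base M c v) \<in> fst c'" unfolding PT_base_def by (rule coord_map_in[OF v(2)])
  show "snd c' (f (PT_base M c v)) = coord_map f c c' (base_coord (mdim M) v)"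
    by (simp add: PT_base_def coord_map_def)
  assume j: "j < mdim N"
  have "push M N f (PT_base M c v) (PT_vec M c i v) (c', j) =
      (\<Sum>l<mdim M. dz l (\<lambda>z. coord_map f c c' z j) (snd c (PT_base M c v)) * PT_vec M c i v (c, l))"
    by (rule push_coord[OF PT_base_in[OF M ball_charts(1) v(1)] fp PT_vec_tangent[OF M ball_charts(1) i v(1)] j])
  also have "\<dots> = (\<Sum>l<mdim M. dz l (\<lambda>z. coord_map f c c' z j) (base_coord (mdim M) v) * hom_coord (mdim M) i v l)"
    unfolding PT_base_coord[OF v(1)]
    by (intro sum.cong refl) (simp add: PT_vec_apply[OF M ball_charts(1) i v(1)])
  finally show "push M N f (PT_base M c v) (PT_vec M c i v) (c', j) =
      (\<Sum>l<mdim M. dz l (\<lambda>z. coord_map f c c' z j) (base_coord (mdim M) v) * hom_coord (mdim M) i v l)" .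
qed

lemma ratio_continuous:
  assumes K: "finsler N K" and H: "finsler M H"
  shows "continuous_on (PT_compact (mdim M) (cball_Cspace (mdim M) a \<rho>))
    (\<lambda>v. ratio M N f K H k A (c, c', a, \<rho>) (PT_base M c v) (PT_vec M c i v))"
proof -
  let ?D = "PT_compact (mdim M) (cball_Cspace (mdim M) a \<rho>)"
  let ?V = "\<lambda>v. push M N f (PT_base M c v) (PT_vec M c i v)"
  note D = PT_compact_ball
  have top: "PT_base M c v \<in> topspace (mtop M)" if "v \<in> ?D" for v
    using PT_base_in[OF M ball_charts(1) D(1)[OF that]] chart_dom_subset[OF M ball_charts(1)] by blast
  have bc: "continuous_on ?D (\<lambda>v. h (base_coord (mdim M) v))"
    if "continuous_on (snd c ` {p \<in> fst c. f p \<in> fst c'}) h" for h :: "cvec \<Rightarrow> complex"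
    by (rule continuous_on_compose2[OF that base_coord_continuous]) (use D(3) in auto)
  have Vc: "continuous_on ?D (\<lambda>v. ?V v (c', j))" if j: "j < mdim N" for j
  proof -
    have "continuous_on ?D (\<lambda>v. \<Sum>l<mdim M. dz l (\<lambda>z. coord_map f c c' z j) (base_coord (mdim M) v) * hom_coord (mdim M) i v l)"
      using dz_coord_map_continuous[OF j] by (intro continuous_intros hom_coord_continuous bc) auto
    then show ?thesis
      by (rule continuous_on_eq) (simp add: PT_push_coord(3)[OF D(1,3) j])
  qed
  have 1: "continuous_on ?D (\<lambda>v. extend0 K (f (PT_base M c v)) (?V v))"
    unfolding extend0_def
  proof (rule finsler_continuous[where V = ?V and q = "\<lambda>v. f (PT_base M c v)", OF N K ball_charts(2) compact_coord_map_ball coord_map_ball_subset])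
    fix v assume v: "v \<in> ?D"
    show "f (PT_base M c v) \<in> fst c'" by (rule PT_push_coord(1)[OF D(1,3)[OF v]])
    show "snd c' (f (PT_base M c v)) \<in> coord_map f c c' ` cball_Cspace (mdim M) a \<rho>"
      unfolding PT_push_coord(2)[OF D(1,3)[OF v]] using D(2)[OF v] by blast
    show "?V v \<in> tangent_space N (f (PT_base M c v))"
      by (rule push_tangent[OF M N f PT_vec_tangent[OF M ball_charts(1) i D(1)[OF v]] top[OF v]])
  next
    fix j assume j: "j < mdim N"
    show "continuous_on ?D (\<lambda>v. ?V v (c', j))" by (rule Vc[OF j])
    have "continuous_on ?D (\<lambda>v. coord_map f c c' (base_coord (mdim M) v) j)"
      using bc[of "\<lambda>z. coord_map f c c' z j"] continuous_on_product_then_coordinatewise[OF coord_map_continuous] by blast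
    then show "continuous_on ?D (\<lambda>v. snd c' (f (PT_base M c v)) j)"
      by (rule continuous_on_eq) (simp add: PT_push_coord(2)[OF D(1,3)])
  qed
  have "continuous_on ?D (\<lambda>v. cutoff (mdim M) a \<rho> (base_coord (mdim M) v))"
    unfolding cutoff_def
    by (intro continuous_intros continuous_on_compose2[OF continuous_on_cvec_apply base_coord_continuous]) auto
  then have 2: "continuous_on ?D (\<lambda>v. cutoff (mdim M) a \<rho> (snd c (PT_base M c v)))"
    by (rule continuous_on_eq) (simp add: PT_base_coord D(1))
  have 3: "continuous_on ?D (\<lambda>v. coord_sqnorm N c' (?V v))"
    unfolding coord_sqnorm_def by (intro continuous_intros Vc) auto
  have Hpos: "H (PT_base M c v) (PT_vec M c i v) > 0" if v: "v \<in> ?D" for v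
    using PT_vec_apply_self[OF M ball_charts(1) i D(1)[OF v]]
    by (intro finslerD(1)[OF H top[OF v] PT_vec_tangent[OF M ball_charts(1) i D(1)[OF v]]]) auto
  have "continuous_on ?D (\<lambda>v. exp (log_norm M H c i v))"
    using log_norm_continuous[OF H ball_charts(1) i] PT_compact_subset[OF ball_subset_chart]
    by (intro continuous_on_exp) (rule continuous_on_subset)
  then have 4: "continuous_on ?D (\<lambda>v. H (PT_base M c v) (PT_vec M c i v))"
    by (rule continuous_on_eq) (simp add: log_norm_def Hpos)
  have "H (PT_base M c v) (PT_vec M c i v) ^ (k + A) \<noteq> 0" if "v \<in> ?D" for v
    using Hpos[OF that] by simp
  then show ?thesis
    unfolding ratio_def prod.case by (intro continuous_intros 1 2 3 4) auto
qed

lemma ratio_vec_coord: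
  assumes K: "finsler N K" and H: "finsler M H"
    and p: "p \<in> fst c" and W: "W \<in> tangent_space M p" "W (c, i) \<noteq> 0"
  shows "ratio M N f K H k A \<kappa> (PT_base M c (vec_coord M c i p W)) (PT_vec M c i (vec_coord M c i p W)) =
    ratio M N f K H k A \<kappa> p W"
proof -
  have "(\<lambda>s. W s / W (c, i)) = (\<lambda>s. inverse (W (c, i)) * W s)"
    by (simp add: divide_inverse mult.commute)
  moreover have "p \<in> topspace (mtop M)" using p chart_dom_subset[OF M ball_charts(1)] by blast
  moreover have "W \<noteq> (\<lambda>s. 0)" using W(2) by auto
  ultimately show ?thesis
    unfolding PT_base_vec_coord[OF M ball_charts(1) i p W] PT_vec_vec_coord[OF M ball_charts(1) i p W]
    using ratio_scale[OF M N f K H _ W(1), of "inverse (W (c, i))"] W(2) by simp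
qed

end

end

section \<open>The Laplacian of the logarithm of the quotient\<close>

lemma skip_index_bij:
  assumes "i < m"
  shows "bij_betw (\<lambda>k. skip_index i (k - m)) {m..<2 * m - 1} ({..<m} - {i})"
  by (rule bij_betw_byWitness[where f' = "\<lambda>j. m + (if j < i then j else j - 1)"])
    (use assms in \<open>auto simp: skip_index_def split: if_splits\<close>)

text \<open>Splits the coordinate length into a factor with harmonic logarithm and the exponential
  of the Fubini--Study potential of the fibre coordinates.\<close>

lemma coord_sqnorm_vec_coord:
  assumes "i < mdim X" "V (c, i) \<noteq> 0"
  shows "coord_sqnorm X c V = (norm (V (c, i)))\<^sup>2 *
    (1 + (\<Sum>k\<in>{mdim X..<2 * mdim X - 1}. (norm (vec_coord X c i q V k))\<^sup>2))"
proof -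
  let ?m = "mdim X"
  have "(\<Sum>k\<in>{?m..<2 * ?m - 1}. (norm (vec_coord X c i q V k))\<^sup>2) =
    (\<Sum>k\<in>{?m..<2 * ?m - 1}. (norm (V (c, skip_index i (k - ?m)) / V (c, i)))\<^sup>2)"
    by (intro sum.cong) (auto simp: vec_coord_def)
  also have "\<dots> = (\<Sum>j\<in>{..<?m} - {i}. (norm (V (c, j) / V (c, i)))\<^sup>2)"
    by (rule sum.reindex_bij_betw[OF skip_index_bij[OF assms(1)]])
  also have "(norm (V (c, i)))\<^sup>2 * (1 + \<dots>) = (norm (V (c, i)))\<^sup>2 + (\<Sum>j\<in>{..<?m} - {i}. (norm (V (c, j)))\<^sup>2)"
    using assms(2) by (simp add: distrib_left sum_distrib_left norm_divide power_divide)
  also have "\<dots> = coord_sqnorm X c V"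
    unfolding coord_sqnorm_def using assms(1) by (simp add: sum.remove[of "{..<?m}" i])
  finally show ?thesis by simp
qed

lemma eventually_at_right_downward:
  assumes "r0 > (0::real)" "\<And>r. 0 < r \<Longrightarrow> r \<le> r0 \<Longrightarrow> P r"
  shows "\<forall>\<^sub>F r in at_right 0. P r"
  unfolding eventually_at_right_field using assms by (intro exI[of _ r0]) auto

text \<open>The only unfavourable term of the perturbation. By Cauchy--Schwarz its first-order part
  is controlled by the squared distance from the centre, which is at most \<rho>. The bound
  degenerates as the cutoff tends to 0.\<close>

lemma laplacian_at0_cutoff:
  assumes "b \<in> Cspace n" and q: "cutoff n a \<rho> z > 0"
  obtains L where "laplacian_at0 (\<lambda>t. ln (cutoff n a \<rho> (cline z b t))) L"
    "L \<ge> - 4 * (\<Sum>j<n. (norm (b j))\<^sup>2) * (1 / cutoff n a \<rho> z + \<rho> / (cutoff n a \<rho> z)\<^sup>2)"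
proof -
  let ?V = "\<lambda>j t. cline z b t j - a j"
  define q where "q = cutoff n a \<rho> z"
  define E where "E = (\<Sum>j<n. (norm (b j))\<^sup>2)"
  define S where "S = (\<Sum>j<n. b j * cnj (z j - a j))"
  have d: "(?V j has_field_derivative b j) (at t)" for j t
    unfolding cline_def by (auto intro!: derivative_eq_intros)
  have "?V j holomorphic_on ball 0 1" for j
    using d by (metis field_differentiable_at_within field_differentiable_def holomorphic_on_def)
  moreover have "deriv (?V j) 0 = b j" for j using d by (rule DERIV_imp_deriv)
  moreover have "\<rho> + - 1 * (\<Sum>j<n. (norm (?V j 0))\<^sup>2) = q" by (simp add: q_def cutoff_def)
  ultimately have L: "laplacian_at0 (\<lambda>t. ln (\<rho> + - 1 * (\<Sum>j<n. (norm (?V j t))\<^sup>2)))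
    (4 * - 1 * E / q - 4 * (- 1 * norm S)\<^sup>2 / q\<^sup>2)"
    using laplacian_at0_ln_norm[of 1 "{..<n}" ?V \<rho> "-1"] assms(2) by (simp add: q_def[symmetric] E_def S_def)
  have "(norm S)\<^sup>2 \<le> E * (\<Sum>j<n. (norm (z j - a j))\<^sup>2)"
    unfolding S_def E_def by (rule norm_sum_cnj_le)
  also have "\<dots> \<le> E * \<rho>"
    using q by (intro mult_left_mono) (auto simp: E_def cutoff_def sum_nonneg)
  finally have "4 * (norm S)\<^sup>2 / q\<^sup>2 \<le> 4 * (E * \<rho>) / q\<^sup>2" by (intro divide_right_mono) auto
  then have "4 * - 1 * E / q - 4 * (- 1 * norm S)\<^sup>2 / q\<^sup>2 \<ge> - 4 * E * (1 / q + \<rho> / q\<^sup>2)"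
    by (simp add: algebra_simps)
  then show ?thesis using that L unfolding q_def E_def by (simp add: cutoff_def)
qed

text \<open>Along a complex line through \<open>v\<close> the image lines form a holomorphic curve
  \<beta> in the projectivized tangent bundle of the target. There the logarithm of the quotient is
  a sum of potentials along curves, the logarithm of the cutoff, the Fubini--Study potential and
  harmonic terms. The point \<open>w\<close> is the position of \<beta> at 0, and \<beta>' is its
  velocity; the base part of the velocity is the differential applied to \<open>b\<close>, and the
  fibre part has no a priori bound.\<close>

lemma laplacian_ratio:
  fixes M :: "'a cmanifold" and N :: "'b cmanifold" and f :: "'a \<Rightarrow> 'b"
  assumes M: "complex_manifold M" and N: "complex_manifold N" and f: "holomorphic_map M N f"
    and ball: "adapted_ball M N f (c, c', a, \<rho>)" and i: "i < mdim M"
    and K: "finsler N K" and H: "finsler M H" and A: "A > 0"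
    and v: "v \<in> PT_compact (mdim M) (cball_Cspace (mdim M) a \<rho>)"
    and pos: "ratio M N f K H k A (c, c', a, \<rho>) (PT_base M c v) (PT_vec M c i v) > 0"
    and b: "b \<in> Cspace (2 * mdim M - 1)"
  defines "q \<equiv> cutoff (mdim M) a \<rho> (base_coord (mdim M) v)"
  obtains i' w \<beta>' L where "i' < mdim N" "w \<in> PT_compact (mdim N) (coord_map f c c' ` cball_Cspace (mdim M) a \<rho>)"
    "\<And>j. j < mdim N \<Longrightarrow> \<beta>' j = (\<Sum>l<mdim M. dz l (\<lambda>z. coord_map f c c' z j) (base_coord (mdim M) v) * b l)"
    "laplacian_at0 (\<lambda>t. ln (ratio M N f K H k A (c, c', a, \<rho>) (PT_base M c (cline v b t)) (PT_vec M c i (cline v b t)))) L"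
    "\<forall>\<^sub>F t in nhds 0. ratio M N f K H k A (c, c', a, \<rho>) (PT_base M c (cline v b t)) (PT_vec M c i (cline v b t)) > 0 \<and>
      cline v b t \<in> PT_region M c \<and> base_coord (mdim M) (cline v b t) \<in> cball_Cspace (mdim M) a \<rho>"
    "q > 0"
    "L \<ge> 4 * (k * levi (2 * mdim N - 1) (log_norm N K c' i') w \<beta>'
      + A * ((\<Sum>l\<in>{mdim N..<2 * mdim N - 1}. (norm (\<beta>' l))\<^sup>2) / (mdim N)\<^sup>2
             - (\<Sum>l<mdim M. (norm (b l))\<^sup>2) * (1 / q + \<rho> / q\<^sup>2))
      - (real k + real A) * levi (2 * mdim M - 1) (log_norm M H c i) v b)"
proof -
  note c = ball_charts(1)[OF M N f ball] and c' = ball_charts(2)[OF M N f ball]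
  define n m where "n = mdim M" and "m = mdim N"
  define B where "B = cball_Cspace n a \<rho>"
  define U where "U = snd c ` {p \<in> fst c. f p \<in> fst c'}"
  define F where "F = coord_map f c c'"
  define z0 b0 where "z0 = base_coord n v" and "b0 = base_coord n b"
  define z where "z t = cline z0 b0 t" for t
  define vt where "vt t = cline v b t" for t
  define p where "p t = PT_base M c (vt t)" for t
  define W where "W t = PT_vec M c i (vt t)" for t
  define V where "V t = push M N f (p t) (W t)" for t
  note vD = PT_compact_ball[OF M N f ball v, folded n_def U_def]
  have Uop: "openin (top_of_set (Cspace n)) U"
    unfolding U_def n_def by (rule overlap_image_open[OF M N f c c'])
  have Rop: "openin (top_of_set (Cspace (2 * n - 1))) (PT_region M c)"
    unfolding n_def by (rule PT_region_open[OF M c])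
  have b0C: "b0 \<in> Cspace n" by (simp add: b0_def base_coord_def Cspace_def)
  have z0U: "z0 \<in> U" using vD(3) by (simp add: z0_def)
  have base_vt: "base_coord n (vt t) = z t" for t
    by (simp add: vt_def z_def z0_def b0_def base_coord_def cline_def fun_eq_iff)
  have Fholo: "holo_on n U (\<lambda>z. F z j)" if "j < m" for j
    unfolding n_def U_def F_def using that unfolding m_def by (rule coord_map_holo[OF M N f ball])
  have F1: "Ck_on n (Suc 0) U (\<lambda>z. F z j)" if "j < m" for j by (rule holo_on_Ck_on[OF Fholo[OF that]])
  have Fbar: "dzbar l (\<lambda>z. F z j) w = 0" if "j < m" "l < n" "w \<in> U" for j l w
    by (rule holo_on_dzbar[OF Fholo]) (use that in auto)
  have v0: "vt 0 = v" "z 0 = z0" by (simp_all add: vt_def z_def)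
  obtain r1 where r1: "r1 > 0" "\<And>t. norm t \<le> r1 \<Longrightarrow> vt t \<in> PT_region M c"
    using cline_in_open[OF Rop vD(1) b[folded n_def]] unfolding vt_def by blast
  obtain r2 where r2: "r2 > 0" "\<And>t. norm t \<le> r2 \<Longrightarrow> z t \<in> U"
    using cline_in_open[OF Uop z0U b0C] unfolding z_def by blast
  \<comment> \<open>Each entry of the Jacobian matrix is holomorphic along the line with a radius of
    its own; the filter at 0 from the right intersects these finitely many discs.\<close>
  have ev: "\<forall>\<^sub>F r in at_right 0. \<forall>j\<in>{..<m}. \<forall>l\<in>{..<n}. (\<lambda>t. dz l (\<lambda>z. F z j) (z t)) holomorphic_on ball 0 r"
  proof (intro eventually_ball_finite ballI)
    fix j l assume "j \<in> {..<m}" "l \<in> {..<n}"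
    then have jl: "j < m" "l < n" by auto
    obtain r where "r > 0" "(\<lambda>t. dz l (\<lambda>z. F z j) (cline z0 b0 t)) holomorphic_on ball 0 r"
      using dz_holomorphic_on_cline[OF Uop F1[OF jl(1)] Fbar[OF jl(1)] z0U b0C jl(2)] by metis
    then show "\<forall>\<^sub>F r in at_right 0. (\<lambda>t. dz l (\<lambda>z. F z j) (z t)) holomorphic_on ball 0 r"
      unfolding z_def by (intro eventually_at_right_downward[of r])
        (auto intro: holomorphic_on_subset)
  qed auto
  have "\<forall>\<^sub>F r in at_right 0. 0 < r \<and> r \<le> min r1 r2"
    using r1 r2 by (intro eventually_at_right_downward[of "min r1 r2"]) auto
  with ev have "\<forall>\<^sub>F r in at_right 0. (\<forall>j\<in>{..<m}. \<forall>l\<in>{..<n}. (\<lambda>t. dz l (\<lambda>z. F z j) (z t)) holomorphic_on ball 0 r)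
    \<and> 0 < r \<and> r \<le> min r1 r2" by (rule eventually_conj)
  from eventually_happens'[OF trivial_limit_at_right_real this]
  obtain r3 where r3: "\<And>j l. j < m \<Longrightarrow> l < n \<Longrightarrow> (\<lambda>t. dz l (\<lambda>z. F z j) (z t)) holomorphic_on ball 0 r3"
    "0 < r3" "r3 \<le> r1" "r3 \<le> r2"
    by auto
  have vtR: "vt t \<in> PT_region M c" and zU: "z t \<in> U" if "t \<in> ball 0 r3" for t
    using that r1(2) r2(2) r3 by auto
  note push' = PT_push_coord[OF M N f ball i, folded n_def m_def U_def F_def]
  have fp: "f (p t) \<in> fst c'" and yF: "snd c' (f (p t)) = F (z t)" 
    and Vc: "\<And>j. j < m \<Longrightarrow> V t (c', j) = (\<Sum>l<n. dz l (\<lambda>z. F z j) (z t) * hom_coord n i (vt t) l)"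
    if t: "t \<in> ball 0 r3" for t
    using push'[OF vtR[OF t]] zU[OF t] unfolding base_vt p_def V_def W_def by blast+
  have pc: "p t \<in> fst c" and Wt: "W t \<in> tangent_space M (p t)" and Wi: "W t (c, i) = 1" if t: "t \<in> ball 0 r3" for t
    unfolding p_def W_def using PT_base_in[OF M c] PT_vec_tangent[OF M c i] PT_vec_apply_self[OF M c i] vtR[OF t] by auto
  have ptop: "p t \<in> topspace (mtop M)" if "t \<in> ball 0 r3" for t using pc[OF that] chart_dom_subset[OF M c] by blast
  have Vt: "V t \<in> tangent_space N (f (p t))" if "t \<in> ball 0 r3" for t
    unfolding V_def by (rule push_tangent[OF M N f Wt[OF that] ptop[OF that]])
  have zero: "(0::complex) \<in> ball 0 r3" using r3 by simp
  have homh: "(\<lambda>t. hom_coord n i (vt t) l) holomorphic_on S" for l S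
    unfolding hom_coord_def vt_def cline_def by (cases "l = i") (auto intro!: holomorphic_intros)
  have Vh: "(\<lambda>t. V t (c', j)) holomorphic_on ball 0 r3" if "j < m" for j
    by (rule holomorphic_transform[where f = "\<lambda>t. \<Sum>l<n. dz l (\<lambda>z. F z j) (z t) * hom_coord n i (vt t) l"])
      (use r3(1)[OF that] Vc that in \<open>auto intro!: holomorphic_intros homh\<close>)
  have Hp: "H (p t) (W t) > 0" if t: "t \<in> ball 0 r3" for t
    using Wi[OF t] by (intro finslerD(1)[OF H ptop[OF t] Wt[OF t]]) auto
  have r0: "ratio M N f K H k A (c, c', a, \<rho>) (p t) (W t) =
    extend0 K (f (p t)) (V t) ^ k * (cutoff n a \<rho> (z t) * coord_sqnorm N c' (V t)) ^ A / H (p t) (W t) ^ (k + A)"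
    if t: "t \<in> ball 0 r3" for t
  proof -
    have "snd c (p t) = z t"
      using PT_base_coord[OF M N f ball vtR[OF t]] base_vt[of t] by (simp add: p_def n_def)
    then show ?thesis by (simp add: ratio_def V_def n_def)
  qed
  have pos0: "ratio M N f K H k A (c, c', a, \<rho>) (p 0) (W 0) > 0"
    using pos by (simp add: p_def W_def v0)
  \<comment> \<open>A positive quotient forces both factors of the base of the \<open>A\<close>-th
    power to be nonzero. Here \<open>A > 0\<close> matters, because
    \<open>0 ^ 0 = 1\<close>.\<close>
  have V0: "V 0 \<noteq> (\<lambda>s. 0)" and q0: "q \<noteq> 0"
  proof -
    have "(cutoff n a \<rho> (z 0) * coord_sqnorm N c' (V 0)) ^ A \<noteq> 0"
      using pos0 unfolding r0[OF zero] by (metis div_0 less_irrefl mult_zero_right)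
    then have "cutoff n a \<rho> (z 0) \<noteq> 0" "coord_sqnorm N c' (V 0) \<noteq> 0"
      using A by (auto simp: zero_power)
    then show "V 0 \<noteq> (\<lambda>s. 0)" "q \<noteq> 0"
      by (auto simp: coord_sqnorm_def q_def v0 z0_def n_def)
  qed
  have q: "q > 0" using q0 vD(2) by (auto simp: q_def cutoff_def cball_Cspace_def n_def)
  \<comment> \<open>The chart of the target fibre is the one whose component is largest at
    \<open>t = 0\<close>. Then the fibre coordinates of \<open>w\<close> have modulus at most 1,
    which places \<open>w\<close> in the compact set and bounds the denominator of the Fubini--Study
    term.\<close>
  obtain i' where i': "i' < m" "V 0 (c', i') \<noteq> 0" "\<And>j. j < m \<Longrightarrow> norm (V 0 (c', j)) \<le> norm (V 0 (c', i'))"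
    using max_component[of m "\<lambda>j. V 0 (c', j)"] tangent_nonzero_component[OF N c' fp[OF zero] Vt[OF zero] V0]
    unfolding m_def by metis
  have "isCont (\<lambda>t. V t (c', i')) 0"
    using Vh[OF i'(1)] zero by (meson continuous_on_eq_continuous_at holomorphic_on_imp_continuous_on open_ball)
  then obtain r4 where r4: "r4 > 0" "\<And>t. dist 0 t < r4 \<Longrightarrow> V t (c', i') \<noteq> 0"
    using continuous_at_avoid[of 0 "\<lambda>t. V t (c', i')" 0] i'(2) by blast
  define r where "r = min r3 r4"
  have r: "r > 0" "ball 0 r \<subseteq> ball (0::complex) r3" using r3 r4 by (auto simp: r_def)
  have nz: "V t (c', i') \<noteq> 0" if "t \<in> ball 0 r" for t using r4(2) that by (simp add: r_def)
  define \<beta> where "\<beta> t = vec_coord N c' i' (f (p t)) (V t)" for t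
  have \<beta>R: "\<beta> t \<in> PT_region N c'" if t: "t \<in> ball 0 r" for t
    unfolding \<beta>_def using t r(2) by (intro vec_coord_in[OF N c' i'(1)[unfolded m_def] fp Vt nz]) auto
  have \<beta>1: "\<beta> t j = F (z t) j" if "j < m" "t \<in> ball 0 r" for j t
    using that yF[of t] r(2) by (auto simp: \<beta>_def vec_coord_def m_def)
  have zd: "((\<lambda>t. F (z t) j) has_field_derivative (\<Sum>l<n. dz l (\<lambda>z. F z j) (z t) * b0 l)) (at t)"
    if "j < m" "t \<in> ball 0 r3" for j t
    by (rule chain_rule_holo[OF Uop F1[OF that(1)]])
      (use zU[OF that(2)] Fbar[OF that(1)] cline_Cspace[OF _ b0C] cline_deriv z0U Uop openin_Cspace_subset in
        \<open>auto simp: z_def intro!: always_eventually\<close>)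
  have \<beta>h1: "(\<lambda>t. \<beta> t j) holomorphic_on ball 0 r" if "j < m" for j
  proof (rule holomorphic_transform[where f = "\<lambda>t. F (z t) j"])
    show "(\<lambda>t. F (z t) j) holomorphic_on ball 0 r"
      using zd[OF that] r(2) unfolding holomorphic_on_def field_differentiable_def
      by (meson has_field_derivative_at_within subsetD)
  qed (use \<beta>1[OF that] in auto)
  have \<beta>h2: "(\<lambda>t. \<beta> t j) holomorphic_on ball 0 r" if "m \<le> j" for j
  proof (cases "j < 2 * m - 1")
    case True
    then have "skip_index i' (j - m) < m" using that by (auto simp: skip_index_def)
    then have "(\<lambda>t. V t (c', skip_index i' (j - m)) / V t (c', i')) holomorphic_on ball 0 r"
      using Vh i'(1) r(2) nz by (intro holomorphic_on_divide) (auto intro: holomorphic_on_subset)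
    then show ?thesis using True that by (simp add: \<beta>_def vec_coord_def m_def)
  next
    case False
    then show ?thesis using that by (simp add: \<beta>_def vec_coord_def m_def)
  qed
  have \<beta>h: "(\<lambda>t. \<beta> t j) holomorphic_on ball 0 r" for j using \<beta>h1 \<beta>h2 by (cases "j < m") auto
  define \<beta>' where "\<beta>' j = deriv (\<lambda>t. \<beta> t j) 0" for j
  have \<beta>'1: "\<beta>' j = (\<Sum>l<n. dz l (\<lambda>z. F z j) z0 * b l)" if j: "j < m" for j
  proof -
    have "((\<lambda>t. \<beta> t j) has_field_derivative (\<Sum>l<n. dz l (\<lambda>z. F z j) (z 0) * b0 l)) (at 0)"
      by (rule has_field_derivative_transform_within_open[OF zd[OF j zero], of "ball 0 r"])
        (use r \<beta>1[OF j] in auto)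
    moreover have "(\<Sum>l<n. dz l (\<lambda>z. F z j) (z 0) * b0 l) = (\<Sum>l<n. dz l (\<lambda>z. F z j) z0 * b l)"
      unfolding v0 by (rule sum.cong) (simp_all add: b0_def base_coord_def)
    ultimately show ?thesis unfolding \<beta>'_def by (simp add: DERIV_imp_deriv)
  qed
  let ?J = "{m..<2 * m - 1}"
  have w: "\<beta> 0 \<in> PT_compact m (F ` B)"
    unfolding \<beta>_def m_def
    by (rule vec_coord_PT_compact[OF N c' i'(1)[unfolded m_def] fp[OF zero] _ Vt[OF zero] i'(2) i'(3)[unfolded m_def]])
      (use yF[OF zero] vD(2) in \<open>auto simp: v0 z0_def B_def\<close>)
  \<comment> \<open>There are \<open>m - 1\<close> fibre coordinates, each of modulus at most
    1.\<close>
  have N0: "1 + (\<Sum>l\<in>?J. (norm (\<beta> 0 l))\<^sup>2) \<le> m"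
  proof -
    have "(\<Sum>l\<in>?J. (norm (\<beta> 0 l))\<^sup>2) \<le> (\<Sum>l\<in>?J. 1)"
      using w unfolding PT_compact_def by (intro sum_mono) (simp add: power_le_one)
    then show ?thesis using i'(1) by (simp add: of_nat_diff)
  qed
  let ?V = "\<lambda>t. V t (c', i')"
  have L1: "laplacian_at0 (\<lambda>t. log_norm N K c' i' (\<beta> t)) (4 * levi (2 * m - 1) (log_norm N K c' i') (\<beta> 0) \<beta>')"
    unfolding levi_def \<beta>'_def
  proof (rule laplacian_at0_comp[OF _ _ r(1) \<beta>h \<beta>R])
    show "openin (top_of_set (Cspace (2 * m - 1))) (PT_region N c')"
      unfolding m_def by (rule PT_region_open[OF N c'])
    show "Ck_on (2 * m - 1) (Suc (Suc 0)) (PT_region N c') (\<lambda>v. complex_of_real (log_norm N K c' i' v))"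
      using K c' i'(1) unfolding finsler_def m_def by blast
  qed
  have L2: "laplacian_at0 (\<lambda>t. ln ((norm (?V t))\<^sup>2)) 0"
    by (rule laplacian_at0_ln_norm_single[OF r(1) holomorphic_on_subset[OF Vh[OF i'(1)] r(2)] i'(2)])
  have qz: "cutoff n a \<rho> z0 = q" by (simp add: q_def z0_def n_def)
  have sb: "(\<Sum>l<n. (norm (b0 l))\<^sup>2) = (\<Sum>l<n. (norm (b l))\<^sup>2)"
    by (rule sum.cong) (simp_all add: b0_def base_coord_def)
  obtain L3 where L3': "laplacian_at0 (\<lambda>t. ln (cutoff n a \<rho> (cline z0 b0 t))) L3"
    "L3 \<ge> - 4 * (\<Sum>l<n. (norm (b0 l))\<^sup>2) * (1 / cutoff n a \<rho> z0 + \<rho> / (cutoff n a \<rho> z0)\<^sup>2)"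
    by (rule laplacian_at0_cutoff[OF b0C]) (use q qz in auto)
  note L3 = L3'[folded z_def, unfolded sb qz]
  obtain L4 where L4: "laplacian_at0 (\<lambda>t. ln (1 + (\<Sum>l\<in>?J. (norm (\<beta> t l))\<^sup>2))) L4"
    "L4 \<ge> 4 * (\<Sum>l\<in>?J. (norm (\<beta>' l))\<^sup>2) / (1 + (\<Sum>l\<in>?J. (norm (\<beta> 0 l))\<^sup>2))\<^sup>2"
    using laplacian_at0_ln_one_plus[OF r(1), of ?J "\<lambda>l t. \<beta> t l"] \<beta>h unfolding \<beta>'_def by auto
  have L4': "L4 \<ge> 4 * (\<Sum>l\<in>?J. (norm (\<beta>' l))\<^sup>2) / m\<^sup>2"
  proof -
    have s: "0 < 1 + (\<Sum>l\<in>?J. (norm (\<beta> 0 l))\<^sup>2)" by (simp add: add_pos_nonneg sum_nonneg)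
    have "4 * (\<Sum>l\<in>?J. (norm (\<beta>' l))\<^sup>2) / (real m)\<^sup>2 \<le> 4 * (\<Sum>l\<in>?J. (norm (\<beta>' l))\<^sup>2) / (1 + (\<Sum>l\<in>?J. (norm (\<beta> 0 l))\<^sup>2))\<^sup>2"
      using s N0 by (intro divide_left_mono power_mono mult_pos_pos zero_less_power mult_nonneg_nonneg sum_nonneg) auto
    then show ?thesis using L4(2) by simp
  qed
  have L5: "laplacian_at0 (\<lambda>t. log_norm M H c i (vt t)) (4 * levi (2 * n - 1) (log_norm M H c i) v b)"
  proof -
    have "laplacian_at0 (\<lambda>t. log_norm M H c i (vt t)) (4 * Re (\<Sum>l<2 * n - 1. \<Sum>j<2 * n - 1.
       dz l (dzbar j (\<lambda>v. complex_of_real (log_norm M H c i v))) (vt 0) * deriv (\<lambda>t. vt t l) 0 * cnj (deriv (\<lambda>t. vt t j) 0)))"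
    proof (rule laplacian_at0_comp[OF Rop _ r3(2)])
      show "Ck_on (2 * n - 1) (Suc (Suc 0)) (PT_region M c) (\<lambda>v. complex_of_real (log_norm M H c i v))"
        using H c i unfolding finsler_def n_def by blast
      show "(\<lambda>t. vt t j) holomorphic_on ball 0 r3" for j
        unfolding vt_def cline_def by (auto intro!: holomorphic_intros)
    qed (rule vtR)
    moreover have "deriv (\<lambda>t. vt t j) 0 = b j" for j
      unfolding vt_def by (rule DERIV_imp_deriv[OF cline_deriv])
    ultimately show ?thesis by (simp add: v0 levi_def)
  qed
  \<comment> \<open>The component \<open>?V\<close> is split off from both lengths of the image
    vector. Its logarithm is harmonic by \<open>L2\<close> and contributes the zeros in
    \<open>?L\<close>.\<close>
  let ?\<phi> = "\<lambda>t. (real k * (log_norm N K c' i' (\<beta> t) + ln ((norm (?V t))\<^sup>2)) +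
     real A * (ln (cutoff n a \<rho> (z t)) + (ln ((norm (?V t))\<^sup>2) + ln (1 + (\<Sum>l\<in>?J. (norm (\<beta> t l))\<^sup>2))))) +
     - real (k + A) * log_norm M H c i (vt t)"
  let ?L = "(real k * (4 * levi (2 * m - 1) (log_norm N K c' i') (\<beta> 0) \<beta>' + 0) + real A * (L3 + (0 + L4))) +
     - real (k + A) * (4 * levi (2 * n - 1) (log_norm M H c i) v b)"
  have "laplacian_at0 ?\<phi> ?L"
    by (intro laplacian_at0_add laplacian_at0_cmult L1 L2 L3(1) L4(1) L5)
  moreover have ev: "\<forall>\<^sub>F t in nhds 0. ?\<phi> t = ln (ratio M N f K H k A (c, c', a, \<rho>) (p t) (W t)) \<and>
    ratio M N f K H k A (c, c', a, \<rho>) (p t) (W t) > 0 \<and> vt t \<in> PT_region M c \<and> base_coord n (vt t) \<in> B"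
  proof -
    have "isCont (\<lambda>t. cutoff n a \<rho> (z t)) 0"
      unfolding cutoff_def z_def cline_def by (intro continuous_intros)
    then have "((\<lambda>t. cutoff n a \<rho> (z t)) \<longlongrightarrow> cutoff n a \<rho> (z 0)) (nhds 0)"
      unfolding continuous_at by (rule tendsto_at_iff_tendsto_nhds[THEN iffD1])
    moreover have "cutoff n a \<rho> (z 0) > 0" using q by (simp add: q_def v0 z0_def n_def)
    ultimately have 1: "\<forall>\<^sub>F t in nhds 0. cutoff n a \<rho> (z t) > 0" by (rule order_tendstoD)
    have 2: "\<forall>\<^sub>F t in nhds 0. t \<in> ball (0::complex) r"
      by (rule eventually_nhds_in_open) (use r in auto)
    show ?thesis using 1 2
    proof eventually_elim
      case (elim t)
      then have t: "t \<in> ball 0 r3" using r(2) by auto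
      have Vn: "V t \<noteq> (\<lambda>s. 0)" using nz[OF elim(2)] by auto
      have "extend0 K (f (p t)) (V t) = (norm (?V t))\<^sup>2 * exp (log_norm N K c' i' (\<beta> t))"
        unfolding extend0_def \<beta>_def using Vn
        by (simp add: finsler_coord[OF N K c' i'(1)[unfolded m_def] fp[OF t] Vt[OF t] nz[OF elim(2)]])
      then have lnK: "extend0 K (f (p t)) (V t) > 0"
         "ln (extend0 K (f (p t)) (V t)) = log_norm N K c' i' (\<beta> t) + ln ((norm (?V t))\<^sup>2)"
        using nz[OF elim(2)] by (auto simp: ln_mult_pos)
      have S: "coord_sqnorm N c' (V t) = (norm (?V t))\<^sup>2 * (1 + (\<Sum>l\<in>?J. (norm (\<beta> t l))\<^sup>2))"
        unfolding \<beta>_def m_def by (rule coord_sqnorm_vec_coord[where V = "V t", OF i'(1)[unfolded m_def] nz[OF elim(2)]])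
      have S1: "1 + (\<Sum>l\<in>?J. (norm (\<beta> t l))\<^sup>2) > 0" by (simp add: add_pos_nonneg sum_nonneg)
      have V2: "(norm (?V t))\<^sup>2 > 0" using nz[OF elim(2)] by simp
      have lnS: "coord_sqnorm N c' (V t) > 0"
        "ln (coord_sqnorm N c' (V t)) = ln ((norm (?V t))\<^sup>2) + ln (1 + (\<Sum>l\<in>?J. (norm (\<beta> t l))\<^sup>2))"
        unfolding S using S1 V2 by (auto simp only: ln_mult_pos mult_pos_pos)
      have lnH: "ln (H (p t) (W t)) = log_norm M H c i (vt t)"
        by (simp add: log_norm_def p_def W_def)
      have "ln (ratio M N f K H k A (c, c', a, \<rho>) (p t) (W t)) =
        real k * ln (extend0 K (f (p t)) (V t)) + real A * (ln (cutoff n a \<rho> (z t)) + ln (coord_sqnorm N c' (V t)))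
        - real (k + A) * ln (H (p t) (W t))"
        unfolding r0[OF t] using lnK(1) lnS(1) elim(1) Hp[OF t]
        by (simp add: ln_div ln_mult_pos ln_realpow)
      moreover have "ratio M N f K H k A (c, c', a, \<rho>) (p t) (W t) > 0"
        unfolding r0[OF t] using lnK(1) lnS(1) elim(1) Hp[OF t] by simp
      moreover have "base_coord n (vt t) \<in> B"
        using elim(1) openin_Cspace_subset[OF Uop zU[OF t]] unfolding base_vt B_def cball_Cspace_def cutoff_def by simp
      ultimately show ?case using vtR[OF t] unfolding lnK(2) lnS(2) lnH by (simp add: left_diff_distrib distrib_right)
    qed
  qed
  ultimately have LL: "laplacian_at0 (\<lambda>t. ln (ratio M N f K H k A (c, c', a, \<rho>) (p t) (W t))) ?L"
    by (rule laplacian_at0_cong[OF _ eventually_mono]) blast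
  have ev': "\<forall>\<^sub>F t in nhds 0. ratio M N f K H k A (c, c', a, \<rho>) (p t) (W t) > 0 \<and>
    vt t \<in> PT_region M c \<and> base_coord n (vt t) \<in> B"
    using ev by (rule eventually_mono) blast
  let ?E = "(\<Sum>l<n. (norm (b l))\<^sup>2) * (1 / q + \<rho> / q\<^sup>2)"
  have "L3 + L4 \<ge> 4 * ((\<Sum>l\<in>?J. (norm (\<beta>' l))\<^sup>2) / m\<^sup>2 - ?E)"
    using L3(2) L4' by (simp add: algebra_simps)
  then have "real A * (L3 + L4) \<ge> real A * (4 * ((\<Sum>l\<in>?J. (norm (\<beta>' l))\<^sup>2) / m\<^sup>2 - ?E))"
    by (intro mult_left_mono) auto
  then have "?L \<ge> 4 * (k * levi (2 * m - 1) (log_norm N K c' i') (\<beta> 0) \<beta>'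
      + A * ((\<Sum>l\<in>?J. (norm (\<beta>' l))\<^sup>2) / m\<^sup>2 - ?E)
      - (real k + real A) * levi (2 * n - 1) (log_norm M H c i) v b)"
    by (simp add: algebra_simps)
  then have bound: "?L \<ge> 4 * (k * levi (2 * m - 1) (log_norm N K c' i') (\<beta> 0) \<beta>'
      + A * ((\<Sum>l\<in>?J. (norm (\<beta>' l))\<^sup>2) / m\<^sup>2 - ?E)
      - (real k + real A) * levi (2 * n - 1) (log_norm M H c i) v b)" by simp
  show ?thesis
    by (rule that[OF i'(1)[unfolded m_def] w[unfolded m_def F_def B_def n_def] \<beta>'1[unfolded m_def n_def F_def z0_def]
          LL[unfolded p_def W_def vt_def m_def n_def] ev'[unfolded p_def W_def vt_def B_def n_def] q bound[unfolded m_def n_def]])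
qed

section \<open>Finite covers by adapted balls, and maps with vanishing differential\<close>

lemma cutoff_open: "openin (top_of_set (Cspace n)) {z \<in> Cspace n. cutoff n a \<rho> z > \<rho>'}"
proof -
  have "open {z. cutoff n a \<rho> z > \<rho>'}"
    unfolding cutoff_def by (intro open_Collect_less continuous_intros continuous_on_cvec_apply)
  moreover have "{z \<in> Cspace n. cutoff n a \<rho> z > \<rho>'} = Cspace n \<inter> {z. cutoff n a \<rho> z > \<rho>'}" by auto
  ultimately show ?thesis by (auto simp: openin_open)
qed

context
  fixes M :: "'a cmanifold" and N :: "'b cmanifold" and f :: "'a \<Rightarrow> 'b"
  assumes M: "complex_manifold M" and N: "complex_manifold N" and f: "holomorphic_map M N f"
begin

lemma ex_adapted_ball:
  assumes p: "p \<in> topspace (mtop M)"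
  obtains c c' \<rho> where "adapted_ball M N f (c, c', snd c p, \<rho>)" "p \<in> fst c"
    "cutoff (mdim M) (snd c p) \<rho> (snd c p) > \<rho> / 2"
proof -
  let ?n = "mdim M"
  obtain c where c: "c \<in> atlas M" "p \<in> fst c" using ex_chart[OF M p] by blast
  have "f p \<in> topspace (mtop N)" using f p unfolding holomorphic_map_def continuous_map_def by auto
  then obtain c' where c': "c' \<in> atlas N" "f p \<in> fst c'" using ex_chart[OF N] by blast
  let ?U = "snd c ` {p \<in> fst c. f p \<in> fst c'}"
  have aU: "snd c p \<in> ?U" using c c' by blast
  obtain e where e: "e > 0" "\<And>w. w \<in> Cspace ?n \<Longrightarrow> (\<And>j. j < ?n \<Longrightarrow> norm (w j - snd c p j) < e) \<Longrightarrow> w \<in> ?U"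
    by (rule Cspace_box[OF overlap_image_open[OF M N f c(1) c'(1)] aU]) blast
  \<comment> \<open>Radius \<open>e / 2\<close>, so that even on the closed ball every coordinate
    differs from the centre by less than \<open>e\<close>.\<close>
  define \<rho> where "\<rho> = (e / 2)\<^sup>2"
  have "w \<in> ?U" if w: "w \<in> cball_Cspace ?n (snd c p) \<rho>" for w
  proof (rule e(2))
    show "w \<in> Cspace ?n" using w by (simp add: cball_Cspace_def)
    fix j assume j: "j < ?n"
    have "(norm (w j - snd c p j))\<^sup>2 \<le> (\<Sum>j<?n. (norm (w j - snd c p j))\<^sup>2)"
      by (rule member_le_sum) (use j in auto)
    also have "\<dots> \<le> (e / 2)\<^sup>2" using w by (simp add: cball_Cspace_def \<rho>_def)
    finally have "norm (w j - snd c p j) \<le> e / 2" by (rule power2_le_imp_le) (use e(1) in simp)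
    then show "norm (w j - snd c p j) < e" using e(1) by simp
  qed
  then have "adapted_ball M N f (c, c', snd c p, \<rho>)"
    using c c' e(1) unfolding adapted_ball_def by (auto simp: \<rho>_def)
  moreover have "cutoff ?n (snd c p) \<rho> (snd c p) > \<rho> / 2" using e(1) by (simp add: cutoff_def \<rho>_def)
  ultimately show ?thesis using that c by blast
qed

text \<open>The balls are chosen so that the smaller sets, where the cutoff exceeds half of its
  maximal value \<rho>, already cover. Every point then has a ball in which its cutoff is not small,
  and this ball competes with any other one for the maximum.\<close>

lemma finite_adapted_cover:
  assumes "compact_space (mtop M)"
  obtains F where "finite F" "\<And>\<kappa>. \<kappa> \<in> F \<Longrightarrow> adapted_ball M N f \<kappa>"
    "\<And>p. p \<in> topspace (mtop M) \<Longrightarrow> \<exists>c c' a \<rho>. (c, c', a, \<rho>) \<in> F \<and> p \<in> fst c \<and> cutoff (mdim M) a \<rho> (snd c p) > \<rho> / 2"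
proof -
  define T where "T = (\<lambda>(c::'a chart, c'::'b chart, a, \<rho>). {p \<in> fst c. snd c p \<in> {z \<in> Cspace (mdim M). cutoff (mdim M) a \<rho> z > \<rho> / 2}})"
  have op: "openin (mtop M) (T \<kappa>)" if "adapted_ball M N f \<kappa>" for \<kappa>
  proof -
    obtain c c' a \<rho> where \<kappa>: "\<kappa> = (c, c', a, \<rho>)" by (cases \<kappa>)
    then have "c \<in> atlas M" using that by (simp add: adapted_ball_def)
    from chart_open_preimage[OF M this cutoff_open[of "mdim M" "\<rho> / 2" a \<rho>]]
    show ?thesis unfolding \<kappa> T_def prod.case .
  qed
  have "topspace (mtop M) \<subseteq> \<Union> (T ` {\<kappa>. adapted_ball M N f \<kappa>})"
  proof
    fix p assume p: "p \<in> topspace (mtop M)"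
    obtain c c' \<rho> where *: "adapted_ball M N f (c, c', snd c p, \<rho>)" "p \<in> fst c"
      "cutoff (mdim M) (snd c p) \<rho> (snd c p) > \<rho> / 2" by (rule ex_adapted_ball[OF p])
    then have "snd c p \<in> Cspace (mdim M)"
      using chart_Cspace[OF M] by (auto simp: adapted_ball_def)
    with * have "p \<in> T (c, c', snd c p, \<rho>)" by (simp add: T_def)
    then show "p \<in> \<Union> (T ` {\<kappa>. adapted_ball M N f \<kappa>})" using *(1) by blast
  qed
  moreover have "\<forall>U\<in>T ` {\<kappa>. adapted_ball M N f \<kappa>}. openin (mtop M) U" using op by auto
  ultimately obtain \<F> where \<F>: "finite \<F>" "\<F> \<subseteq> T ` {\<kappa>. adapted_ball M N f \<kappa>}" "topspace (mtop M) \<subseteq> \<Union> \<F>"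
    using assms unfolding compact_space_alt by (metis (no_types, lifting))
  then obtain F where F: "finite F" "F \<subseteq> {\<kappa>. adapted_ball M N f \<kappa>}" "\<F> = T ` F"
    by (meson finite_subset_image)
  show ?thesis
  proof (rule that[OF F(1)])
    show "adapted_ball M N f \<kappa>" if "\<kappa> \<in> F" for \<kappa> using F(2) that by blast
    fix p assume "p \<in> topspace (mtop M)"
    then obtain \<kappa> where \<kappa>: "\<kappa> \<in> F" "p \<in> T \<kappa>" using \<F>(3) F(3) by blast
    obtain c c' a \<rho> where eq: "\<kappa> = (c, c', a, \<rho>)" by (cases \<kappa>)
    have "p \<in> fst c \<and> cutoff (mdim M) a \<rho> (snd c p) > \<rho> / 2"
      using \<kappa>(2) unfolding eq T_def prod.case by blast
    then show "\<exists>c c' a \<rho>. (c, c', a, \<rho>) \<in> F \<and> p \<in> fst c \<and> cutoff (mdim M) a \<rho> (snd c p) > \<rho> / 2"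
      using \<kappa>(1) unfolding eq by blast
  qed
qed

text \<open>If the differential vanishes, the coordinate map is constant along the segments from the
  centre of an adapted ball, so \<open>f\<close> is locally constant. Connectedness of the manifold
  does the rest.\<close>

lemma constant_on_if_push_zero:
  assumes zero: "\<And>p W. p \<in> topspace (mtop M) \<Longrightarrow> W \<in> tangent_space M p \<Longrightarrow> push M N f p W = (\<lambda>s. 0)"
  shows "f constant_on topspace (mtop M)"
proof -
  have local: "\<exists>T. openin (mtop M) T \<and> p \<in> T \<and> (\<forall>x\<in>T. f x = f p)" if p: "p \<in> topspace (mtop M)" for p
  proof -
    obtain c c' \<rho> where ball: "adapted_ball M N f (c, c', snd c p, \<rho>)" and pc: "p \<in> fst c"
      and cut: "cutoff (mdim M) (snd c p) \<rho> (snd c p) > \<rho> / 2" by (rule ex_adapted_ball[OF p])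
    let ?n = "mdim M" and ?a = "snd c p" and ?U = "snd c ` {p \<in> fst c. f p \<in> fst c'}"
    let ?F = "coord_map f c c'"
    note cc = ball_charts[OF M N f ball]
    have aC: "?a \<in> Cspace ?n" by (rule chart_Cspace[OF M cc(1) pc])
    have dz0: "dz l (\<lambda>z. ?F z j) z = 0" if z: "z \<in> ?U" and jl: "j < mdim N" "l < ?n" for z j l
    proof -
      obtain q where q: "q \<in> fst c" "f q \<in> fst c'" "z = snd c q" using z by blast
      \<comment> \<open>Testing with the \<open>l\<close>-th coordinate vector isolates a single
        entry of the Jacobian matrix.\<close>
      let ?W = "mkvec M c q (\<lambda>k. if k = l then 1 else 0)"
      have W: "?W \<in> tangent_space M q" by (rule mkvec_tangent[OF M cc(1) q(1)])
      have "q \<in> topspace (mtop M)" using q(1) chart_dom_subset[OF M cc(1)] by blast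
      then have "0 = (\<Sum>k<?n. dz k (\<lambda>z. ?F z j) (snd c q) * ?W (c, k))"
        using push_coord[OF M N f ball q(1,2) W jl(1)] zero[OF _ W] by simp
      also have "\<dots> = (\<Sum>k<?n. if k = l then dz k (\<lambda>z. ?F z j) z else 0)"
        by (intro sum.cong refl) (simp add: mkvec_apply[OF M cc(1) q(1)] q(3))
      also have "\<dots> = dz l (\<lambda>z. ?F z j) z" using jl by simp
      finally show ?thesis by simp
    qed
    have eq: "?F z j = ?F ?a j" if z: "z \<in> cball_Cspace ?n ?a \<rho>" and j: "j < mdim N" for z j
    proof -
      define b where "b = (\<lambda>k. z k - ?a k)"
      have zC: "z \<in> Cspace ?n" using z by (simp add: cball_Cspace_def)
      have bC: "b \<in> Cspace ?n" using zC aC by (simp add: b_def Cspace_def)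
      have in_U: "cline ?a b t \<in> ?U" if t: "t \<in> closed_segment 0 1" for t
      proof -
        have "norm t \<le> 1" using t by (auto simp: in_segment norm_mult)
        then have "(norm t * norm (b k))\<^sup>2 \<le> (norm (b k))\<^sup>2" for k
          by (intro power_mono) (auto simp: mult_left_le_one_le)
        then have "(\<Sum>k<?n. (norm (cline ?a b t k - ?a k))\<^sup>2) \<le> (\<Sum>k<?n. (norm (b k))\<^sup>2)"
          by (intro sum_mono) (simp add: cline_def norm_mult)
        also have "\<dots> \<le> \<rho>" using z by (simp add: cball_Cspace_def b_def)
        finally have "cline ?a b t \<in> cball_Cspace ?n ?a \<rho>"
          using cline_Cspace[OF aC bC] by (simp add: cball_Cspace_def)
        then show ?thesis using ball_subset[OF M N f ball] by blast
      qed
      have d: "((\<lambda>t. ?F (cline ?a b t) j) has_field_derivative 0) (at t within closed_segment 0 1)"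
        if t: "t \<in> closed_segment 0 1" for t
      proof -
        have "((\<lambda>t. ?F (cline ?a b t) j) has_field_derivative (\<Sum>l<?n. dz l (\<lambda>z. ?F z j) (cline ?a b t) * b l)) (at t)"
        proof (rule chain_rule_holo[where \<gamma> = "cline ?a b", OF overlap_image_open[OF M N f cc(1,2)] holo_on_Ck_on[OF coord_map_holo[OF M N f ball j]] _ in_U[OF t]])
          show "\<forall>\<^sub>F t in nhds t. cline ?a b t \<in> Cspace ?n" by (intro always_eventually allI cline_Cspace aC bC)
          show "((\<lambda>t. cline ?a b t l) has_field_derivative b l) (at t)" for l by (rule cline_deriv)
          show "dzbar l (\<lambda>z. ?F z j) (cline ?a b t) = 0" if "l < ?n" for l
            by (rule holo_on_dzbar[OF coord_map_holo[OF M N f ball j] that in_U[OF t]])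
        qed
        then show ?thesis using dz0[OF in_U[OF t] j] by (simp add: has_field_derivative_at_within)
      qed
      obtain C where "\<And>t. t \<in> closed_segment (0::complex) 1 \<Longrightarrow> ?F (cline ?a b t) j = C"
        using has_field_derivative_zero_constant[OF convex_closed_segment d] by blast
      from this[of 0] this[of 1] show ?thesis by (simp add: cline_def b_def)
    qed
    let ?T = "{x \<in> fst c. snd c x \<in> {z \<in> Cspace ?n. cutoff ?n ?a \<rho> z > 0}}"
    have "openin (mtop M) ?T" by (rule chart_open_preimage[OF M cc(1) cutoff_open])
    moreover have "p \<in> ?T" using pc aC cut cc(3) by simp
    moreover have "f x = f p" if x: "x \<in> ?T" for x
    proof -
      have xb: "snd c x \<in> cball_Cspace ?n ?a \<rho>" using x by (simp add: cball_Cspace_def cutoff_def)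
      have ab: "?a \<in> cball_Cspace ?n ?a \<rho>" using aC cc(3) by (simp add: cball_Cspace_def)
      have U: "snd c x \<in> ?U" "?a \<in> ?U" using xb ab ball_subset[OF M N f ball] by auto
      have inv: "chart_inv c (snd c x) = x" "chart_inv c ?a = p"
        using chart_inv_apply[OF M cc(1)] x pc by auto
      have "?F (snd c x) = ?F ?a"
      proof
        fix j show "?F (snd c x) j = ?F ?a j"
          using eq[OF xb, of j] coord_map_Cspace[OF M N f ball U(1)] coord_map_Cspace[OF M N f ball U(2)]
          by (cases "j < mdim N") (auto simp: Cspace_def)
      qed
      then have "snd c' (f x) = snd c' (f p)" by (simp add: coord_map_def inv)
      moreover have "f x \<in> fst c'" "f p \<in> fst c'"
        using coord_map_in[OF M N f ball U(1)] coord_map_in[OF M N f ball U(2)] by (simp_all add: inv)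
      ultimately show "f x = f p" using chart_inj[OF N cc(2)] by (meson inj_onD)
    qed
    ultimately show ?thesis by blast
  qed
  \<comment> \<open>A locally constant map has open preimages of all sets. So the points with the
    value \<open>f p\<close> and the points with another value form a separation unless one of the
    two sets is empty.\<close>
  have op: "openin (mtop M) {x \<in> topspace (mtop M). P (f x)}" for P
  proof (subst openin_subopen, intro ballI)
    fix x assume x: "x \<in> {x \<in> topspace (mtop M). P (f x)}"
    then obtain T where T: "openin (mtop M) T" "x \<in> T" "\<forall>y\<in>T. f y = f x" using local by blast
    then have "T \<subseteq> {x \<in> topspace (mtop M). P (f x)}" using x openin_subset by fastforce
    with T show "\<exists>T. openin (mtop M) T \<and> x \<in> T \<and> T \<subseteq> {x \<in> topspace (mtop M). P (f x)}" by blast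
  qed
  show ?thesis
  proof (cases "topspace (mtop M) = {}")
    case True
    then show ?thesis by (simp add: constant_on_def)
  next
    case False
    then obtain p where p: "p \<in> topspace (mtop M)" by blast
    have conn: "connected_space (mtop M)" using M unfolding complex_manifold_def by blast
    let ?S = "{x \<in> topspace (mtop M). f x = f p}" and ?T = "{x \<in> topspace (mtop M). f x \<noteq> f p}"
    have "?T = {}"
    proof (rule ccontr)
      assume "?T \<noteq> {}"
      moreover have "openin (mtop M) ?S" "openin (mtop M) ?T" by (rule op)+
      moreover have "topspace (mtop M) \<subseteq> ?S \<union> ?T" "?S \<inter> ?T = {}" "?S \<noteq> {}" using p by auto
      ultimately show False using conn unfolding connected_space_def by blast
    qed
    then show ?thesis unfolding constant_on_def by blast
  qed
qed

end

section \<open>Uniform constants and existence of the maximum\<close>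

lemma compact_real_bound:
  fixes h :: "'p::topological_space \<Rightarrow> 'q::real_normed_vector"
  assumes "compact S" "continuous_on S h"
  obtains B where "\<And>x. x \<in> S \<Longrightarrow> norm (h x) \<le> B"
  using compact_imp_bounded[OF compact_continuous_image[OF assms(2,1)]] unfolding bounded_iff by blast

text \<open>The bounds that must be known before the metric from nefness is chosen: for the ball,
  for the negativity of the potential of \<open>H\<close>, for the form \<Omega>, for the
  differential, and for the comparison of coordinate length with the fixed metric \<open>K1\<close>.
  All of them stay true when \<open>C\<close> grows.\<close>

definition controls :: "'a cmanifold \<Rightarrow> 'b cmanifold \<Rightarrow> ('a \<Rightarrow> 'b) \<Rightarrow> ('a \<Rightarrow> 'a tvec \<Rightarrow> real) \<Rightarrow> ('b \<Rightarrow> 'b tvec \<Rightarrow> real) \<Rightarrow>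
    ('b chart \<Rightarrow> nat \<Rightarrow> cvec \<Rightarrow> nat \<Rightarrow> nat \<Rightarrow> complex) \<Rightarrow> 'a chart \<times> 'b chart \<times> cvec \<times> real \<Rightarrow> real \<Rightarrow> bool" where
  "controls M N f H K1 \<Omega> = (\<lambda>(c, c', a, \<rho>) C. C > 0 \<and> \<rho> \<le> C \<and> 1 \<le> C * \<rho> \<and>
    (\<forall>i<mdim M. \<forall>v\<in>PT_compact (mdim M) (cball_Cspace (mdim M) a \<rho>).
      \<exists>b\<in>Cspace (2 * mdim M - 1). (\<forall>j. norm (b j) \<le> 1) \<and> levi (2 * mdim M - 1) (log_norm M H c i) v b \<le> - (1 / C)) \<and>
    (\<forall>i<mdim N. \<forall>w\<in>PT_compact (mdim N) (coord_map f c c' ` cball_Cspace (mdim M) a \<rho>). \<forall>e.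
      Re (\<Sum>l<2 * mdim N - 1. \<Sum>j<2 * mdim N - 1. \<Omega> c' i w l j * e l * cnj (e j)) \<le> C * (\<Sum>l<2 * mdim N - 1. (norm (e l))\<^sup>2)) \<and>
    (\<forall>z\<in>cball_Cspace (mdim M) a \<rho>. \<forall>b. (\<forall>j. norm (b j) \<le> 1) \<longrightarrow>
      (\<Sum>j<mdim N. (norm (\<Sum>l<mdim M. dz l (\<lambda>z. coord_map f c c' z j) z * b l))\<^sup>2) \<le> C) \<and>
    (\<forall>p\<in>fst c'. snd c' p \<in> coord_map f c c' ` cball_Cspace (mdim M) a \<rho> \<longrightarrow>
      (\<forall>V\<in>tangent_space N p. V \<noteq> (\<lambda>s. 0) \<longrightarrow> K1 p V \<le> C * coord_sqnorm N c' V \<and> coord_sqnorm N c' V \<le> C * K1 p V)))"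

context
  fixes M :: "'a cmanifold" and N :: "'b cmanifold" and f :: "'a \<Rightarrow> 'b"
  assumes M: "complex_manifold M" and N: "complex_manifold N" and f: "holomorphic_map M N f"
begin

text \<open>The values fill a finite union of continuous images of compact sets, since every nonzero
  vector over a ball is represented after division by its largest component. The maximum runs over
  all balls at once, so a point may be compared in two different balls. The vector \<open>W0\<close>
  only ensures that there is a value.\<close>

lemma ratio_attains_max:
  assumes F: "finite F" "\<And>\<kappa>. \<kappa> \<in> F \<Longrightarrow> adapted_ball M N f \<kappa>"
    and K: "finsler N K" and H: "finsler M H"
    and p0: "(c0, c0', a0, \<rho>0) \<in> F" "p0 \<in> fst c0" "snd c0 p0 \<in> cball_Cspace (mdim M) a0 \<rho>0"
      "W0 \<in> tangent_space M p0" "W0 \<noteq> (\<lambda>s. 0)"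
  obtains c c' a \<rho> i v where "(c, c', a, \<rho>) \<in> F" "i < mdim M" "v \<in> PT_compact (mdim M) (cball_Cspace (mdim M) a \<rho>)"
    "\<And>d d' a' \<rho>' p W. (d, d', a', \<rho>') \<in> F \<Longrightarrow> p \<in> fst d \<Longrightarrow> snd d p \<in> cball_Cspace (mdim M) a' \<rho>' \<Longrightarrow>
      W \<in> tangent_space M p \<Longrightarrow> W \<noteq> (\<lambda>s. 0) \<Longrightarrow>
      ratio M N f K H k A (d, d', a', \<rho>') p W \<le> ratio M N f K H k A (c, c', a, \<rho>) (PT_base M c v) (PT_vec M c i v)"
proof -
  define D where "D = (\<lambda>(c::'a chart, c'::'b chart, a, \<rho>). PT_compact (mdim M) (cball_Cspace (mdim M) a \<rho>))"
  define R where "R \<kappa> i v = ratio M N f K H k A \<kappa> (PT_base M (fst \<kappa>) v) (PT_vec M (fst \<kappa>) i v)" for \<kappa> i v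
  define S where "S = (\<Union>\<kappa>\<in>F. \<Union>i\<in>{..<mdim M}. R \<kappa> i ` D \<kappa>)"
  have "compact S"
    unfolding S_def
  proof (intro compact_UN F finite_lessThan)
    fix \<kappa> i assume \<kappa>: "\<kappa> \<in> F" and i: "i \<in> {..<mdim M}"
    obtain c c' a \<rho> where eq: "\<kappa> = (c, c', a, \<rho>)" by (cases \<kappa>)
    show "compact (R \<kappa> i ` D \<kappa>)"
      unfolding D_def eq prod.case R_def fst_conv
      using ratio_continuous[OF M N f F(2)[OF \<kappa>, unfolded eq] _ K H] i
      by (intro compact_continuous_image compact_PT_compact compact_cball_Cspace) auto
  qed
  have in_S: "ratio M N f K H k A (d, d', a', \<rho>') p W \<in> S"
    if d: "(d, d', a', \<rho>') \<in> F" and p: "p \<in> fst d" "snd d p \<in> cball_Cspace (mdim M) a' \<rho>'"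
      and W: "W \<in> tangent_space M p" "W \<noteq> (\<lambda>s. 0)" for d d' a' \<rho>' p W
  proof -
    note ball = F(2)[OF d]
    note dc = ball_charts(1)[OF M N f ball]
    obtain i where i: "i < mdim M" "W (d, i) \<noteq> 0" "\<And>j. j < mdim M \<Longrightarrow> norm (W (d, j)) \<le> norm (W (d, i))"
      using max_component[OF tangent_nonzero_component[OF M dc p(1) W]] by blast
    let ?v = "vec_coord M d i p W"
    have "?v \<in> D (d, d', a', \<rho>')"
      unfolding D_def prod.case by (rule vec_coord_PT_compact[OF M dc i(1) p W(1) i(2,3)])
    moreover have "R (d, d', a', \<rho>') i ?v = ratio M N f K H k A (d, d', a', \<rho>') p W"
      unfolding R_def fst_conv by (rule ratio_vec_coord[OF M N f ball i(1) K H p(1) W(1) i(2)])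
    ultimately show ?thesis unfolding S_def using d i(1) by (metis (no_types, lifting) UN_I image_eqI lessThan_iff)
  qed
  have "S \<noteq> {}" using in_S[OF p0] by blast
  then obtain s where s: "s \<in> S" "\<And>t. t \<in> S \<Longrightarrow> t \<le> s"
    using compact_attains_sup[OF \<open>compact S\<close>] by blast
  then obtain \<kappa> i v where \<kappa>: "\<kappa> \<in> F" "i < mdim M" "v \<in> D \<kappa>" "s = R \<kappa> i v" unfolding S_def by auto
  obtain c c' a \<rho> where eq: "\<kappa> = (c, c', a, \<rho>)" by (cases \<kappa>)
  show ?thesis
  proof (rule that)
    show "(c, c', a, \<rho>) \<in> F" "i < mdim M" "v \<in> PT_compact (mdim M) (cball_Cspace (mdim M) a \<rho>)"
      using \<kappa> by (simp_all add: eq D_def)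
    show "ratio M N f K H k A (d, d', a', \<rho>') p W \<le> ratio M N f K H k A (c, c', a, \<rho>) (PT_base M c v) (PT_vec M c i v)"
      if "(d, d', a', \<rho>') \<in> F" "p \<in> fst d" "snd d p \<in> cball_Cspace (mdim M) a' \<rho>'"
        "W \<in> tangent_space M p" "W \<noteq> (\<lambda>s. 0)" for d d' a' \<rho>' p W
      using s(2)[OF in_S[OF that]] unfolding \<kappa>(4) R_def eq fst_conv .
  qed
qed

text \<open>Each bound comes from a continuous function on a compact set over the closed ball or
  over its image; the constants for the individual indices are merged by
  \<open>finite_uniform\<close>.\<close>

lemma adapted_ball_constants:
  assumes ball: "adapted_ball M N f (c, c', a, \<rho>)"
    and K1: "finsler N K1" and H: "finsler M H"
    and neg: "\<And>c i v. c \<in> atlas M \<Longrightarrow> i < mdim M \<Longrightarrow> v \<in> PT_region M c \<Longrightarrow>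
      \<exists>b\<in>Cspace (2 * mdim M - 1). levi (2 * mdim M - 1) (log_norm M H c i) v b < 0"
    and \<Omega>: "\<And>c i l j. c \<in> atlas N \<Longrightarrow> i < mdim N \<Longrightarrow> l < 2 * mdim N - 1 \<Longrightarrow> j < 2 * mdim N - 1 \<Longrightarrow>
      continuous_on (PT_region N c) (\<lambda>v. \<Omega> c i v l j)"
  shows "\<exists>C. \<forall>C'\<ge>C. controls M N f H K1 \<Omega> (c, c', a, \<rho>) C'"
proof -
  let ?n = "mdim M" and ?m = "mdim N" and ?B = "cball_Cspace (mdim M) a \<rho>"
  let ?D = "PT_compact ?n ?B" and ?E = "PT_compact ?m (coord_map f c c' ` ?B)"
  note cc = ball_charts[OF M N f ball]
  have Dc: "compact ?D" and DR: "?D \<subseteq> PT_region M c"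
    by (intro compact_PT_compact compact_cball_Cspace PT_compact_subset ball_subset_chart[OF M N f ball])+
  have Ec: "compact ?E" and ER: "?E \<subseteq> PT_region N c'"
    by (intro compact_PT_compact compact_coord_map_ball[OF M N f ball] PT_compact_subset coord_map_ball_subset[OF M N f ball])+
  have "\<exists>C. \<forall>C'\<ge>C. C' > 0 \<and> (\<forall>v\<in>?D. \<exists>b\<in>Cspace (2 * ?n - 1). (\<forall>j. norm (b j) \<le> 1) \<and>
    levi (2 * ?n - 1) (log_norm M H c i) v b \<le> - (1 / C'))" if i: "i \<in> {..<?n}" for i
  proof -
    have i': "i < ?n" using i by simp
    have Ck: "Ck_on (2 * ?n - 1) (Suc (Suc 0)) (PT_region M c) (\<lambda>v. complex_of_real (log_norm M H c i v))"
      using H cc(1) i' unfolding finsler_def by blast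
    obtain C where C: "C > 0" "\<And>v. v \<in> ?D \<Longrightarrow> \<exists>b\<in>Cspace (2 * ?n - 1). (\<forall>j. norm (b j) \<le> 1) \<and>
        levi (2 * ?n - 1) (log_norm M H c i) v b \<le> - (1 / C)"
      by (rule levi_uniformly_negative[OF PT_region_open[OF M cc(1)] Ck Dc DR]) (use neg[OF cc(1) i'] DR in blast)+
    have "- (1 / C) \<le> - (1 / C')" if "C' \<ge> C" for C' using that C(1) by (simp add: frac_le)
    then show ?thesis using C by (intro exI[of _ C] allI impI conjI ballI) (simp, meson order_trans)
  qed
  from finite_uniform[of "{..<?n}" "\<lambda>i C'. C' > 0 \<and> (\<forall>v\<in>?D. \<exists>b\<in>Cspace (2 * ?n - 1). (\<forall>j. norm (b j) \<le> 1) \<and>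
    levi (2 * ?n - 1) (log_norm M H c i) v b \<le> - (1 / C'))", OF finite_lessThan this]
  obtain C1 where C1: "C1 > 0" "\<forall>i\<in>{..<?n}. \<forall>C'\<ge>C1. C' > 0 \<and> (\<forall>v\<in>?D. \<exists>b\<in>Cspace (2 * ?n - 1). (\<forall>j. norm (b j) \<le> 1) \<and>
    levi (2 * ?n - 1) (log_norm M H c i) v b \<le> - (1 / C'))" by blast
  let ?I = "{..<?m} \<times> {..<2 * ?m - 1} \<times> {..<2 * ?m - 1}"
  have "\<exists>C. \<forall>C'\<ge>C. (\<lambda>(i, l, j) C'. \<forall>w\<in>?E. norm (\<Omega> c' i w l j) \<le> C') s C'" if s: "s \<in> ?I" for s
  proof -
    obtain i l j where eq: "s = (i, l, j)" by (cases s)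
    have "continuous_on ?E (\<lambda>v. \<Omega> c' i v l j)"
      using s by (intro continuous_on_subset[OF \<Omega>[OF cc(2)] ER]) (auto simp: eq)
    from compact_real_bound[OF Ec this] obtain B where "\<And>w. w \<in> ?E \<Longrightarrow> norm (\<Omega> c' i w l j) \<le> B" by blast
    then show ?thesis by (intro exI[of _ B]) (auto simp: eq intro: order_trans)
  qed
  from finite_uniform[of ?I "\<lambda>(i, l, j) C'. \<forall>w\<in>?E. norm (\<Omega> c' i w l j) \<le> C'", OF _ this]
  obtain C2 where C2: "C2 > 0" "\<And>i l j w. i < ?m \<Longrightarrow> l < 2 * ?m - 1 \<Longrightarrow> j < 2 * ?m - 1 \<Longrightarrow> w \<in> ?E \<Longrightarrow> norm (\<Omega> c' i w l j) \<le> C2"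
    by auto
  let ?J = "{..<?m} \<times> {..<?n}"
  have "\<exists>C. \<forall>C'\<ge>C. (\<lambda>(j, l) C'. \<forall>z\<in>?B. norm (dz l (\<lambda>z. coord_map f c c' z j) z) \<le> C') s C'" if s: "s \<in> ?J" for s
  proof -
    obtain j l where eq: "s = (j, l)" by (cases s)
    have "continuous_on ?B (dz l (\<lambda>z. coord_map f c c' z j))"
      using s by (intro continuous_on_subset[OF dz_coord_map_continuous[OF M N f ball] ball_subset[OF M N f ball]]) (auto simp: eq)
    from compact_real_bound[OF compact_cball_Cspace this]
    obtain B where "\<And>z. z \<in> ?B \<Longrightarrow> norm (dz l (\<lambda>z. coord_map f c c' z j) z) \<le> B" by blast
    then show ?thesis by (intro exI[of _ B]) (auto simp: eq intro: order_trans)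
  qed
  from finite_uniform[of ?J "\<lambda>(j, l) C'. \<forall>z\<in>?B. norm (dz l (\<lambda>z. coord_map f c c' z j) z) \<le> C'", OF _ this]
  obtain C3 where C3: "C3 > 0" "\<And>j l z. j < ?m \<Longrightarrow> l < ?n \<Longrightarrow> z \<in> ?B \<Longrightarrow> norm (dz l (\<lambda>z. coord_map f c c' z j) z) \<le> C3"
    by auto
  have 3: "(\<Sum>j<?m. (norm (\<Sum>l<?n. dz l (\<lambda>z. coord_map f c c' z j) z * b l))\<^sup>2) \<le> ?m * (?n * C3)\<^sup>2"
    if z: "z \<in> ?B" and b: "\<forall>j. norm (b j) \<le> 1" for z b
  proof -
    have "norm (\<Sum>l<?n. dz l (\<lambda>z. coord_map f c c' z j) z * b l) \<le> ?n * C3" if j: "j < ?m" for j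
    proof -
      have "norm (\<Sum>l<?n. dz l (\<lambda>z. coord_map f c c' z j) z * b l) \<le> (\<Sum>l<?n. C3 * 1)"
      proof (rule sum_norm_le)
        fix l assume "l \<in> {..<?n}"
        then show "norm (dz l (\<lambda>z. coord_map f c c' z j) z * b l) \<le> C3 * 1"
          unfolding norm_mult using C3(1) C3(2)[OF j _ z] b by (intro mult_mono) auto
      qed
      then show ?thesis by simp
    qed
    then have "(\<Sum>j<?m. (norm (\<Sum>l<?n. dz l (\<lambda>z. coord_map f c c' z j) z * b l))\<^sup>2) \<le> (\<Sum>j<?m. (?n * C3)\<^sup>2)"
      by (intro sum_mono power_mono) auto
    then show ?thesis by simp
  qed
  obtain C4 where C4: "C4 > 0" "\<And>p V. p \<in> fst c' \<Longrightarrow> snd c' p \<in> coord_map f c c' ` ?B \<Longrightarrow> V \<in> tangent_space N p \<Longrightarrow> V \<noteq> (\<lambda>s. 0) \<Longrightarrow>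
    K1 p V \<le> C4 * coord_sqnorm N c' V \<and> coord_sqnorm N c' V \<le> C4 * K1 p V"
    by (rule finsler_coord_sqnorm_bounds[OF N K1 cc(2) compact_coord_map_ball[OF M N f ball] coord_map_ball_subset[OF M N f ball]]) blast
  \<comment> \<open>The factors turn entrywise bounds into bounds for forms and vectors:
    \<open>2 * ?m - 1\<close> is the dimension in \<open>hermitian_form_bound\<close>, and
    \<open>1 / \<rho>\<close> serves the clause \<open>1 \<le> C * \<rho>\<close>.\<close>
  define C where "C = Max {C1, C2 * (2 * ?m - 1), ?m * (?n * C3)\<^sup>2, C4, \<rho>, 1 / \<rho>}"
  have C: "C1 \<le> C" "C2 * (2 * ?m - 1) \<le> C" "?m * (?n * C3)\<^sup>2 \<le> C" "C4 \<le> C" "\<rho> \<le> C" "1 / \<rho> \<le> C"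
    unfolding C_def by (intro Max_ge; simp)+
  show ?thesis
    unfolding controls_def prod.case
  proof (intro exI[of _ C] allI impI conjI ballI)
    fix C' assume C': "C' \<ge> C"
    show "C' > 0" "\<rho> \<le> C'" using C(1,5) C1(1) C' by linarith+
    have "1 / \<rho> \<le> C'" using C(6) C' by linarith
    then show "1 \<le> C' * \<rho>" using cc(3) by (simp add: field_simps)
    show "\<exists>b\<in>Cspace (2 * ?n - 1). (\<forall>j. norm (b j) \<le> 1) \<and> levi (2 * ?n - 1) (log_norm M H c i) v b \<le> - (1 / C')"
      if "i < ?n" "v \<in> ?D" for i v
      using C1(2) that C(1) C' by (meson lessThan_iff order_trans)
    show "Re (\<Sum>l<2 * ?m - 1. \<Sum>j<2 * ?m - 1. \<Omega> c' i w l j * e l * cnj (e j)) \<le> C' * (\<Sum>l<2 * ?m - 1. (norm (e l))\<^sup>2)"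
      if "i < ?m" "w \<in> ?E" for i w e
    proof -
      have "Re (\<Sum>l<2 * ?m - 1. \<Sum>j<2 * ?m - 1. \<Omega> c' i w l j * e l * cnj (e j)) \<le> C2 * (2 * ?m - 1) * (\<Sum>l<2 * ?m - 1. (norm (e l))\<^sup>2)"
        by (rule hermitian_form_bound) (use C2(2) that in blast)
      also have "\<dots> \<le> C' * (\<Sum>l<2 * ?m - 1. (norm (e l))\<^sup>2)"
        using C(2) C' by (intro mult_right_mono sum_nonneg) auto
      finally show ?thesis .
    qed
    show "(\<Sum>j<?m. (norm (\<Sum>l<?n. dz l (\<lambda>z. coord_map f c c' z j) z * b l))\<^sup>2) \<le> C'"
      if "z \<in> ?B" "\<forall>j. norm (b j) \<le> 1" for z b
      using 3[OF that] C(3) C' by linarith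
    fix p V assume V: "p \<in> fst c'" "snd c' p \<in> coord_map f c c' ` ?B" "V \<in> tangent_space N p" "V \<noteq> (\<lambda>s. 0)"
    have nn: "coord_sqnorm N c' V \<ge> 0" by (rule coord_sqnorm_nonneg)
    have "p \<in> topspace (mtop N)" using V(1) chart_dom_subset[OF N cc(2)] by blast
    then have "K1 p V > 0" using V by (intro finslerD(1)[OF K1])
    then have "C4 * coord_sqnorm N c' V \<le> C' * coord_sqnorm N c' V" "C4 * K1 p V \<le> C' * K1 p V"
      using nn C(4) C' by (auto intro!: mult_right_mono)
    then show "K1 p V \<le> C' * coord_sqnorm N c' V" "coord_sqnorm N c' V \<le> C' * K1 p V"
      using C4(2)[OF V] by linarith+
  qed
qed

end

theorem corollary1p6:
  fixes M :: "'a cmanifold" and N :: "'b cmanifold" and f :: "'a \<Rightarrow> 'b"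
  assumes "complex_manifold M" and "compact_space (mtop M)"
    and "complex_manifold N" and "compact_space (mtop N)"
    and "holomorphic_map M N f"
    and "RC_positive (proj_tangent M) (tautological M)"
    and "nef (proj_tangent N) (dual_bundle (tautological N))"
  shows "f constant_on topspace (mtop M)"
proof (rule constant_on_if_push_zero[OF assms(1,3,5)], rule ccontr)
  note M = assms(1) and N = assms(3) and f = assms(5)
  fix p0 W0 assume p0: "p0 \<in> topspace (mtop M)" and W0: "W0 \<in> tangent_space M p0"
    and push0: "push M N f p0 W0 \<noteq> (\<lambda>s. 0)"
  define n m where "n = mdim M" and "m = mdim N"
  have W0nz: "W0 \<noteq> (\<lambda>s. 0)"
  proof
    assume "W0 = (\<lambda>s. 0)"
    then have "push M N f p0 W0 = (\<lambda>s. 0)" using push_scale[of M N f p0 0 W0] by simp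
    with push0 show False by simp
  qed
  obtain H where H: "finsler M H"
    and neg: "\<And>c i v. c \<in> atlas M \<Longrightarrow> i < mdim M \<Longrightarrow> v \<in> PT_region M c \<Longrightarrow>
      \<exists>b\<in>Cspace (2 * mdim M - 1). levi (2 * mdim M - 1) (log_norm M H c i) v b < 0"
    using RC_positive_levi[OF M assms(6)] by blast
  obtain \<Omega> :: "'b chart \<Rightarrow> nat \<Rightarrow> cvec \<Rightarrow> nat \<Rightarrow> nat \<Rightarrow> complex"
    where \<Omega>: "\<And>c i l j. c \<in> atlas N \<Longrightarrow> i < mdim N \<Longrightarrow> l < 2 * mdim N - 1 \<Longrightarrow> j < 2 * mdim N - 1 \<Longrightarrow>
      continuous_on (PT_region N c) (\<lambda>v. \<Omega> c i v l j)"
    and nef: "\<And>\<epsilon>. \<epsilon> > 0 \<Longrightarrow> \<exists>K. finsler N K \<and> (\<forall>c\<in>atlas N. \<forall>i<mdim N. \<forall>v\<in>PT_region N c. \<forall>a.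
      levi (2 * mdim N - 1) (log_norm N K c i) v a \<ge>
        - \<epsilon> * Re (\<Sum>l<2 * mdim N - 1. \<Sum>j<2 * mdim N - 1. \<Omega> c i v l j * a l * cnj (a j)))"
    by (rule nef_levi[OF N assms(7)]) blast
  \<comment> \<open>A fixed metric as a yardstick between different charts of the target; the one
    that nefness gives for \<epsilon> = 1 will do.\<close>
  obtain K1 where K1: "finsler N K1" using nef[of 1] by auto
  obtain F where F: "finite F" "\<And>\<kappa>. \<kappa> \<in> F \<Longrightarrow> adapted_ball M N f \<kappa>"
    and cover: "\<And>p. p \<in> topspace (mtop M) \<Longrightarrow> \<exists>c c' a \<rho>. (c, c', a, \<rho>) \<in> F \<and> p \<in> fst c \<and> cutoff (mdim M) a \<rho> (snd c p) > \<rho> / 2"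
    by (rule finite_adapted_cover[OF M N f assms(2)]) blast
  let ?Q = "controls M N f H K1 \<Omega>"
  have "\<exists>C. \<forall>C'\<ge>C. ?Q \<kappa> C'" if "\<kappa> \<in> F" for \<kappa>
  proof -
    obtain c c' a \<rho> where \<kappa>: "\<kappa> = (c, c', a, \<rho>)" by (cases \<kappa>)
    show ?thesis
      unfolding \<kappa>
      by (rule adapted_ball_constants[OF M N f F(2)[OF that, unfolded \<kappa>] K1 H neg \<Omega>])
  qed
  from finite_uniform[of F ?Q, OF F(1) this] obtain C where C: "C > 0" "\<And>\<kappa>. \<kappa> \<in> F \<Longrightarrow> ?Q \<kappa> C" by blast
  \<comment> \<open>\<open>C\<close>, \<open>\<delta>\<close> and \<open>A\<close> must not depend on the metric \<open>K\<close>, which is known only after \<open>k\<close>.\<close>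
  define \<delta> where "\<delta> = 1 / (2 * C ^ 3)"
  have \<delta>: "\<delta> > 0" using C(1) by (simp add: \<delta>_def)
  \<comment> \<open>Bounds the loss from the cutoff once it is at least \<delta>, with
    \<open>\<rho> \<le> C\<close> and a direction whose components have modulus at most 1.\<close>
  define E0 where "E0 = n * (1 / \<delta> + C / \<delta>\<^sup>2)"
  \<comment> \<open>Makes \<open>A / m\<^sup>2\<close> at least \<open>C\<close>, so that the
    Fubini--Study term outweighs the fibre part of the error from nefness; the added 1 keeps
    \<open>A\<close> positive.\<close>
  define A where "A = nat \<lceil>C * m\<^sup>2\<rceil> + 1"
  have A: "A > 0" "A \<ge> C * m\<^sup>2" by (simp_all add: A_def) linarith
  \<comment> \<open>Makes the gain \<open>k / C\<close> from RC-positivity exceed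
    \<open>C\<^sup>2 + A * E0\<close>, the sum of the losses that remain bounded.\<close>
  define k where "k = nat \<lceil>C * (C\<^sup>2 + A * E0)\<rceil> + 1"
  have k: "k > 0" "k > C * (C\<^sup>2 + A * E0)" by (simp_all add: k_def) linarith
  obtain K where K: "finsler N K" and Kn: "\<And>c i v a. c \<in> atlas N \<Longrightarrow> i < mdim N \<Longrightarrow> v \<in> PT_region N c \<Longrightarrow>
      levi (2 * mdim N - 1) (log_norm N K c i) v a \<ge>
        - (1 / k) * Re (\<Sum>l<2 * mdim N - 1. \<Sum>j<2 * mdim N - 1. \<Omega> c i v l j * a l * cnj (a j))"
    using nef[of "1 / k"] k(1) by auto
  let ?R = "ratio M N f K H k A"
  have ratio_eq: "?R (d, d', a', \<rho>') p W = K (f p) (push M N f p W) ^ k *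
      (cutoff n a' \<rho>' (snd d p) * coord_sqnorm N d' (push M N f p W)) ^ A / H p W ^ (k + A)"
    and Kpos: "K (f p) (push M N f p W) > 0"
    if p: "p \<in> topspace (mtop M)" and W: "W \<in> tangent_space M p" "push M N f p W \<noteq> (\<lambda>s. 0)" for d d' a' \<rho>' p W
  proof -
    show "?R (d, d', a', \<rho>') p W = K (f p) (push M N f p W) ^ k *
      (cutoff n a' \<rho>' (snd d p) * coord_sqnorm N d' (push M N f p W)) ^ A / H p W ^ (k + A)"
      using W(2) by (simp add: ratio_def extend0_def n_def)
    have "f p \<in> topspace (mtop N)" using f p unfolding holomorphic_map_def continuous_map_def by auto
    then show "K (f p) (push M N f p W) > 0"
      by (rule finslerD(1)[OF K _ push_tangent[OF M N f W(1) p] W(2)])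
  qed
  have sqpos: "coord_sqnorm N d' V > 0" if V: "d' \<in> atlas N" "q \<in> fst d'" "V \<in> tangent_space N q" "V \<noteq> (\<lambda>s. 0)" for d' q V
  proof -
    obtain j where "j < mdim N" "V (d', j) \<noteq> 0" using tangent_nonzero_component[OF N V] by blast
    then show ?thesis unfolding coord_sqnorm_def by (intro sum_pos2[of _ j]) auto
  qed
  have in_ball: "snd d p \<in> cball_Cspace n a' \<rho>' \<and> f p \<in> fst d' \<and> snd d' (f p) \<in> coord_map f d d' ` cball_Cspace n a' \<rho>'"
    if "(d, d', a', \<rho>') \<in> F" "p \<in> fst d" "cutoff n a' \<rho>' (snd d p) > 0" for d d' a' \<rho>' p
  proof -
    note ball = F(2)[OF that(1)]
    have dC: "d \<in> atlas M" using ball_charts(1)[OF M N f ball] .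
    have 1: "snd d p \<in> cball_Cspace n a' \<rho>'"
      using chart_Cspace[OF M dC that(2)] that(3) by (simp add: cball_Cspace_def cutoff_def n_def)
    then have "snd d p \<in> snd d ` {p \<in> fst d. f p \<in> fst d'}" using ball_subset[OF M N f ball] by (auto simp: n_def)
    from coord_map_in[OF M N f ball this] have "f p \<in> fst d'" by (simp add: chart_inv_apply[OF M dC that(2)])
    moreover have "coord_map f d d' (snd d p) = snd d' (f p)"
      by (simp add: coord_map_def chart_inv_apply[OF M dC that(2)])
    ultimately show ?thesis using 1 by (metis image_eqI)
  qed
  obtain c0 c0' a0 \<rho>0 where k0: "(c0, c0', a0, \<rho>0) \<in> F" "p0 \<in> fst c0" "cutoff n a0 \<rho>0 (snd c0 p0) > \<rho>0 / 2"
    using cover[OF p0] unfolding n_def by blast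
  have cut0: "cutoff n a0 \<rho>0 (snd c0 p0) > 0" using k0(3) ball_charts(3)[OF M N f F(2)[OF k0(1)]] by linarith
  note b0 = in_ball[OF k0(1,2) cut0]
  obtain c c' a \<rho> i v where mx: "(c, c', a, \<rho>) \<in> F" "i < mdim M" "v \<in> PT_compact (mdim M) (cball_Cspace (mdim M) a \<rho>)"
    and max: "\<And>d d' a' \<rho>' p W. (d, d', a', \<rho>') \<in> F \<Longrightarrow> p \<in> fst d \<Longrightarrow> snd d p \<in> cball_Cspace (mdim M) a' \<rho>' \<Longrightarrow>
      W \<in> tangent_space M p \<Longrightarrow> W \<noteq> (\<lambda>s. 0) \<Longrightarrow>
      ?R (d, d', a', \<rho>') p W \<le> ?R (c, c', a, \<rho>) (PT_base M c v) (PT_vec M c i v)"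
    by (rule ratio_attains_max[OF M N f F K H k0(1,2) b0[THEN conjunct1, unfolded n_def] W0 W0nz, where k = k and A = A]) (assumption, rule that)
  note ball = F(2)[OF mx(1)]
  note cc = ball_charts[OF M N f ball]
  note vR = PT_compact_ball[OF M N f ball mx(3)]
  define p W where "p = PT_base M c v" and "W = PT_vec M c i v"
  have pc: "p \<in> fst c" unfolding p_def by (rule PT_base_in[OF M cc(1) vR(1)])
  have pt: "p \<in> topspace (mtop M)" using pc chart_dom_subset[OF M cc(1)] by blast
  have WT: "W \<in> tangent_space M p" unfolding p_def W_def by (rule PT_vec_tangent[OF M cc(1) mx(2) vR(1)])
  have Wnz: "W \<noteq> (\<lambda>s. 0)" using PT_vec_apply_self[OF M cc(1) mx(2) vR(1)] by (auto simp: W_def)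
  have Hpos: "H p W > 0" by (rule finslerD(1)[OF H pt WT Wnz])
  have snd_p: "snd c p = base_coord n v" unfolding p_def n_def by (rule PT_base_coord[OF M N f ball vR(1)])
  \<comment> \<open>The given vector with nonzero image has a positive value in the ball that
    contains \<open>p0\<close> well inside, and the maximum is at least this value.\<close>
  have pos: "?R (c, c', a, \<rho>) p W > 0"
  proof -
    have "?R (c0, c0', a0, \<rho>0) p0 W0 > 0"
      unfolding ratio_eq[OF p0 W0 push0]
      using Kpos[OF p0 W0 push0] cut0 finslerD(1)[OF H p0 W0 W0nz]
        sqpos[OF ball_charts(2)[OF M N f F(2)[OF k0(1)]] _ push_tangent[OF M N f W0 p0] push0] b0
      by simp
    also have "\<dots> \<le> ?R (c, c', a, \<rho>) p W"
      unfolding p_def W_def by (rule max[OF k0(1,2) _ W0 W0nz]) (use b0 in \<open>simp add: n_def\<close>)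
    finally show ?thesis .
  qed
  obtain b where b: "b \<in> Cspace (2 * mdim M - 1)" "\<And>j. norm (b j) \<le> 1"
    "levi (2 * mdim M - 1) (log_norm M H c i) v b \<le> - (1 / C)"
    using C(2)[OF mx(1)] mx(2,3) unfolding controls_def prod.case by blast
  obtain i' w \<beta>' L where i': "i' < mdim N" and w: "w \<in> PT_compact (mdim N) (coord_map f c c' ` cball_Cspace (mdim M) a \<rho>)"
    and \<beta>': "\<And>j. j < mdim N \<Longrightarrow> \<beta>' j = (\<Sum>l<mdim M. dz l (\<lambda>z. coord_map f c c' z j) (base_coord (mdim M) v) * b l)"
    and L: "laplacian_at0 (\<lambda>t. ln (?R (c, c', a, \<rho>) (PT_base M c (cline v b t)) (PT_vec M c i (cline v b t)))) L"
    and near: "\<forall>\<^sub>F t in nhds 0. ?R (c, c', a, \<rho>) (PT_base M c (cline v b t)) (PT_vec M c i (cline v b t)) > 0 \<and>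
      cline v b t \<in> PT_region M c \<and> base_coord (mdim M) (cline v b t) \<in> cball_Cspace (mdim M) a \<rho>"
    and q: "cutoff (mdim M) a \<rho> (base_coord (mdim M) v) > 0"
    and Lge: "L \<ge> 4 * (k * levi (2 * mdim N - 1) (log_norm N K c' i') w \<beta>'
      + A * ((\<Sum>l\<in>{mdim N..<2 * mdim N - 1}. (norm (\<beta>' l))\<^sup>2) / (mdim N)\<^sup>2
             - (\<Sum>l<mdim M. (norm (b l))\<^sup>2) * (1 / cutoff (mdim M) a \<rho> (base_coord (mdim M) v) + \<rho> / (cutoff (mdim M) a \<rho> (base_coord (mdim M) v))\<^sup>2))
      - (real k + real A) * levi (2 * mdim M - 1) (log_norm M H c i) v b)"
    by (rule laplacian_ratio[OF M N f ball mx(2) K H A(1) mx(3) pos[unfolded p_def W_def] b(1)]) (rule that)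
  define q where "q = cutoff n a \<rho> (base_coord n v)"
  have q0: "q > 0" using q by (simp add: q_def n_def)
  \<comment> \<open>For small \<open>t\<close> the line stays over the same ball, so all its points
    compete for the maximum; the logarithm is monotone because the values are positive
    there.\<close>
  have L0: "L \<le> 0"
  proof (rule laplacian_at0_local_max[OF L], rule eventually_mono[OF near])
    fix t assume t: "?R (c, c', a, \<rho>) (PT_base M c (cline v b t)) (PT_vec M c i (cline v b t)) > 0 \<and>
      cline v b t \<in> PT_region M c \<and> base_coord (mdim M) (cline v b t) \<in> cball_Cspace (mdim M) a \<rho>"
    let ?v = "cline v b t"
    have R: "?v \<in> PT_region M c" using t by blast
    have "?R (c, c', a, \<rho>) (PT_base M c ?v) (PT_vec M c i ?v) \<le> ?R (c, c', a, \<rho>) (PT_base M c v) (PT_vec M c i v)"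
    proof (rule max[OF mx(1) PT_base_in[OF M cc(1) R] _ PT_vec_tangent[OF M cc(1) mx(2) R]])
      show "snd c (PT_base M c ?v) \<in> cball_Cspace (mdim M) a \<rho>"
        unfolding PT_base_coord[OF M N f ball R] using t by blast
      show "PT_vec M c i ?v \<noteq> (\<lambda>s. 0)" using PT_vec_apply_self[OF M cc(1) mx(2) R] by auto
    qed
    then show "ln (?R (c, c', a, \<rho>) (PT_base M c (cline v b t)) (PT_vec M c i (cline v b t))) \<le>
      ln (?R (c, c', a, \<rho>) (PT_base M c (cline v b 0)) (PT_vec M c i (cline v b 0)))"
      using t by simp
  qed
  have q\<delta>: "q \<ge> \<delta>"
  proof -
    \<comment> \<open>Near the boundary of a ball the ratio is smaller than the one for a ball that contains the
      point well inside; the fixed metric \<open>K1\<close> compares the coordinates of the two.\<close>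
    let ?V = "push M N f p W"
    have Vnz: "?V \<noteq> (\<lambda>s. 0)"
    proof
      assume "?V = (\<lambda>s. 0)"
      then have "?R (c, c', a, \<rho>) p W = 0" using k(1) by (simp add: ratio_def extend0_def)
      then show False using pos by simp
    qed
    have VT: "?V \<in> tangent_space N (f p)" by (rule push_tangent[OF M N f WT pt])
    obtain d d' a' \<rho>' where d: "(d, d', a', \<rho>') \<in> F" "p \<in> fst d" "cutoff n a' \<rho>' (snd d p) > \<rho>' / 2"
      using cover[OF pt] unfolding n_def by blast
    note dc = ball_charts[OF M N f F(2)[OF d(1)]]
    have cutd: "cutoff n a' \<rho>' (snd d p) > 0" using d(3) dc(3) by linarith
    note bd = in_ball[OF d(1,2) cutd]
    have cutc: "cutoff n a \<rho> (snd c p) = q" by (simp add: q_def snd_p)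
    have bc: "f p \<in> fst c'" "snd c' (f p) \<in> coord_map f c c' ` cball_Cspace n a \<rho>"
      using in_ball[OF mx(1) pc] q0 cutc by auto
    have sq: "coord_sqnorm N c' ?V > 0" "coord_sqnorm N d' ?V > 0"
      using sqpos[OF cc(2) bc(1) VT Vnz] sqpos[OF dc(2) _ VT Vnz] bd by auto
    have "?R (d, d', a', \<rho>') p W \<le> ?R (c, c', a, \<rho>) p W"
      using max[OF d(1,2) _ WT Wnz] bd unfolding p_def W_def n_def by blast
    \<comment> \<open>Both values belong to the same vector at the same point, so the powers of
      \<open>K\<close> and \<open>H\<close> cancel and only the \<open>A\<close>-th powers are
      left.\<close>
    then have "(cutoff n a' \<rho>' (snd d p) * coord_sqnorm N d' ?V) ^ A \<le> (q * coord_sqnorm N c' ?V) ^ A"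
      unfolding ratio_eq[OF pt WT Vnz] cutc using Hpos Kpos[OF pt WT Vnz]
      by (simp add: divide_le_cancel)
    then have 1: "cutoff n a' \<rho>' (snd d p) * coord_sqnorm N d' ?V \<le> q * coord_sqnorm N c' ?V"
      by (rule power_mono_iff[THEN iffD1, rotated 3]) (use A(1) q0 sq cutd in simp_all)
    have K1le: "K1 (f p) ?V \<le> C * coord_sqnorm N d' ?V" "coord_sqnorm N c' ?V \<le> C * K1 (f p) ?V"
      using C(2)[OF d(1)] C(2)[OF mx(1)] bd bc VT Vnz unfolding controls_def prod.case n_def by blast+
    have "1 \<le> C * \<rho>'" using C(2)[OF d(1)] unfolding controls_def prod.case by blast
    then have "1 / (2 * C) \<le> \<rho>' / 2" using C(1) by (simp add: field_simps)
    then have 2: "1 / (2 * C) \<le> cutoff n a' \<rho>' (snd d p)" using d(3) by linarith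
    have "coord_sqnorm N c' ?V \<le> C * (C * coord_sqnorm N d' ?V)"
      using K1le C(1) by (meson mult_left_mono order_trans less_imp_le)
    \<comment> \<open>Origin of \<delta>: passing through \<open>K1\<close> from one coordinate
      length to the other costs \<open>C\<close> twice, and the cutoff of the competing ball is at
      least \<open>1 / (2 * C)\<close>.\<close>
    then have "coord_sqnorm N c' ?V / (2 * C ^ 3) \<le> C * (C * coord_sqnorm N d' ?V) / (2 * C ^ 3)"
      using C(1) by (intro divide_right_mono) auto
    also have "\<dots> = 1 / (2 * C) * coord_sqnorm N d' ?V" using C(1) by (simp add: power3_eq_cube)
    also have "\<dots> \<le> cutoff n a' \<rho>' (snd d p) * coord_sqnorm N d' ?V" using 2 sq by (intro mult_right_mono) auto
    also note 1
    finally have "\<delta> * coord_sqnorm N c' ?V \<le> q * coord_sqnorm N c' ?V" by (simp add: \<delta>_def)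
    then show ?thesis using sq by simp
  qed
  let ?J = "{m..<2 * m - 1}"
  define T where "T = (\<Sum>l\<in>?J. (norm (\<beta>' l))\<^sup>2)"
  define lk where "lk = levi (2 * m - 1) (log_norm N K c' i') w \<beta>'"
  define lh where "lh = levi (2 * n - 1) (log_norm M H c i) v b"
  have T0: "T \<ge> 0" by (simp add: T_def sum_nonneg)
  have "w \<in> PT_region N c'"
    using w PT_compact_subset[OF coord_map_ball_subset[OF M N f ball]] by blast
  from Kn[OF cc(2) i' this, of \<beta>']
  have "lk \<ge> - (1 / k) * Re (\<Sum>l<2 * m - 1. \<Sum>j<2 * m - 1. \<Omega> c' i' w l j * \<beta>' l * cnj (\<beta>' j))"
    by (simp add: lk_def m_def)
  \<comment> \<open>The base part of \<beta>' is the differential applied to \<open>b\<close>, and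
    its squared norm is at most \<open>C\<close>; only the fibre part \<open>T\<close> stays
    unbounded. Multiplied by \<open>k\<close>, the bound loses its factor \<open>1 / k\<close>, so
    the total loss \<open>C * (C + T)\<close> is independent of \<open>k\<close>.\<close>
  moreover have "Re (\<Sum>l<2 * m - 1. \<Sum>j<2 * m - 1. \<Omega> c' i' w l j * \<beta>' l * cnj (\<beta>' j)) \<le> C * (C + T)"
  proof -
    have "Re (\<Sum>l<2 * m - 1. \<Sum>j<2 * m - 1. \<Omega> c' i' w l j * \<beta>' l * cnj (\<beta>' j)) \<le> C * (\<Sum>l<2 * m - 1. (norm (\<beta>' l))\<^sup>2)"
      using C(2)[OF mx(1)] i' w unfolding controls_def prod.case m_def by blast
    also have "(\<Sum>l<2 * m - 1. (norm (\<beta>' l))\<^sup>2) = (\<Sum>l<m. (norm (\<beta>' l))\<^sup>2) + T"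
    proof -
      have "{..<2 * m - 1} = {..<m} \<union> ?J" using i' by (auto simp: m_def)
      moreover have "(\<Sum>l\<in>{..<m} \<union> ?J. (norm (\<beta>' l))\<^sup>2) = (\<Sum>l<m. (norm (\<beta>' l))\<^sup>2) + T"
        unfolding T_def by (rule sum.union_disjoint) auto
      ultimately show ?thesis by (simp only:)
    qed
    also have "(\<Sum>l<m. (norm (\<beta>' l))\<^sup>2) \<le> C"
    proof -
      have "(\<Sum>l<m. (norm (\<beta>' l))\<^sup>2) = (\<Sum>j<m. (norm (\<Sum>l<mdim M. dz l (\<lambda>z. coord_map f c c' z j) (base_coord (mdim M) v) * b l))\<^sup>2)"
        by (intro sum.cong refl) (simp add: \<beta>' m_def)
      also have "\<dots> \<le> C"
        using C(2)[OF mx(1)] vR(2) b(2) unfolding controls_def prod.case m_def by blast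
      finally show ?thesis .
    qed
    finally show ?thesis using C(1) by (simp add: mult_left_mono)
  qed
  ultimately have 1: "k * lk \<ge> - (C * (C + T))"
    using k(1) by (simp add: field_simps)
  \<comment> \<open>This is where the unbounded term \<open>C * T\<close> is absorbed.\<close>
  have 2: "A * (T / m\<^sup>2) \<ge> C * T"
  proof -
    have m0: "m > 0" using i' by (simp add: m_def)
    have "C * m\<^sup>2 * (T / m\<^sup>2) \<le> A * (T / m\<^sup>2)" using A(2) T0 by (intro mult_right_mono) auto
    then show ?thesis using m0 by simp
  qed
  have "(\<Sum>l<n. (norm (b l))\<^sup>2) * (1 / q + \<rho> / q\<^sup>2) \<le> E0"
    unfolding E0_def
  proof (intro mult_mono add_mono)
    have "(\<Sum>l<n. (norm (b l))\<^sup>2) \<le> (\<Sum>l<n. 1)" using b(2) by (intro sum_mono) (simp add: power_le_one)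
    then show "(\<Sum>l<n. (norm (b l))\<^sup>2) \<le> n" by simp
    show "1 / q \<le> 1 / \<delta>" using q\<delta> \<delta> by (simp add: frac_le)
    have "\<rho> \<le> C" using C(2)[OF mx(1)] unfolding controls_def prod.case by blast
    then show "\<rho> / q\<^sup>2 \<le> C / \<delta>\<^sup>2" using q\<delta> \<delta> C(1) by (intro frac_le power_mono) auto
    show "0 \<le> 1 / q + \<rho> / q\<^sup>2" using q0 cc(3) by simp
  qed simp
  then have 3: "A * ((\<Sum>l<n. (norm (b l))\<^sup>2) * (1 / q + \<rho> / q\<^sup>2)) \<le> A * E0"
    by (intro mult_left_mono) auto
  have 4: "(real k + real A) * lh \<le> - (k / C)"
  proof -
    have "(real k + real A) * lh \<le> (real k + real A) * (- (1 / C))"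
      using b(3) by (intro mult_left_mono) (auto simp: lh_def n_def)
    also have "\<dots> \<le> - (k / C)" using C(1) by (simp add: field_simps)
    finally show ?thesis by simp
  qed
  have 5: "k / C > C\<^sup>2 + A * E0" using k(2) C(1) by (simp add: field_simps)
  \<comment> \<open>In the sum of the estimates \<open>C * T\<close> cancels, and the rest is at
    least \<open>k / C - C\<^sup>2 - A * E0\<close>, which is positive by the choice of
    \<open>k\<close>.\<close>
  define Z where "Z = k * lk + A * (T / m\<^sup>2 - (\<Sum>l<n. (norm (b l))\<^sup>2) * (1 / q + \<rho> / q\<^sup>2)) - (real k + real A) * lh"
  have "L \<ge> 4 * Z"
    using Lge by (simp add: Z_def lk_def lh_def T_def q_def n_def m_def)
  moreover have "Z > 0"
  proof -
    define x y z where "x = A * (T / m\<^sup>2)" and "y = A * ((\<Sum>l<n. (norm (b l))\<^sup>2) * (1 / q + \<rho> / q\<^sup>2))"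
      and "z = (real k + real A) * lh"
    have "Z = k * lk + (x - y) - z" by (simp only: Z_def x_def y_def z_def right_diff_distrib)
    moreover have "C * (C + T) = C\<^sup>2 + C * T" by (simp add: power2_eq_square distrib_left)
    moreover note 1 2[folded x_def] 3[folded y_def] 4[folded z_def] 5
    ultimately show ?thesis by linarith
  qed
  ultimately show False using L0 by linarith
qed

end
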